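(* Let $\Delta(x)=\sum^*_{n\le x}\mu(n)$, where $\mu$ is the Möbius function. Let $s_0$ be the nontrivial zero of $\zeta(s)$ with least positive imaginary part, and let $\lambda=|s_0|^{-1}\left|\mathrm{Res}_{s=s_0}\frac{1}{\zeta(s)}\right|$. Fix $\epsilon_0$ with $0<\epsilon_0<\lambda$ and put $$\mathcal{A}_1=\{x\ge1:\Delta(x)>(\lambda-\epsilon_0)x^{1/2}\},\qquad \mathcal{A}_2=\{x\ge1:\Delta(x)<(-\lambda+\epsilon_0)x^{1/2}\}.$$ Then (unconditionally), for $j=1,2$ and for any $\epsilon>0$, as $T\to\infty$, $$\mathfrak{m}(\mathcal{A}_j\cap[T,2T])=\Omega\left(T^{1-\epsilon}\right).$$
   Context: $\sum^*_{n\le x}$ means that when $x\in\mathbb{N}$ the last term $n=x$ is counted with weight $\frac12$. $\mathfrak{m}$ is Lebesgue measure on $\mathbb{R}$. For nonnegative $F$ and positive $f$, $F(T)=\Omega(f(T))$ as $T\to\infty$ means $\limsup_{T\to\infty}F(T)/f(T)>0$. Numerically $s_0=\frac12+i\,14.134\ldots$. *)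

theory Defs
  imports
    "HOL-Complex_Analysis.Complex_Analysis"
    "HOL-Computational_Algebra.Computational_Algebra"
begin

definition moebius_mu :: "nat \<Rightarrow> int" where
  "moebius_mu n = (if squarefree n then (- 1) ^ card (prime_factors n) else 0)"

(* The sum over positive n \<le> x in which a last term with n = x has weight 1/2. *)
definition star_sum :: "(nat \<Rightarrow> real) \<Rightarrow> real \<Rightarrow> real" where
  "star_sum f x = (\<Sum>n | 1 \<le> n \<and> real n \<le> x. (if real n = x then 1 / 2 else 1) * f n)"

definition Delta :: "real \<Rightarrow> real" where
  "Delta x = star_sum (\<lambda>n. of_int (moebius_mu n)) x"

(* The analytic continuation of the Dirichlet series to the plane without the pole s = 1.
   The value at the pole is a junk value, fixed only to make the total function unique. *)
definition zeta :: "complex \<Rightarrow> complex" where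
  "zeta = (THE f. f holomorphic_on (- {1}) \<and>
                  (\<forall>s. Re s > 1 \<longrightarrow> f s = (\<Sum>n. 1 / of_nat (Suc n) powr s)) \<and>
                  f 1 = 0)"

(* The conjunct s \<noteq> 1 discards the junk value at the pole. *)
definition nontrivial_zeta_zero :: "complex \<Rightarrow> bool" where
  "nontrivial_zeta_zero s \<longleftrightarrow>
     s \<noteq> 1 \<and> zeta s = 0 \<and> \<not> (\<exists>n::nat. n \<ge> 1 \<and> s = - 2 * of_nat n)"

definition is_first_zeta_zero :: "complex \<Rightarrow> bool" where
  "is_first_zeta_zero s \<longleftrightarrow> is_arg_min Im (\<lambda>z. nontrivial_zeta_zero z \<and> Im z > 0) s"

(* The Omega of analytic number theory, i.e. the negation of F = o(f) for nonnegative F.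
   It is weaker than bigomega of HOL-Library.Landau_Symbols, which asks for
   a lower bound at all large T. *)
definition is_Omega :: "(real \<Rightarrow> real) \<Rightarrow> (real \<Rightarrow> real) \<Rightarrow> bool" where
  "is_Omega F f \<longleftrightarrow> Limsup at_top (\<lambda>T. ereal (F T / f T)) > 0"

definition A1 :: "real \<Rightarrow> real \<Rightarrow> real set" where
  "A1 l e = {x. x \<ge> 1 \<and> Delta x > (l - e) * x powr (1 / 2)}"

definition A2 :: "real \<Rightarrow> real \<Rightarrow> real set" where
  "A2 l e = {x. x \<ge> 1 \<and> Delta x < (- l + e) * x powr (1 / 2)}"

end

theory Submission
  imports Defs "HOL-Probability.Probability"
begin

text \<open>
  Put \<open>x = e\<^sup>u\<close> and let \<open>F(s)\<close> be the Laplace transform of \<open>M(e\<^sup>u)\<close>, so that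
  \<open>s F(s) \<zeta>(s) = 1\<close>. Suppose the set \<open>A\<close> where \<open>\<plusminus>M(x) > C x\<^sup>1\<^sup>/\<^sup>2\<close> has measure
  \<open>O(T\<^sup>1\<^sup>-\<^sup>\<delta>)\<close> in \<open>[T, 2T]\<close>, and let \<open>c \<ge> 1/2\<close> be such that \<open>F\<close> converges absolutely for
  \<open>Re s > c\<close>. There \<open>1/\<zeta>(s) = s F(s)\<close> grows at most linearly, hence (Littlewood's argument for
  \<open>log \<zeta>\<close>) slower than any power, and Gaussian smoothing gives \<open>M(x) = O(x\<^sup>c\<^sup>+\<^sup>\<epsilon>)\<close>. As \<open>A\<close> is
  sparse, its contribution to the transform of \<open>C x\<^sup>1\<^sup>/\<^sup>2 \<mp> M(x)\<close> is holomorphic for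
  \<open>Re s > c - \<delta>\<close>; the rest is nonnegative, so Landau's theorem moves the abscissa below \<open>c\<close>
  unless \<open>c = 1/2\<close>. Thus \<open>\<zeta>\<close> has no zeros to the right of the critical line and, by the functional
  equation, \<open>s\<^sub>0\<close> lies on it. Comparing the transform of the nonnegative part at
  \<open>\<sigma> + i Im s\<^sub>0\<close> with its value at \<open>\<sigma>\<close> as \<open>\<sigma> \<rightarrow> 1/2\<close> yields \<open>\<lambda> \<le> C\<close>.
\<close>

subsection \<open>Laplace transforms\<close>

text \<open>The hypothesis controls the measure of the exceptional set but not the size of the
  Mertens function on it. With the trivial bound \<open>exp u\<close> the contribution of that set
  would be holomorphic only for Re s > 1 - \<delta>, which gains nothing once c \<le> 1 - \<delta>.
  A pointwise bound with exponent close to the current c is what turns a saving \<delta> in measure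
  into a saving \<delta> in the abscissa, wherever c lies in [1/2, 1]. No zero-free region is
  assumed for it: absolute convergence of F to the right of c supplies both the absence of zeros of
  zeta there and the linear bound on which Littlewood's argument rests. \<open>zeta\<close> is
  specified only by its properties, so its continuation has to be constructed. Riemann's theta
  integral gives it together with the functional equation, and the functional equation of theta
  comes from Poisson summation. The constant \<lambda> is 1 / |s0 zeta'(s0)|. The last comparison is
  kept in product form, 1 \<le> C |s0| |zeta'(s0)|, and so also proves that s0 is a simple zero.
  With C = \<lambda> - \<epsilon>0 the conclusion \<lambda> \<le> C is absurd.\<close>

definition laplace :: "'a measure \<Rightarrow> ('a \<Rightarrow> real) \<Rightarrow> ('a \<Rightarrow> real) \<Rightarrow> complex \<Rightarrow> complex" where
  "laplace N l f s = (\<integral>x. of_real (f x) * exp (- (s * of_real (l x))) \<partial>N)"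

text \<open>Convergence is absolute and is asked at a real point only; for \<open>l\<close> \<ge> 0
  it then holds on the closed half-plane to the right. The half-line with \<open>l u = u\<close> and
  the counting measure with \<open>l n = ln (n + 1)\<close> are the two instances, so integrals and
  Dirichlet series share one theory.\<close>

definition laplace_conv :: "'a measure \<Rightarrow> ('a \<Rightarrow> real) \<Rightarrow> ('a \<Rightarrow> real) \<Rightarrow> real \<Rightarrow> bool" where
  "laplace_conv N l f a \<longleftrightarrow> integrable N (\<lambda>x. f x * exp (- (a * l x)))"

lemma norm_laplace_integrand:
  "norm (complex_of_real y * exp (- (s * complex_of_real t))) = \<bar>y\<bar> * exp (- (Re s * t))"
  by (simp add: norm_mult)

lemma laplace_conv_mono:
  assumes [measurable]: "l \<in> borel_measurable N" "f \<in> borel_measurable N"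
    and l: "\<And>x. x \<in> space N \<Longrightarrow> l x \<ge> 0"
    and a: "laplace_conv N l f a" and b: "a \<le> b"
  shows "laplace_conv N l f b"
  unfolding laplace_conv_def
proof (rule Bochner_Integration.integrable_bound[OF a[unfolded laplace_conv_def]])
  show "AE x in N. norm (f x * exp (- (b * l x))) \<le> norm (f x * exp (- (a * l x)))"
    using l b by (intro AE_I2) (auto simp: abs_mult intro!: mult_left_mono mult_right_mono)
qed measurable

lemma laplace_integrable:
  assumes [measurable]: "l \<in> borel_measurable N" "f \<in> borel_measurable N"
    and l: "\<And>x. x \<in> space N \<Longrightarrow> l x \<ge> 0"
    and a: "laplace_conv N l f a" and b: "a \<le> Re s"
  shows "integrable N (\<lambda>x. of_real (f x) * exp (- (s * of_real (l x))))"
proof (rule Bochner_Integration.integrable_bound)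
  show "integrable N (\<lambda>x. f x * exp (- (Re s * l x)))"
    using laplace_conv_mono[OF assms] by (simp add: laplace_conv_def)
  show "AE x in N. norm (complex_of_real (f x) * exp (- (s * of_real (l x)))) \<le> norm (f x * exp (- (Re s * l x)))"
    by (simp only: norm_laplace_integrand) (simp add: abs_mult)
qed measurable

lemma norm_laplace_le:
  assumes [measurable]: "l \<in> borel_measurable N" "f \<in> borel_measurable N"
    and l: "\<And>x. x \<in> space N \<Longrightarrow> l x \<ge> 0"
    and a: "laplace_conv N l f a" and b: "a \<le> Re s"
  shows "norm (laplace N l f s) \<le> (\<integral>x. \<bar>f x\<bar> * exp (- (a * l x)) \<partial>N)"
proof -
  have i: "integrable N (\<lambda>x. \<bar>f x\<bar> * exp (- (a * l x)))"
    using integrable_norm[OF a[unfolded laplace_conv_def]] by (simp add: abs_mult)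
  have "norm (laplace N l f s) \<le> (\<integral>x. norm (of_real (f x) * exp (- (s * of_real (l x)))) \<partial>N)"
    unfolding laplace_def by (rule integral_norm_bound)
  also have "\<dots> \<le> (\<integral>x. \<bar>f x\<bar> * exp (- (a * l x)) \<partial>N)"
    using l b by (intro integral_mono[OF integrable_norm[OF laplace_integrable[OF assms]] i])
      (auto simp only: norm_laplace_integrand, auto intro!: mult_left_mono mult_right_mono)
  finally show ?thesis .
qed

lemma laplace_of_real:
  "laplace N l f (of_real s) = of_real (\<integral>x. f x * exp (- (s * l x)) \<partial>N)"
  unfolding laplace_def
  by (subst integral_complex_of_real[symmetric]) (simp flip: exp_of_real)

text \<open>Coefficients in powers of c - s rather than s - c. For real c and nonnegative
  \<open>f\<close> and \<open>l\<close> this makes all of them nonnegative, which is what Landau's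
  argument exploits.\<close>

definition laplace_coeff :: "'a measure \<Rightarrow> ('a \<Rightarrow> real) \<Rightarrow> ('a \<Rightarrow> real) \<Rightarrow> complex \<Rightarrow> nat \<Rightarrow> complex" where
  "laplace_coeff N l f c n =
     (\<integral>x. of_real (f x) * exp (- (c * of_real (l x))) * of_real (l x) ^ n /\<^sub>R fact n \<partial>N)"

text \<open>The exponential of z l may be expanded under the integral because the absolute values of
  the terms add up to |f| exp(-(Re c - |z|) l), which is at most the integrable |f| exp(-a l). The
  closed disc is allowed since convergence is assumed at \<open>a\<close> itself.\<close>

lemma laplace_expansion:
  assumes [measurable]: "l \<in> borel_measurable N" "f \<in> borel_measurable N"
    and l: "\<And>x. x \<in> space N \<Longrightarrow> l x \<ge> 0"
    and a: "laplace_conv N l f a" and z: "norm z \<le> Re c - a"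
  shows "(\<lambda>n. laplace_coeff N l f c n * z ^ n) sums laplace N l f (c - z)"
proof -
  define g where "g n x = (of_real (f x) * exp (- (c * of_real (l x))) * of_real (l x) ^ n /\<^sub>R fact n) * z ^ n" for n x
  have g [measurable]: "g n \<in> borel_measurable N" for n unfolding g_def by measurable
  define B where "B x = \<bar>f x\<bar> * exp (- (a * l x))" for x
  have B: "integrable N B"
    using integrable_norm[OF a[unfolded laplace_conv_def]] unfolding B_def by (simp add: abs_mult)
  have ng: "norm (g n x) = \<bar>f x\<bar> * exp (- (Re c * l x)) * ((l x * norm z) ^ n /\<^sub>R fact n)" if "x \<in> space N" for n x
    unfolding g_def using l[OF that]
    by (simp add: norm_mult norm_power power_mult_distrib field_simps)
  have gs: "(\<lambda>n. g n x) sums (of_real (f x) * exp (- ((c - z) * of_real (l x))))" for x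
  proof -
    have "(\<lambda>n. (z * of_real (l x)) ^ n /\<^sub>R fact n) sums exp (z * of_real (l x))"
      by (rule exp_converges)
    hence "(\<lambda>n. of_real (f x) * exp (- (c * of_real (l x))) * ((z * of_real (l x)) ^ n /\<^sub>R fact n)) sums
        (of_real (f x) * exp (- (c * of_real (l x))) * exp (z * of_real (l x)))"
      by (rule sums_mult)
    moreover have "exp (- (c * of_real (l x))) * exp (z * of_real (l x)) = exp (- ((c - z) * of_real (l x)))"
      by (simp add: exp_add[symmetric] algebra_simps)
    ultimately show ?thesis
      by (simp add: g_def power_mult_distrib mult_ac scaleR_conv_of_real)
  qed
  have ns: "(\<lambda>n. norm (g n x)) sums (\<bar>f x\<bar> * exp (- (Re c * l x)) * exp (l x * norm z))" if "x \<in> space N" for x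
    unfolding ng[OF that] by (intro sums_mult exp_converges)
  have nb: "\<bar>f x\<bar> * exp (- (Re c * l x)) * exp (l x * norm z) \<le> B x" if "x \<in> space N" for x
  proof -
    have "l x * norm z \<le> l x * (Re c - a)" using l[OF that] z by (intro mult_left_mono) auto
    hence "exp (- (Re c * l x)) * exp (l x * norm z) \<le> exp (- (a * l x))"
      by (simp add: exp_add[symmetric] algebra_simps)
    thus ?thesis unfolding B_def by (simp add: mult_left_mono mult.assoc)
  qed
  have gB: "(\<Sum>i\<in>I. norm (g i x)) \<le> B x" if "x \<in> space N" "finite I" for x I
    using sum_le_suminf[OF sums_summable[OF ns[OF that(1)]] that(2)] sums_unique[OF ns[OF that(1)]] nb[OF that(1)]
    by simp
  have gi: "integrable N (g n)" for n
  proof (rule Bochner_Integration.integrable_bound[OF B])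
    show "AE x in N. norm (g n x) \<le> norm (B x)"
    proof (rule AE_I2)
      fix x assume "x \<in> space N"
      from gB[OF this, of "{n}"] show "norm (g n x) \<le> norm (B x)" by simp
    qed
  qed measurable
  have "summable (\<lambda>n. \<integral>x. norm (g n x) \<partial>N)"
  proof (rule summableI_nonneg_bounded)
    fix n
    show "0 \<le> (\<integral>x. norm (g n x) \<partial>N)" by (rule integral_nonneg_AE) auto
    have "(\<Sum>i<n. \<integral>x. norm (g i x) \<partial>N) = (\<integral>x. (\<Sum>i<n. norm (g i x)) \<partial>N)"
      by (rule Bochner_Integration.integral_sum[symmetric]) (auto intro: gi)
    also have "\<dots> \<le> integral\<^sup>L N B"
      by (rule integral_mono) (auto intro!: gi B gB)
    finally show "(\<Sum>i<n. \<integral>x. norm (g i x) \<partial>N) \<le> integral\<^sup>L N B" .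
  qed
  hence "(\<lambda>n. integral\<^sup>L N (g n)) sums (\<integral>x. (\<Sum>n. g n x) \<partial>N)"
    by (intro sums_integral gi) (auto intro!: AE_I2 sums_summable ns)
  moreover have "(\<Sum>n. g n x) = of_real (f x) * exp (- ((c - z) * of_real (l x)))" for x
    using gs by (rule sums_unique[symmetric])
  moreover have "integral\<^sup>L N (g n) = laplace_coeff N l f c n * z ^ n" for n
    unfolding g_def laplace_coeff_def by simp
  ultimately show ?thesis unfolding laplace_def by simp
qed

lemma laplace_holomorphic:
  assumes [measurable]: "l \<in> borel_measurable N" "f \<in> borel_measurable N"
    and l: "\<And>x. x \<in> space N \<Longrightarrow> l x \<ge> 0"
    and a: "laplace_conv N l f a"
  shows "laplace N l f holomorphic_on {s. Re s > a}"
proof -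
  have "laplace N l f field_differentiable (at c)" if c: "Re c > a" for c
  proof -
    have "laplace N l f holomorphic_on ball c (Re c - a)"
    proof (rule power_series_holomorphic)
      fix w assume "w \<in> ball c (Re c - a)"
      hence "norm (c - w) \<le> Re c - a" by (simp add: dist_norm)
      from laplace_expansion[OF assms this]
      show "(\<lambda>n. (laplace_coeff N l f c n * (-1) ^ n) * (w - c) ^ n) sums laplace N l f w"
        by (simp add: mult.assoc power_mult_distrib[symmetric])
    qed
    thus ?thesis
      using c by (elim holomorphic_on_imp_differentiable_at) auto
  qed
  thus ?thesis
    by (auto simp: holomorphic_on_def intro: field_differentiable_at_within)
qed

text \<open>The difference of the series sums to 0 everywhere, whereas a nonzero coefficient of
  positive index would make the sum nonzero in a punctured disc. Index 0 is read off at x =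
  c.\<close>

lemma power_series_coeff_unique:
  fixes a b :: "nat \<Rightarrow> complex"
  assumes "r > 0"
    and A: "\<And>x. norm (x - c) < r \<Longrightarrow> (\<lambda>n. a n * (x - c) ^ n) sums f x"
    and B: "\<And>x. norm (x - c) < r \<Longrightarrow> (\<lambda>n. b n * (x - c) ^ n) sums f x"
  shows "a n = b n"
proof -
  have D: "(\<lambda>n. (a n - b n) * (x - c) ^ n) sums 0" if "norm (x - c) < r" for x
    using sums_diff[OF A[OF that] B[OF that]] by (simp add: algebra_simps)
  show ?thesis
  proof (cases "n = 0")
    case True
    thus ?thesis using D[of c] \<open>r > 0\<close> by simp
  next
    case False
    show ?thesis
    proof (rule ccontr)
      assume "a n \<noteq> b n"
      then obtain s where "0 < s" and s: "\<And>z. z \<in> cball c s - {c} \<Longrightarrow> (0::complex) \<noteq> 0"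
        using powser_0_nonzero[OF \<open>r > 0\<close>, of c "\<lambda>n. a n - b n" "\<lambda>_. 0" n] D False by auto
      thus False using s[of "c + of_real s"] by (auto simp: dist_norm)
    qed
  qed
qed

text \<open>
  The Taylor series of \<open>H\<close> about a point to the right of \<open>a\<close> converges to the left of \<open>a\<close>, and its
  terms are nonnegative there, so Tonelli's theorem turns it back into the transform.
\<close>

lemma laplace_landau:
  assumes [measurable]: "l \<in> borel_measurable N" "f \<in> borel_measurable N"
    and l: "\<And>x. x \<in> space N \<Longrightarrow> l x \<ge> 0" and f: "\<And>x. x \<in> space N \<Longrightarrow> f x \<ge> 0"
    and a: "\<And>s. s > a \<Longrightarrow> laplace_conv N l f s"
    and r: "r > 0" and H: "H holomorphic_on ball (of_real a) r"
    and eq: "\<And>s. s \<in> ball (of_real a) r \<Longrightarrow> Re s > a \<Longrightarrow> H s = laplace N l f s"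
  shows "\<exists>b<a. laplace_conv N l f b"
proof -
  \<comment> \<open>The disc of radius r/2 about this centre stays in the domain of
    \<open>H\<close>, as r/4 + r/2 < r, and reaches to the left of a. The point c - t used below,
    with t = 3 r / 8, is a - r/8.\<close>
  define c where "c = a + r / 4"
  define \<beta> where "\<beta> n = (\<integral>x. f x * exp (- (c * l x)) * l x ^ n /\<^sub>R fact n \<partial>N)" for n
  have \<beta>: "laplace_coeff N l f (of_real c) n = of_real (\<beta> n)" for n
    unfolding laplace_coeff_def \<beta>_def
    by (subst integral_complex_of_real[symmetric]) (simp add: scaleR_conv_of_real flip: exp_of_real)
  have sub: "ball (of_real c :: complex) (r / 2) \<subseteq> ball (of_real a) r"
  proof
    fix x :: complex assume "x \<in> ball (of_real c) (r / 2)"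
    moreover have "dist (of_real a :: complex) x \<le> dist (of_real a) (of_real c :: complex) + dist (of_real c) x"
      by (rule dist_triangle)
    moreover have "dist (of_real a) (of_real c :: complex) = r / 4"
      using r by (simp add: dist_norm c_def flip: of_real_diff del: of_real_add)
    ultimately show "x \<in> ball (of_real a) r" using r by simp
  qed
  define \<gamma> where "\<gamma> n = (deriv ^^ n) H (of_real c) / fact n" for n
  have \<gamma>: "(\<lambda>n. \<gamma> n * (w - of_real c) ^ n) sums H w" if "w \<in> ball (of_real c) (r / 2)" for w
    unfolding \<gamma>_def
    by (rule holomorphic_power_series[OF holomorphic_on_subset[OF H sub] that])
  \<comment> \<open>The two expansions are compared on the disc of radius r/8 about c. There Re x >
    a + r/8, so the transform itself still converges.\<close>
  have eqc: "\<gamma> n = of_real (\<beta> n) * (- 1) ^ n" for n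
  proof (rule power_series_coeff_unique[where r = "r / 8" and c = "of_real c" and f = H])
    fix x :: complex assume x: "norm (x - of_real c) < r / 8"
    show "(\<lambda>n. \<gamma> n * (x - of_real c) ^ n) sums H x"
      using x r by (intro \<gamma>) (auto simp: dist_norm norm_minus_commute)
    have "\<bar>Re (x - of_real c)\<bar> < r / 8" using abs_Re_le_cmod[of "x - of_real c"] x by linarith
    hence "Re x > c - r / 8" unfolding abs_less_iff by simp
    hence Re: "Re x > a" using r by (simp add: c_def)
    have "x \<in> ball (of_real c) (r / 2)" using x r by (auto simp: dist_norm norm_minus_commute)
    hence xb: "x \<in> ball (of_real a) r" using sub by blast
    have "(\<lambda>n. laplace_coeff N l f (of_real c) n * (of_real c - x) ^ n) sums laplace N l f (of_real c - (of_real c - x))"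
      using x r by (intro laplace_expansion[where a = "a + r / 8"] assms)
         (auto simp: norm_minus_commute c_def)
    thus "(\<lambda>n. of_real (\<beta> n) * (- 1) ^ n * (x - of_real c) ^ n) sums H x"
      using eq[OF xb Re] by (simp add: \<beta> mult.assoc power_mult_distrib[symmetric])
  qed (use r in auto)
  define t where "t = 3 * r / 8"
  have "(\<lambda>n. \<gamma> n * (of_real (c - t) - of_real c) ^ n) sums H (of_real (c - t))"
    using r by (intro \<gamma>) (auto simp: dist_norm t_def)
  hence "summable (\<lambda>n. complex_of_real (\<beta> n * t ^ n))"
    by (auto simp: eqc mult.assoc power_mult_distrib[symmetric] dest: sums_summable)
  hence sm: "summable (\<lambda>n. \<beta> n * t ^ n)" by (simp only: summable_complex_of_real)
  have t: "t > 0" using r by (simp add: t_def)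
  \<comment> \<open>One term of the series of exp(l r / 8) bounds l^n / n! up to the factor (8/r)^n,
    so integrability at c - r/8, still to the right of a, dominates every coefficient.\<close>
  have ci: "integrable N (\<lambda>x. f x * exp (- (c * l x)) * l x ^ n /\<^sub>R fact n)" for n
  proof (rule Bochner_Integration.integrable_bound)
    have "laplace_conv N l f (c - r / 8)" using r by (intro a) (auto simp: c_def)
    thus "integrable N (\<lambda>x. (8 / r) ^ n * (f x * exp (- ((c - r / 8) * l x))))"
      unfolding laplace_conv_def by simp
    show "AE x in N. norm (f x * exp (- (c * l x)) * l x ^ n /\<^sub>R fact n)
        \<le> norm ((8 / r) ^ n * (f x * exp (- ((c - r / 8) * l x))))"
    proof (rule AE_I2)
      fix x assume x: "x \<in> space N"
      have s: "(\<lambda>n. (r / 8 * l x) ^ n /\<^sub>R fact n) sums exp (r / 8 * l x)" by (rule exp_converges)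
      have "(r / 8 * l x) ^ n /\<^sub>R fact n \<le> exp (r / 8 * l x)"
        using sum_le_suminf[OF sums_summable[OF s], of "{n}"] sums_unique[OF s] l[OF x] r by simp
      hence "l x ^ n /\<^sub>R fact n \<le> (8 / r) ^ n * exp (r / 8 * l x)"
        using r by (simp add: power_mult_distrib power_divide field_simps)
      hence "f x * exp (- (c * l x)) * (l x ^ n /\<^sub>R fact n) \<le> f x * exp (- (c * l x)) * ((8 / r) ^ n * exp (r / 8 * l x))"
        using f[OF x] by (intro mult_left_mono) auto
      also have "\<dots> = (8 / r) ^ n * (f x * exp (- ((c - r / 8) * l x)))"
      proof -
        have "exp (- (c * l x)) * exp (r / 8 * l x) = exp (- ((c - r / 8) * l x))"
          by (simp add: exp_add[symmetric] algebra_simps)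
        moreover have "f x * exp (- (c * l x)) * ((8 / r) ^ n * exp (r / 8 * l x)) =
            (8 / r) ^ n * (f x * (exp (- (c * l x)) * exp (r / 8 * l x)))"
          by (simp only: mult_ac)
        ultimately show ?thesis by (simp only:)
      qed
      finally show "norm (f x * exp (- (c * l x)) * l x ^ n /\<^sub>R fact n)
        \<le> norm ((8 / r) ^ n * (f x * exp (- ((c - r / 8) * l x))))"
        using f[OF x] l[OF x] r by (simp add: mult_ac)
    qed
  qed measurable
  have e: "ennreal (f x * exp (- ((c - t) * l x))) =
     (\<Sum>n. ennreal (f x * exp (- (c * l x)) * l x ^ n /\<^sub>R fact n * t ^ n))" if x: "x \<in> space N" for x
  proof -
    have "(\<lambda>n. f x * exp (- (c * l x)) * ((t * l x) ^ n /\<^sub>R fact n)) sums (f x * exp (- (c * l x)) * exp (t * l x))"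
      by (intro sums_mult exp_converges)
    moreover have "f x * exp (- (c * l x)) * exp (t * l x) = f x * exp (- ((c - t) * l x))"
      by (simp add: exp_add[symmetric] algebra_simps)
    ultimately have "(\<lambda>n. f x * exp (- (c * l x)) * ((t * l x) ^ n /\<^sub>R fact n)) sums (f x * exp (- ((c - t) * l x)))"
      by (simp only:)
    hence "(\<lambda>n. f x * exp (- (c * l x)) * l x ^ n /\<^sub>R fact n * t ^ n) sums (f x * exp (- ((c - t) * l x)))"
      by (simp add: power_mult_distrib mult_ac)
    thus ?thesis using f[OF x] l[OF x] t
      by (subst suminf_ennreal_eq) auto
  qed
  have "(\<integral>\<^sup>+x. ennreal (f x * exp (- ((c - t) * l x))) \<partial>N) =
     (\<integral>\<^sup>+x. (\<Sum>n. ennreal (f x * exp (- (c * l x)) * l x ^ n /\<^sub>R fact n * t ^ n)) \<partial>N)"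
    by (intro nn_integral_cong e)
  also have "\<dots> = (\<Sum>n. \<integral>\<^sup>+x. ennreal (f x * exp (- (c * l x)) * l x ^ n /\<^sub>R fact n * t ^ n) \<partial>N)"
    by (rule nn_integral_suminf) measurable
  also have "\<dots> = (\<Sum>n. ennreal (\<beta> n * t ^ n))"
  proof (rule suminf_cong)
    fix n
    have "(\<integral>\<^sup>+x. ennreal (f x * exp (- (c * l x)) * l x ^ n /\<^sub>R fact n * t ^ n) \<partial>N) =
      ennreal (\<integral>x. f x * exp (- (c * l x)) * l x ^ n /\<^sub>R fact n * t ^ n \<partial>N)"
      using f l t by (intro nn_integral_eq_integral integrable_mult_left ci) (auto intro!: AE_I2)
    thus "(\<integral>\<^sup>+x. ennreal (f x * exp (- (c * l x)) * l x ^ n /\<^sub>R fact n * t ^ n) \<partial>N) = ennreal (\<beta> n * t ^ n)"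
      by (simp add: \<beta>_def)
  qed
  also have "\<dots> < \<infinity>"
  proof -
    have "\<beta> n * t ^ n \<ge> 0" for n
      unfolding \<beta>_def using t f l by (intro mult_nonneg_nonneg integral_nonneg_AE AE_I2) auto
    thus ?thesis using sm by (simp add: suminf_ennreal2 less_top)
  qed
  finally have fin: "(\<integral>\<^sup>+x. ennreal (f x * exp (- ((c - t) * l x))) \<partial>N) < \<infinity>" .
  have "laplace_conv N l f (c - t)"
    unfolding laplace_conv_def
  proof (rule integrableI_nonneg)
    show "AE x in N. 0 \<le> f x * exp (- ((c - t) * l x))" using f by (intro AE_I2) auto
  qed (use fin in \<open>auto\<close>)
  moreover have "c - t < a" using r by (simp add: c_def t_def)
  ultimately show ?thesis by blast
qed

subsection \<open>The functional equation of the theta function\<close>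

text \<open>The characteristic function of the standard normal law at frequency t / h, after the
  substitution y = h w; sqrt(2 pi) undoes the normalisation of the density.\<close>

lemma gaussian_fourier:
  fixes h t :: real
  assumes h: "h > 0"
  shows "has_bochner_integral lborel (\<lambda>w. iexp (t * w) * of_real (exp (- (h\<^sup>2 * w\<^sup>2) / 2)))
           (of_real (sqrt (2 * pi) / h * exp (- t\<^sup>2 / (2 * h\<^sup>2))))"
proof -
  define F where "F y = sqrt (2 * pi) *\<^sub>R (std_normal_density y *\<^sub>R iexp (t / h * y))" for y
  have i: "integrable std_normal_distribution (\<lambda>x. iexp (t / h * x))"
    by (intro finite_measure.integrable_const_bound[where B = 1])
       (auto intro!: prob_space.finite_measure prob_space_normal_density)
  have "(\<integral>x. iexp (t / h * x) \<partial>std_normal_distribution) = of_real (exp (- ((t / h)\<^sup>2) / 2))"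
    using char_std_normal_distribution unfolding char_def by meson
  moreover have "integrable lborel (\<lambda>x. std_normal_density x *\<^sub>R iexp (t / h * x))"
    using i by (subst (asm) integrable_density) (auto simp: normal_density_nonneg)
  moreover have "(\<integral>x. iexp (t / h * x) \<partial>std_normal_distribution) = (\<integral>x. std_normal_density x *\<^sub>R iexp (t / h * x) \<partial>lborel)"
    by (subst integral_density) (auto simp: normal_density_nonneg)
  ultimately have "has_bochner_integral lborel (\<lambda>x. std_normal_density x *\<^sub>R iexp (t / h * x)) (of_real (exp (- ((t / h)\<^sup>2) / 2)))"
    by (simp add: has_bochner_integral_iff)
  hence "has_bochner_integral lborel F (sqrt (2 * pi) *\<^sub>R of_real (exp (- ((t / h)\<^sup>2) / 2)))"
    unfolding F_def by (rule has_bochner_integral_scaleR_right)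
  hence "has_bochner_integral lborel (\<lambda>x. F (0 + h * x)) ((sqrt (2 * pi) *\<^sub>R of_real (exp (- ((t / h)\<^sup>2) / 2))) /\<^sub>R \<bar>h\<bar>)"
    using h by (subst (asm) lborel_has_bochner_integral_real_affine_iff[where c = h and t = 0]) auto
  moreover have "F (0 + h * w) = iexp (t * w) * of_real (exp (- (h\<^sup>2 * w\<^sup>2) / 2))" for w
    using h by (simp add: F_def std_normal_density_def power_mult_distrib scaleR_conv_of_real real_sqrt_mult)
  moreover have "(sqrt (2 * pi) *\<^sub>R of_real (exp (- ((t / h)\<^sup>2) / 2))) /\<^sub>R \<bar>h\<bar> =
      complex_of_real (sqrt (2 * pi) / h * exp (- t\<^sup>2 / (2 * h\<^sup>2)))"
    using h by (simp add: scaleR_conv_of_real power_divide divide_simps)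
  ultimately show ?thesis by simp
qed

lemma gaussian_fourier_cos:
  fixes x t :: real
  assumes x: "x > 0"
  shows "has_bochner_integral lborel (\<lambda>w. exp (- (pi * x * w\<^sup>2)) * cos (2 * pi * t * w)) (exp (- (pi * t\<^sup>2 / x)) / sqrt x)"
proof -
  define h where "h = sqrt (2 * pi * x)"
  have h: "h > 0" and h2: "h\<^sup>2 = 2 * pi * x" using x by (auto simp: h_def)
  have "has_bochner_integral lborel (\<lambda>w. Re (iexp ((2 * pi * t) * w) * of_real (exp (- (h\<^sup>2 * w\<^sup>2) / 2))))
           (Re (of_real (sqrt (2 * pi) / h * exp (- (2 * pi * t)\<^sup>2 / (2 * h\<^sup>2)))))"
    by (rule has_bochner_integral_Re[OF gaussian_fourier[OF h]])
  moreover have "Re (iexp ((2 * pi * t) * w) * of_real (exp (- (h\<^sup>2 * w\<^sup>2) / 2))) = exp (- (pi * x * w\<^sup>2)) * cos (2 * pi * t * w)" for w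
    unfolding h2 by (simp add: Re_exp mult_ac)
  moreover have "Re (of_real (sqrt (2 * pi) / h * exp (- (2 * pi * t)\<^sup>2 / (2 * h\<^sup>2)))) = exp (- (pi * t\<^sup>2 / x)) / sqrt x"
    unfolding h2 using x by (simp add: h_def real_sqrt_mult power_mult_distrib power2_eq_square)
  ultimately show ?thesis by simp
qed

section \<open>Poisson summation through the Dirichlet kernel\<close>

definition dirichlet_kernel :: "nat \<Rightarrow> real \<Rightarrow> real" where
  "dirichlet_kernel N y = 1 + 2 * (\<Sum>k\<in>{1..N}. cos (2 * pi * real k * y))"

text \<open>Telescoping: 2 sin(pi y) cos(2 pi k y) is a difference of consecutive odd sines. The
  product form avoids division at the zeros of sin(pi y).\<close>

lemma sin_mult_dirichlet_kernel:
  "sin (pi * y) * dirichlet_kernel N y = sin (real (2 * N + 1) * pi * y)"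
proof (induction N)
  case (Suc N)
  have s: "sin ((2 * real (Suc N) + 1) * pi * y) - sin ((2 * real N + 1) * pi * y) =
      2 * sin (pi * y) * cos (2 * pi * real (Suc N) * y)"
  proof -
    have "(2 * real (Suc N) + 1) * pi * y = 2 * pi * real (Suc N) * y + pi * y"
      "(2 * real N + 1) * pi * y = 2 * pi * real (Suc N) * y - pi * y"
      by (simp_all add: algebra_simps)
    thus ?thesis by (simp only: sin_add sin_diff) simp
  qed
  have "sin (pi * y) * dirichlet_kernel (Suc N) y =
      sin (pi * y) * dirichlet_kernel N y + 2 * sin (pi * y) * cos (2 * pi * real (Suc N) * y)"
    by (simp add: dirichlet_kernel_def algebra_simps)
  thus ?case using s Suc by (simp add: algebra_simps)
qed (simp add: dirichlet_kernel_def)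

text \<open>A period centred at 0, so that 0 is the only zero of sin(pi y) in it and lies in the
  interior.\<close>

definition unit_cell :: "real measure" where
  "unit_cell = restrict_space lborel {-1/2..1/2}"

lemma space_unit_cell [simp]: "space unit_cell = {-1/2..1/2}"
  by (simp add: unit_cell_def space_restrict_space)

lemma finite_measure_unit_cell: "finite_measure unit_cell"
  by (rule finite_measureI) (simp add: unit_cell_def emeasure_restrict_space)

lemma measurable_unit_cell [measurable (raw)]: "f \<in> borel_measurable borel \<Longrightarrow> f \<in> borel_measurable unit_cell"
  unfolding unit_cell_def by (rule measurable_restrict_space1) simp

lemma integrable_unit_cell:
  fixes f :: "real \<Rightarrow> real"
  assumes "f \<in> borel_measurable borel" "\<And>y. y \<in> {-1/2..1/2} \<Longrightarrow> \<bar>f y\<bar> \<le> B"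
  shows "integrable unit_cell f"
  using assms by (intro finite_measure.integrable_const_bound[OF finite_measure_unit_cell, where B = B]) auto

lemma measure_unit_cell [simp]: "measure unit_cell {- (1 / 2)..1 / 2} = 1"
  by (simp add: unit_cell_def measure_restrict_space)

lemma integral_unit_cell:
  fixes f :: "real \<Rightarrow> 'b::{banach, second_countable_topology}"
  shows "integral\<^sup>L unit_cell f = (\<integral>y. indicator {-1/2..1/2} y *\<^sub>R f y \<partial>lborel)"
  unfolding unit_cell_def by (subst integral_restrict_space) auto

lemma integral_unit_cell_const [simp]: "(\<integral>y. c \<partial>unit_cell) = (c::real)"
  by (subst integral_unit_cell) simp

lemma integral_unit_cell_cos:
  assumes "k \<noteq> (0::int)"
  shows "(\<integral>y. cos (2 * pi * of_int k * y) \<partial>unit_cell) = 0"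
proof -
  let ?F = "\<lambda>y. sin (2 * pi * of_int k * y) / (2 * pi * of_int k)"
  have "(\<integral>y. indicator {-1/2..1/2} y *\<^sub>R cos (2 * pi * of_int k * y) \<partial>lborel) = ?F (1/2) - ?F (-1/2)"
  proof (rule integral_FTC_atLeastAtMost)
    fix x :: real
    show "(?F has_vector_derivative cos (2 * pi * of_int k * x)) (at x within {-1/2..1/2})"
      unfolding has_real_derivative_iff_has_vector_derivative[symmetric]
      using assms by (auto intro!: derivative_eq_intros)
  qed (auto intro!: continuous_intros)
  also have "\<dots> = 0" using assms by (simp add: mult.commute sin_int_times_real)
  finally show ?thesis by (simp only: integral_unit_cell)
qed

lemma continuous_on_unit_cell_integrable:
  fixes f :: "real \<Rightarrow> real"
  assumes "continuous_on UNIV f"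
  shows "integrable unit_cell f"
proof -
  have "bounded (f ` {-1/2..1/2})"
    using assms by (intro compact_imp_bounded compact_continuous_image continuous_on_subset[OF assms]) auto
  hence "\<exists>B. \<forall>y\<in>{-1/2..1/2}. \<bar>f y\<bar> \<le> B" by (simp add: bounded_iff)
  then obtain B where "\<And>y. y \<in> {-1/2..1/2} \<Longrightarrow> \<bar>f y\<bar> \<le> B" by blast
  thus ?thesis using assms by (intro integrable_unit_cell borel_measurable_continuous_onI)
qed

lemma integral_dirichlet_kernel: "(\<integral>y. dirichlet_kernel N y \<partial>unit_cell) = 1"
proof -
  have i: "integrable unit_cell (\<lambda>y. cos (2 * pi * real k * y))" for k
    by (intro continuous_on_unit_cell_integrable continuous_intros)
  have c: "(\<integral>y. cos (2 * pi * real k * y) \<partial>unit_cell) = 0" if "k \<in> {1..N}" for k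
    using integral_unit_cell_cos[of "int k"] that by simp
  have "(\<integral>y. dirichlet_kernel N y \<partial>unit_cell) = 1 + 2 * (\<Sum>k\<in>{1..N}. (\<integral>y. cos (2 * pi * real k * y) \<partial>unit_cell))"
    unfolding dirichlet_kernel_def
    using i by (subst Bochner_Integration.integral_add) (auto intro!: continuous_on_unit_cell_integrable continuous_intros)
  thus ?thesis using c by simp
qed

text \<open>Bessel's inequality: the integral of (h - S)^2 is nonnegative for the orthogonal
  projection S, which bounds the sum of the squared coefficients, so these tend to 0. This stands in
  for the Riemann-Lebesgue lemma and asks only boundedness of \<open>h\<close>, as suits a
  difference quotient.\<close>

lemma bessel_tendsto_zero:
  fixes e :: "nat \<Rightarrow> 'a \<Rightarrow> real"
  assumes M: "finite_measure M" and c: "c > 0"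
    and [measurable]: "\<And>i. e i \<in> borel_measurable M" "h \<in> borel_measurable M"
    and e: "\<And>i x. \<bar>e i x\<bar> \<le> 1" and h: "\<And>x. x \<in> space M \<Longrightarrow> \<bar>h x\<bar> \<le> B"
    and orth: "\<And>i j. (\<integral>x. e i x * e j x \<partial>M) = (if i = j then c else 0)"
  shows "(\<lambda>i. \<integral>x. h x * e i x \<partial>M) \<longlonglongrightarrow> 0"
proof -
  interpret finite_measure M by fact
  define b where "b i = (\<integral>x. h x * e i x \<partial>M)" for i
  have hh: "integrable M (\<lambda>x. h x * h x)"
  proof (intro integrable_const_bound[where B = "B * B"] AE_I2)
    fix x assume "x \<in> space M"
    thus "norm (h x * h x) \<le> B * B"
      using h[of x] unfolding real_norm_def abs_mult by (intro mult_mono) auto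
  qed measurable
  have he: "integrable M (\<lambda>x. h x * e i x)" for i
  proof (intro integrable_const_bound[where B = "B * 1"] AE_I2)
    fix x assume "x \<in> space M"
    thus "norm (h x * e i x) \<le> B * 1"
      using h[of x] e[of i x] unfolding real_norm_def abs_mult by (intro mult_mono) auto
  qed measurable
  have ee: "integrable M (\<lambda>x. e i x * e j x)" for i j
  proof (intro integrable_const_bound[where B = "1 * 1"] AE_I2)
    fix x
    show "norm (e i x * e j x) \<le> 1 * 1"
      using e[of i x] e[of j x] unfolding real_norm_def abs_mult by (intro mult_mono) auto
  qed measurable
  have bound: "(\<Sum>i<n. (b i)\<^sup>2) \<le> c * (\<integral>x. h x * h x \<partial>M)" for n
  proof -
    define S where "S x = (\<Sum>i<n. b i / c * e i x)" for x
    have hS: "has_bochner_integral M (\<lambda>x. h x * S x) (\<Sum>i<n. (b i)\<^sup>2 / c)"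
    proof -
      have "has_bochner_integral M (\<lambda>x. \<Sum>i<n. b i / c * (h x * e i x)) (\<Sum>i<n. b i / c * b i)"
        unfolding b_def by (intro has_bochner_integral_sum has_bochner_integral_mult_right has_bochner_integral_integrable he)
      thus ?thesis by (simp add: S_def sum_distrib_left mult_ac power2_eq_square)
    qed
    have SS: "has_bochner_integral M (\<lambda>x. S x * S x) (\<Sum>i<n. (b i)\<^sup>2 / c)"
    proof -
      have "has_bochner_integral M (\<lambda>x. \<Sum>i<n. \<Sum>j<n. b i / c * (b j / c) * (e i x * e j x))
          (\<Sum>i<n. \<Sum>j<n. b i / c * (b j / c) * (\<integral>x. e i x * e j x \<partial>M))"
        by (intro has_bochner_integral_sum has_bochner_integral_mult_right has_bochner_integral_integrable ee)
      moreover have "(\<Sum>i<n. \<Sum>j<n. b i / c * (b j / c) * (\<integral>x. e i x * e j x \<partial>M)) = (\<Sum>i<n. (b i)\<^sup>2 / c)"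
        unfolding orth using c by (simp add: if_distrib sum.delta power2_eq_square cong: if_cong)
      ultimately show ?thesis by (simp add: S_def sum_product mult_ac)
    qed
    have "has_bochner_integral M (\<lambda>x. h x * h x - 2 * (h x * S x) + S x * S x)
       ((\<integral>x. h x * h x \<partial>M) - 2 * (\<Sum>i<n. (b i)\<^sup>2 / c) + (\<Sum>i<n. (b i)\<^sup>2 / c))"
      by (intro has_bochner_integral_add has_bochner_integral_diff has_bochner_integral_mult_right hS SS has_bochner_integral_integrable hh)
    moreover have "h x * h x - 2 * (h x * S x) + S x * S x = (h x - S x)\<^sup>2" for x
      by (simp add: power2_eq_square algebra_simps)
    ultimately have hb: "has_bochner_integral M (\<lambda>x. (h x - S x)\<^sup>2)
       ((\<integral>x. h x * h x \<partial>M) - 2 * (\<Sum>i<n. (b i)\<^sup>2 / c) + (\<Sum>i<n. (b i)\<^sup>2 / c))" by simp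
    have "0 \<le> (\<integral>x. (h x - S x)\<^sup>2 \<partial>M)" by (rule integral_nonneg_AE) auto
    hence "(\<Sum>i<n. (b i)\<^sup>2 / c) \<le> (\<integral>x. h x * h x \<partial>M)"
      using has_bochner_integral_integral_eq[OF hb] by simp
    thus ?thesis using c by (simp add: sum_divide_distrib[symmetric] field_simps)
  qed
  have "summable (\<lambda>i. (b i)\<^sup>2)"
    by (rule summableI_nonneg_bounded) (use bound in auto)
  hence "(\<lambda>i. (b i)\<^sup>2) \<longlonglongrightarrow> 0" by (rule summable_LIMSEQ_zero)
  hence "(\<lambda>i. sqrt ((b i)\<^sup>2)) \<longlonglongrightarrow> sqrt 0" by (rule tendsto_real_sqrt)
  hence "(\<lambda>i. \<bar>b i\<bar>) \<longlonglongrightarrow> 0" by simp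
  thus ?thesis unfolding b_def by (simp add: tendsto_rabs_zero_iff)
qed

text \<open>The identity 2 sin a sin b = cos(a - b) - cos(a + b) produces the integer frequencies i
  - j and i + j + 1. Over a period only frequency 0 survives, and i + j + 1 is never 0.\<close>

lemma orthogonal_odd_sines:
  "(\<integral>y. sin (real (2 * i + 1) * pi * y) * sin (real (2 * j + 1) * pi * y) \<partial>unit_cell) = (if i = j then 1 / 2 else 0)"
proof -
  have e: "sin (real (2 * i + 1) * pi * y) * sin (real (2 * j + 1) * pi * y) =
     1 / 2 * cos (2 * pi * of_int (int i - int j) * y) - 1 / 2 * cos (2 * pi * of_int (int i + int j + 1) * y)" for y
  proof -
    define a b where "a = real (2 * i + 1) * pi * y" and "b = real (2 * j + 1) * pi * y"
    have args: "2 * pi * of_int (int i - int j) * y = a - b" "2 * pi * of_int (int i + int j + 1) * y = a + b"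
      by (simp_all add: a_def b_def algebra_simps)
    show ?thesis unfolding args a_def[symmetric] b_def[symmetric] cos_add cos_diff by (simp add: algebra_simps)
  qed
  have i: "integrable unit_cell (\<lambda>y. 1 / 2 * cos (2 * pi * of_int k * y))" for k
    by (intro continuous_on_unit_cell_integrable continuous_intros)
  have "(\<integral>y. sin (real (2 * i + 1) * pi * y) * sin (real (2 * j + 1) * pi * y) \<partial>unit_cell) =
     1 / 2 * (\<integral>y. cos (2 * pi * of_int (int i - int j) * y) \<partial>unit_cell) - 1 / 2 * (\<integral>y. cos (2 * pi * of_int (int i + int j + 1) * y) \<partial>unit_cell)"
    unfolding e by (subst Bochner_Integration.integral_diff[OF i i]) simp
  thus ?thesis by (cases "i = j") (simp_all add: integral_unit_cell_cos del: of_int_diff of_int_add)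
qed

text \<open>Jordan's inequality: by concavity the sine lies above its chord from 0 to pi/2.\<close>

lemma two_abs_le_abs_sin:
  assumes "y \<in> {-1/2..1/2}"
  shows "2 * \<bar>y\<bar> \<le> \<bar>sin (pi * y)\<bar>"
proof -
  have *: "2 * z \<le> sin (pi * z)" if "0 \<le> z" "z \<le> 1/2" for z
  proof -
    have cc: "concave_on {0..pi} sin"
    proof (rule f''_le0_imp_concave)
      fix x :: real assume "x \<in> {0..pi}"
      show "(sin has_real_derivative cos x) (at x)" by (auto intro!: derivative_eq_intros)
      show "(cos has_real_derivative - sin x) (at x)" by (auto intro!: derivative_eq_intros)
      show "- sin x \<le> 0" using \<open>x \<in> {0..pi}\<close> by (simp add: sin_ge_zero)
    qed simp
    have "(1 - 2 * z) * sin 0 + (2 * z) * sin (pi / 2) \<le> sin ((1 - 2 * z) *\<^sub>R 0 + (2 * z) *\<^sub>R (pi / 2))"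
      using that by (intro concave_onD[OF cc]) auto
    thus ?thesis by (simp add: mult.commute)
  qed
  show ?thesis
  proof (cases "y \<ge> 0")
    case True
    thus ?thesis using *[of y] assms by (simp add: abs_of_nonneg)
  next
    case False
    thus ?thesis using *[of "- y"] assms by simp
  qed
qed


text \<open>The kernel has integral 1, so subtracting g 0 leaves the coefficients of the quotient (g
  y - g 0) / sin(pi y) against the odd sines; the Lipschitz condition bounds this quotient. The
  second claim is uniform in N and later serves as the dominating bound for an interchange of
  limits.\<close>

lemma dirichlet_kernel_convergence:
  fixes g :: "real \<Rightarrow> real"
  assumes g: "continuous_on UNIV g"
    and lip: "\<And>y. y \<in> {-1/2..1/2} \<Longrightarrow> \<bar>g y - g 0\<bar> \<le> L * \<bar>y\<bar>"
  shows "(\<lambda>N. \<integral>y. g y * dirichlet_kernel N y \<partial>unit_cell) \<longlonglongrightarrow> g 0"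
    and "\<bar>\<integral>y. g y * dirichlet_kernel N y \<partial>unit_cell\<bar> \<le> \<bar>g 0\<bar> + L / 2"
proof -
  have [measurable]: "g \<in> borel_measurable borel" using g by (rule borel_measurable_continuous_onI)
  have "2 * \<bar>g (1/2) - g 0\<bar> \<le> L" using lip[of "1/2"] by simp
  moreover have "0 \<le> 2 * \<bar>g (1/2) - g 0\<bar>" by simp
  ultimately have L0: "0 \<le> L" by (rule order_trans[rotated])
  \<comment> \<open>At y = 0 division by zero gives \<open>h 0 = 0\<close>, in agreement with the
    product identity \<open>s\<close>, since g y - g 0 vanishes there.\<close>
  define h where "h y = (g y - g 0) / sin (pi * y)" for y
  have h: "\<bar>h y\<bar> \<le> L / 2" if "y \<in> {-1/2..1/2}" for y
  proof (cases "y = 0")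
    case True
    thus ?thesis using L0 by (simp add: h_def)
  next
    case False
    have "\<bar>g y - g 0\<bar> * 2 \<le> L * (2 * \<bar>y\<bar>)" using lip[OF that] by simp
    also have "\<dots> \<le> L * \<bar>sin (pi * y)\<bar>"
      using L0 by (intro mult_left_mono two_abs_le_abs_sin that) auto
    finally show ?thesis
      using two_abs_le_abs_sin[OF that] False by (simp add: h_def field_simps abs_divide)
  qed
  have cd: "continuous_on UNIV (dirichlet_kernel N)" for N
    unfolding dirichlet_kernel_def[abs_def] by (intro continuous_intros)
  have hm [measurable]: "h \<in> borel_measurable borel" unfolding h_def by measurable
  have s: "h y * sin (real (2 * N + 1) * pi * y) = (g y - g 0) * dirichlet_kernel N y" if "y \<in> {-1/2..1/2}" for y N
  proof (cases "y = 0")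
    case False
    hence "sin (pi * y) \<noteq> 0" using two_abs_le_abs_sin[OF that] by auto
    thus ?thesis unfolding sin_mult_dirichlet_kernel[symmetric] h_def by simp
  qed (simp add: h_def)
  have e: "(\<integral>y. g y * dirichlet_kernel N y \<partial>unit_cell) = g 0 + (\<integral>y. h y * sin (real (2 * N + 1) * pi * y) \<partial>unit_cell)" for N
  proof -
    have "(\<integral>y. h y * sin (real (2 * N + 1) * pi * y) \<partial>unit_cell) = (\<integral>y. (g y - g 0) * dirichlet_kernel N y \<partial>unit_cell)"
      by (rule Bochner_Integration.integral_cong[OF refl]) (use s in simp)
    also have "\<dots> = (\<integral>y. g y * dirichlet_kernel N y - g 0 * dirichlet_kernel N y \<partial>unit_cell)"
      by (simp add: left_diff_distrib)
    also have "\<dots> = (\<integral>y. g y * dirichlet_kernel N y \<partial>unit_cell) - (\<integral>y. g 0 * dirichlet_kernel N y \<partial>unit_cell)"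
      by (intro Bochner_Integration.integral_diff continuous_on_unit_cell_integrable continuous_intros g cd)
    finally show ?thesis by (simp add: integral_dirichlet_kernel)
  qed
  have "(\<lambda>N. \<integral>y. h y * sin (real (2 * N + 1) * pi * y) \<partial>unit_cell) \<longlonglongrightarrow> 0"
    by (rule bessel_tendsto_zero[OF finite_measure_unit_cell, where c = "1/2" and B = "L / 2"])
       (use h orthogonal_odd_sines in auto)
  hence "(\<lambda>N. g 0 + (\<integral>y. h y * sin (real (2 * N + 1) * pi * y) \<partial>unit_cell)) \<longlonglongrightarrow> g 0 + 0"
    by (intro tendsto_add tendsto_const)
  thus "(\<lambda>N. \<integral>y. g y * dirichlet_kernel N y \<partial>unit_cell) \<longlonglongrightarrow> g 0" by (simp add: e)
  have hs: "\<bar>h y * sin (real (2 * N + 1) * pi * y)\<bar> \<le> L / 2" if "y \<in> {-1/2..1/2}" for y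
  proof -
    have "\<bar>h y\<bar> * \<bar>sin (real (2 * N + 1) * pi * y)\<bar> \<le> (L / 2) * 1"
      using h[OF that] by (intro mult_mono) auto
    thus ?thesis by (simp add: abs_mult)
  qed
  have "\<bar>\<integral>y. h y * sin (real (2 * N + 1) * pi * y) \<partial>unit_cell\<bar> \<le> (\<integral>y. \<bar>h y * sin (real (2 * N + 1) * pi * y)\<bar> \<partial>unit_cell)"
    by (rule integral_abs_bound)
  also have "\<dots> \<le> (\<integral>y. L / 2 \<partial>unit_cell)"
    using hs L0 by (intro integral_mono integrable_unit_cell[where B = "L / 2"]) auto
  finally show "\<bar>\<integral>y. g y * dirichlet_kernel N y \<partial>unit_cell\<bar> \<le> \<bar>g 0\<bar> + L / 2"
    unfolding e by simp
qed

text \<open>The line is cut into the shells n - 1/2 \<le> |y| < n + 1/2. By evenness a shell with n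
  > 0 counts one cell twice, whence the weights 1, 2, 2, ...; the boundary points of the cells are
  null.\<close>

lemma integral_even_sums:
  fixes F :: "real \<Rightarrow> real"
  assumes F: "integrable lborel F" and ev: "\<And>y. F (- y) = F y"
  shows "(\<lambda>n. (if n = 0 then 1 else 2) * (\<integral>y. F (real n + y) \<partial>unit_cell)) sums (\<integral>y. F y \<partial>lborel)"
proof -
  have [measurable]: "F \<in> borel_measurable borel" using F by auto
  define A where "A n = {y::real. real n - 1 / 2 \<le> \<bar>y\<bar> \<and> \<bar>y\<bar> < real n + 1 / 2}" for n :: nat
  define B where "B n = {y::real. real n - 1 / 2 \<le> y \<and> y < real n + 1 / 2}" for n :: nat
  have [measurable]: "A n \<in> sets borel" "B n \<in> sets borel" for n unfolding A_def B_def by measurable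
  have iB: "integrable lborel (\<lambda>y. indicator (B n) y * F y)" for n
    using integrable_mult_indicator[OF _ F, of "B n"] by simp
  have cell: "(\<integral>y. indicator (B n) y * F y \<partial>lborel) = (\<integral>y. F (real n + y) \<partial>unit_cell)" for n
  proof -
    have "(\<integral>y. indicator (B n) y * F y \<partial>lborel) = (\<integral>y. indicator (B n) (real n + 1 * y) * F (real n + 1 * y) \<partial>lborel)"
      by (subst lborel_integral_real_affine[where c = 1 and t = "real n"]) auto
    also have "\<dots> = (\<integral>y. indicator {-1/2..1/2} y *\<^sub>R F (real n + y) \<partial>lborel)"
    proof (rule integral_cong_AE)
      show "AE y in lborel. indicator (B n) (real n + 1 * y) * F (real n + 1 * y) = indicator {-1/2..1/2} y *\<^sub>R F (real n + y)"
        using AE_lborel_singleton[of "1/2::real"]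
        by eventually_elim (auto simp: B_def indicator_def)
    qed measurable
    finally show ?thesis by (simp only: integral_unit_cell)
  qed
  have c: "(\<integral>y. indicator (A n) y * F y \<partial>lborel) = (if n = 0 then 1 else 2) * (\<integral>y. F (real n + y) \<partial>unit_cell)" for n
  proof (cases "n = 0")
    case True
    have "(\<integral>y. indicator (A n) y * F y \<partial>lborel) = (\<integral>y. indicator (B n) y * F y \<partial>lborel)"
    proof (rule integral_cong_AE)
      show "AE y in lborel. indicator (A n) y * F y = indicator (B n) y * F y"
        using AE_lborel_singleton[of "-1/2::real"]
        by eventually_elim (auto simp: A_def B_def indicator_def True)
    qed measurable
    thus ?thesis using cell[of n] True by simp
  next
    case False
    have "AE y in lborel. indicator (A n) y * F y = indicator (B n) y * F y + indicator (B n) (0 + (-1) * y) * F (0 + (-1) * y)"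
      using False by (intro AE_I2) (auto simp: A_def B_def indicator_def ev)
    hence "(\<integral>y. indicator (A n) y * F y \<partial>lborel) = (\<integral>y. indicator (B n) y * F y + indicator (B n) (0 + (-1) * y) * F (0 + (-1) * y) \<partial>lborel)"
      by (rule integral_cong_AE[rotated 2]) measurable
    also have "\<dots> = (\<integral>y. indicator (B n) y * F y \<partial>lborel) + (\<integral>y. indicator (B n) (0 + (-1) * y) * F (0 + (-1) * y) \<partial>lborel)"
      by (intro Bochner_Integration.integral_add iB lborel_integrable_real_affine[where f = "\<lambda>y. indicator (B n) y * F y"]) auto
    also have "(\<integral>y. indicator (B n) (0 + (-1) * y) * F (0 + (-1) * y) \<partial>lborel) = (\<integral>y. indicator (B n) y * F y \<partial>lborel)"
      by (subst lborel_integral_real_affine[where c = "-1" and t = 0 and f = "\<lambda>y. indicator (B n) y * F y"]) auto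
    finally show ?thesis using cell[of n] False by simp
  qed
  have ps: "(\<Sum>i<m. indicator (A i) y * F y) = indicator {y. \<bar>y\<bar> < real m - 1 / 2} y * F y" for m y
    by (induction m) (auto simp: A_def indicator_def)
  have iA: "integrable lborel (\<lambda>y. indicator (A n) y * F y)" for n
    using integrable_mult_indicator[OF _ F, of "A n"] by simp
  have "(\<lambda>m. \<integral>y. indicator {y. \<bar>y\<bar> < real m - 1 / 2} y * F y \<partial>lborel) \<longlonglongrightarrow> (\<integral>y. F y \<partial>lborel)"
  proof (rule integral_dominated_convergence[where w = "\<lambda>y. norm (F y)"])
    show "AE y in lborel. (\<lambda>m. indicator {y. \<bar>y\<bar> < real m - 1 / 2} y * F y) \<longlonglongrightarrow> F y"
    proof (rule AE_I2)
      fix y :: real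
      obtain k :: nat where k: "\<bar>y\<bar> + 1 < real k" using reals_Archimedean2 by blast
      have "\<forall>\<^sub>F m in sequentially. indicator {y. \<bar>y\<bar> < real m - 1 / 2} y * F y = F y"
        using eventually_ge_at_top[of k] by eventually_elim (use k in \<open>auto simp: indicator_def\<close>)
      thus "(\<lambda>m. indicator {y. \<bar>y\<bar> < real m - 1 / 2} y * F y) \<longlonglongrightarrow> F y" by (rule tendsto_eventually)
    qed
  qed (use F in \<open>auto simp: indicator_def\<close>)
  moreover have "(\<integral>y. indicator {y. \<bar>y\<bar> < real m - 1 / 2} y * F y \<partial>lborel) = (\<Sum>i<m. \<integral>y. indicator (A i) y * F y \<partial>lborel)" for m
    unfolding ps[symmetric] by (intro Bochner_Integration.integral_sum iA)
  ultimately show ?thesis unfolding sums_def c by simp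
qed

definition theta_tail :: "real \<Rightarrow> real" where
  "theta_tail x = (\<Sum>n. exp (- (pi * x * (real (Suc n))\<^sup>2)))"

lemma exp_minus_square_le:
  assumes "c > 0" shows "exp (- (c * (real n)\<^sup>2)) \<le> exp (- c) ^ n"
proof -
  have "real n \<le> (real n)\<^sup>2" by (cases n) (auto simp: power2_eq_square)
  hence "c * real n \<le> c * (real n)\<^sup>2" using assms by simp
  thus ?thesis by (simp add: exp_of_nat_mult[symmetric] mult.commute)
qed

lemma summable_theta_tail:
  assumes "x > 0" shows "summable (\<lambda>n. exp (- (pi * x * (real (Suc n))\<^sup>2)))"
proof -
  have "summable (\<lambda>n. exp (- (pi * x)) ^ n)" using assms by (intro summable_geometric) auto
  hence "summable (\<lambda>n. exp (- (pi * x * (real n)\<^sup>2)))"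
    by (rule summable_comparison_test[rotated]) (use assms exp_minus_square_le[of "pi * x"] in auto)
  thus ?thesis by (subst summable_Suc_iff)
qed

text \<open>The integral of the Gaussian \<open>f\<close> times the N-th Dirichlet kernel is
  evaluated in two ways: by the Gaussian transform of each cosine, and, the kernel being periodic,
  as a sum over cells, each of which tends to the value of \<open>f\<close> at an integer. The
  bounds from \<open>L n\<close> are summable and independent of N, so Tannery's theorem lets N tend
  to infinity under the sum.\<close>

theorem theta_functional_equation:
  assumes x: "x > 0"
  shows "1 + 2 * theta_tail x = (1 + 2 * theta_tail (1 / x)) / sqrt x"
proof -
  define f where "f y = exp (- (pi * x * y\<^sup>2))" for y
  define c :: "nat \<Rightarrow> real" where "c n = (if n = 0 then 1 else 2)" for n
  define J where "J n N = (\<integral>y. f (real n + y) * dirichlet_kernel N y \<partial>unit_cell)" for n N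
  \<comment> \<open>Bounds the derivative 2 pi x z exp(-pi x z^2) on the cell around n: there |z|
    \<le> n + 1 and |z| \<ge> n / 2, the latter trivially for n = 0, and n^2 \<ge> n turns the
    Gaussian into a geometric factor.\<close>
  define L where "L n = 2 * pi * x * (real n + 1) * exp (- (pi * x / 4)) ^ n" for n
  have cf: "continuous_on UNIV (\<lambda>y. f (a + y))" for a unfolding f_def by (intro continuous_intros)
  have lip: "\<bar>f (real n + y) - f (real n + 0)\<bar> \<le> L n * \<bar>y\<bar>" if y: "y \<in> {-1/2..1/2}" for n y
  proof -
    have "norm (f (real n + y) - f (real n)) \<le> L n * norm ((real n + y) - real n)"
    proof (rule field_differentiable_bound)
      fix z :: real assume z: "z \<in> {real n - 1/2..real n + 1/2}"
      show "(f has_field_derivative (- (2 * pi * x * z) * exp (- (pi * x * z\<^sup>2)))) (at z within {real n - 1/2..real n + 1/2})"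
        unfolding f_def by (auto intro!: derivative_eq_intros)
      have z1: "\<bar>z\<bar> \<le> real n + 1" using z by auto
      have "real n / 2 \<le> \<bar>z\<bar>" using z by (cases "n = 0") auto
      hence "(real n / 2)\<^sup>2 \<le> \<bar>z\<bar>\<^sup>2" by (intro power_mono) auto
      hence "pi * x * (real n / 2)\<^sup>2 \<le> pi * x * z\<^sup>2" using x by (intro mult_left_mono) auto
      hence "exp (- (pi * x * z\<^sup>2)) \<le> exp (- (pi * x / 4 * (real n)\<^sup>2))" by (simp add: power_divide)
      also have "\<dots> \<le> exp (- (pi * x / 4)) ^ n" using x by (intro exp_minus_square_le) auto
      finally have z2: "exp (- (pi * x * z\<^sup>2)) \<le> exp (- (pi * x / 4)) ^ n" .
      have "(2 * pi * x) * \<bar>z\<bar> * exp (- (pi * x * z\<^sup>2)) \<le> (2 * pi * x) * (real n + 1) * exp (- (pi * x / 4)) ^ n"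
        using x z1 z2 by (intro mult_mono) auto
      thus "norm (- (2 * pi * x * z) * exp (- (pi * x * z\<^sup>2))) \<le> L n"
        using x by (simp add: L_def abs_mult)
    qed (use y in auto)
    thus ?thesis by simp
  qed
  have "summable (\<lambda>n. real (Suc n) * exp (- (pi * x / 4)) ^ n)"
    using geometric_deriv_sums[of "exp (- (pi * x / 4))"] x by (auto simp: sums_iff)
  hence "summable (\<lambda>n. (2 * pi * x) * (real (Suc n) * exp (- (pi * x / 4)) ^ n))" by (rule summable_mult)
  hence sL: "summable L" unfolding L_def by (simp only: of_nat_Suc mult.assoc add.commute)
  have sf: "summable (\<lambda>n. f (real n))"
    using summable_theta_tail[OF x] unfolding f_def by (subst (asm) summable_Suc_iff)
  have lim: "(\<lambda>N. c n * J n N) \<longlonglongrightarrow> c n * f (real n)" for n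
    using dirichlet_kernel_convergence(1)[OF cf lip, of n] by (intro tendsto_mult tendsto_const) (simp add: J_def)
  have dom: "norm (c n * J n N) \<le> 2 * (f (real n) + L n / 2)" for n N
  proof -
    have "\<bar>J n N\<bar> \<le> f (real n) + L n / 2"
      using dirichlet_kernel_convergence(2)[OF cf lip, of n N] by (simp add: J_def f_def)
    moreover have "\<bar>c n\<bar> \<le> 2" by (simp add: c_def)
    ultimately show ?thesis unfolding real_norm_def abs_mult by (intro mult_mono) auto
  qed
  have T: "(\<lambda>N. \<Sum>n. c n * J n N) \<longlonglongrightarrow> (\<Sum>n. c n * f (real n))"
  proof -
    have "summable (\<lambda>n. 2 * (f (real n) + L n / 2))"
      by (intro summable_mult summable_add summable_divide sf sL)
    from tannerys_theorem[of "\<lambda>n N. c n * J n N", OF lim _ this sequentially_bot] dom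
    show ?thesis by (auto intro: always_eventually)
  qed
  define S where "S N = (1 + 2 * (\<Sum>k\<in>{1..N}. exp (- (pi * (real k)\<^sup>2 / x)))) / sqrt x" for N
  have "(\<lambda>n. c n * J n N) sums S N" for N
  proof -
    have hb: "has_bochner_integral lborel (\<lambda>y. f y * cos (2 * pi * 0 * y) + 2 * (\<Sum>k\<in>{1..N}. f y * cos (2 * pi * real k * y)))
      (exp (- (pi * 0\<^sup>2 / x)) / sqrt x + 2 * (\<Sum>k\<in>{1..N}. exp (- (pi * (real k)\<^sup>2 / x)) / sqrt x))"
      unfolding f_def
      by (intro has_bochner_integral_add has_bochner_integral_mult_right has_bochner_integral_sum gaussian_fourier_cos x)
    have e: "f y * cos (2 * pi * 0 * y) + 2 * (\<Sum>k\<in>{1..N}. f y * cos (2 * pi * real k * y)) = f y * dirichlet_kernel N y" for y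
      by (simp add: dirichlet_kernel_def algebra_simps sum_distrib_left)
    have "has_bochner_integral lborel (\<lambda>y. f y * dirichlet_kernel N y) (S N)"
      using hb unfolding e by (simp add: S_def add_divide_distrib flip: sum_divide_distrib)
    hence i: "integrable lborel (\<lambda>y. f y * dirichlet_kernel N y)" and v: "(\<integral>y. f y * dirichlet_kernel N y \<partial>lborel) = S N"
      by (simp_all add: has_bochner_integral_iff)
    have per: "dirichlet_kernel N (real n + y) = dirichlet_kernel N y" for n y
    proof -
      have "cos (2 * pi * real k * (real n + y)) = cos (2 * pi * real k * y)" for k
      proof -
        have "2 * pi * real k * (real n + y) = 2 * pi * real k * y + 2 * pi * of_int (int (k * n))"
          by (simp add: algebra_simps)
        thus ?thesis by (simp only: cos.plus_of_int cos_add sin_int_2pin cos_int_2pin mult.right_neutral mult_zero_right diff_zero)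
      qed
      thus ?thesis by (simp add: dirichlet_kernel_def)
    qed
    have "f (- y) * dirichlet_kernel N (- y) = f y * dirichlet_kernel N y" for y
      by (simp add: f_def dirichlet_kernel_def)
    from integral_even_sums[OF i this] show ?thesis by (simp add: per v c_def J_def)
  qed
  hence "(\<Sum>n. c n * J n N) = S N" for N by (simp add: sums_iff)
  with T have T': "S \<longlonglongrightarrow> (\<Sum>n. c n * f (real n))" by simp
  have "S \<longlonglongrightarrow> (1 + 2 * theta_tail (1 / x)) / sqrt x"
  proof -
    have "(\<lambda>N. \<Sum>k<N. exp (- (pi * (1 / x) * (real (Suc k))\<^sup>2))) \<longlonglongrightarrow> theta_tail (1 / x)"
      unfolding theta_tail_def using x by (intro summable_LIMSEQ summable_theta_tail) auto
    moreover have "(\<Sum>k\<in>{1..N}. exp (- (pi * (real k)\<^sup>2 / x))) = (\<Sum>k<N. exp (- (pi * (1 / x) * (real (Suc k))\<^sup>2)))" for N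
      by (rule sum.reindex_bij_witness[of _ Suc "\<lambda>k. k - 1"]) auto
    ultimately have "(\<lambda>N. \<Sum>k\<in>{1..N}. exp (- (pi * (real k)\<^sup>2 / x))) \<longlonglongrightarrow> theta_tail (1 / x)" by simp
    thus ?thesis unfolding S_def using x by (intro tendsto_intros) auto
  qed
  with T' have "(\<Sum>n. c n * f (real n)) = (1 + 2 * theta_tail (1 / x)) / sqrt x"
    by (rule LIMSEQ_unique)
  moreover have "(\<Sum>n. c n * f (real n)) = 1 + 2 * theta_tail x"
  proof -
    have "(\<lambda>n. 2 * f (real (Suc n))) sums (2 * theta_tail x)"
      unfolding f_def theta_tail_def using x by (intro sums_mult summable_sums summable_theta_tail)
    hence "(\<lambda>n. c (Suc n) * f (real (Suc n))) sums (2 * theta_tail x)" by (simp add: c_def)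
    hence "(\<lambda>n. c n * f (real n)) sums (2 * theta_tail x + c 0 * f (real 0))" by (rule sums_Suc[of "\<lambda>n. c n * f (real n)"])
    thus ?thesis by (simp add: sums_iff c_def f_def)
  qed
  ultimately show ?thesis by simp
qed

subsection \<open>The zeta function\<close>

abbreviation halfline :: "real measure" where
  "halfline \<equiv> restrict_space lborel {0..}"

abbreviation laplace_half :: "(real \<Rightarrow> real) \<Rightarrow> complex \<Rightarrow> complex" where
  "laplace_half f \<equiv> laplace halfline (\<lambda>u. u) f"

abbreviation laplace_half_conv :: "(real \<Rightarrow> real) \<Rightarrow> real \<Rightarrow> bool" where
  "laplace_half_conv f a \<equiv> laplace_conv halfline (\<lambda>u. u) f a"

lemma space_halfline [simp]: "space halfline = {0..}"
  by (simp add: space_restrict_space)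

lemma measurable_halfline [measurable (raw)]:
  "f \<in> borel_measurable borel \<Longrightarrow> f \<in> borel_measurable halfline"
  by (rule measurable_restrict_space1) simp

section \<open>The Mellin transform of the theta function\<close>

lemma indicator_subset_mono: "A \<subseteq> B \<Longrightarrow> indicator A x \<le> (indicator B x :: real)"
  by (auto simp: indicator_def)

text \<open>Substitution on the compact interval [-k, k], then monotone convergence on both sides.
  With nonnegative integrals no integrability has to be known beforehand.\<close>

lemma nn_integral_exp_substitution:
  fixes g :: "real \<Rightarrow> real"
  assumes [measurable]: "g \<in> borel_measurable borel" and g: "\<And>t. g t \<ge> 0"
  shows "(\<integral>\<^sup>+t. ennreal (g t * indicator {0<..} t) \<partial>lborel) = (\<integral>\<^sup>+u. ennreal (g (exp u) * exp u) \<partial>lborel)"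
proof -
  have e: "(\<integral>\<^sup>+t. ennreal (g t * indicator {exp (- real k)..exp (real k)} t) \<partial>lborel) =
     (\<integral>\<^sup>+u. ennreal (g (exp u) * exp u * indicator {- real k..real k} u) \<partial>lborel)" for k :: nat
    by (rule nn_integral_substitution) (auto intro!: derivative_eq_intros continuous_intros simp: set_borel_measurable_def)
  have l1: "(\<lambda>k. \<integral>\<^sup>+t. ennreal (g t * indicator {exp (- real k)..exp (real k)} t) \<partial>lborel) \<longlonglongrightarrow>
      (\<integral>\<^sup>+t. ennreal (g t * indicator {0<..} t) \<partial>lborel)"
  proof (rule nn_integral_LIMSEQ)
    show "incseq (\<lambda>k t. ennreal (g t * indicator {exp (- real k)..exp (real k)} t))"
    proof (unfold incseq_def le_fun_def, intro allI impI ennreal_leI mult_left_mono g)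
      fix m n :: nat and t :: real assume "m \<le> n"
      hence "{exp (- real m)..exp (real m)} \<subseteq> {exp (- real n)..exp (real n)}" by simp
      thus "indicator {exp (- real m)..exp (real m)} t \<le> (indicator {exp (- real n)..exp (real n)} t :: real)"
        by (rule indicator_subset_mono)
    qed
    fix t :: real
    show "(\<lambda>k. ennreal (g t * indicator {exp (- real k)..exp (real k)} t)) \<longlonglongrightarrow> ennreal (g t * indicator {0<..} t)"
    proof (cases "t > 0")
      case True
      obtain k :: nat where k: "\<bar>ln t\<bar> < real k" using reals_Archimedean2 by blast
      have "\<forall>\<^sub>F m in sequentially. ennreal (g t * indicator {exp (- real m)..exp (real m)} t) = ennreal (g t * indicator {0<..} t)"
        using eventually_ge_at_top[of k]
      proof eventually_elim
        case (elim m)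
        hence "- real m \<le> ln t" "ln t \<le> real m" using k by auto
        hence "exp (- real m) \<le> exp (ln t)" "exp (ln t) \<le> exp (real m)" by (simp_all only: exp_le_cancel_iff)
        hence "exp (- real m) \<le> t" "t \<le> exp (real m)" using True by simp_all
        thus ?case using True by (simp add: indicator_def)
      qed
      thus ?thesis by (rule tendsto_eventually)
    next
      case False
      hence "\<not> exp (- real m) \<le> t" for m :: nat using exp_gt_zero[of "- real m"] by linarith
      thus ?thesis using False by (simp add: indicator_def)
    qed
  qed measurable
  have l2: "(\<lambda>k. \<integral>\<^sup>+u. ennreal (g (exp u) * exp u * indicator {- real k..real k} u) \<partial>lborel) \<longlonglongrightarrow>
      (\<integral>\<^sup>+u. ennreal (g (exp u) * exp u) \<partial>lborel)"
  proof (rule nn_integral_LIMSEQ)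
    show "incseq (\<lambda>k u. ennreal (g (exp u) * exp u * indicator {- real k..real k} u))"
    proof (unfold incseq_def le_fun_def, intro allI impI ennreal_leI mult_left_mono)
      fix m n :: nat and u :: real assume "m \<le> n"
      hence "{- real m..real m} \<subseteq> {- real n..real n}" by simp
      thus "indicator {- real m..real m} u \<le> (indicator {- real n..real n} u :: real)"
        by (rule indicator_subset_mono)
    qed (use g in auto)
    fix u :: real
    obtain k :: nat where k: "\<bar>u\<bar> < real k" using reals_Archimedean2 by blast
    have "\<forall>\<^sub>F m in sequentially. ennreal (g (exp u) * exp u * indicator {- real m..real m} u) = ennreal (g (exp u) * exp u)"
      using eventually_ge_at_top[of k] by eventually_elim (use k in \<open>auto simp: indicator_def\<close>)
    thus "(\<lambda>k. ennreal (g (exp u) * exp u * indicator {- real k..real k} u)) \<longlonglongrightarrow> ennreal (g (exp u) * exp u)"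
      by (rule tendsto_eventually)
  qed measurable
  from l1 l2 show ?thesis unfolding e by (rule LIMSEQ_unique)
qed

text \<open>The Gamma integral in the variable t = exp u, where scaling t by c becomes translating u
  by ln c.\<close>

lemma nn_integral_Gamma_exp:
  assumes z: "z > 0" and c: "c > 0"
  shows "(\<integral>\<^sup>+u. ennreal (exp (- (c * exp u)) * exp (z * u)) \<partial>lborel) = ennreal (c powr (- z) * Gamma z)"
proof -
  have "ennreal (Gamma z) = (\<integral>\<^sup>+t. ennreal (t powr (z - 1) / exp t * indicator {0<..} t) \<partial>lborel)"
    unfolding Gamma_conv_nn_integral_real[OF z]
  proof (rule nn_integral_cong_AE)
    show "AE t in lborel. ennreal (indicator {0..} t * t powr (z - 1) / exp t) = ennreal (t powr (z - 1) / exp t * indicator {0<..} t)"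
      using AE_lborel_singleton[of "0::real"] by eventually_elim (auto simp: indicator_def)
  qed
  also have "\<dots> = (\<integral>\<^sup>+u. ennreal (exp u powr (z - 1) / exp (exp u) * exp u) \<partial>lborel)"
    by (rule nn_integral_exp_substitution) auto
  also have "(\<lambda>u::real. exp u powr (z - 1) / exp (exp u) * exp u) = (\<lambda>u. exp (- exp u) * exp (z * u))"
    by (simp add: fun_eq_iff powr_def exp_minus field_simps exp_diff)
  also have "(\<integral>\<^sup>+u. ennreal (exp (- exp u) * exp (z * u)) \<partial>lborel) =
      (\<integral>\<^sup>+u. ennreal (exp (- exp (ln c + 1 * u)) * exp (z * (ln c + 1 * u))) \<partial>lborel)"
    by (subst nn_integral_real_affine[where c = 1 and t = "ln c"]) auto
  also have "\<dots> = (\<integral>\<^sup>+u. ennreal (c powr z) * ennreal (exp (- (c * exp u)) * exp (z * u)) \<partial>lborel)"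
  proof (rule nn_integral_cong)
    fix u :: real
    have "exp (- exp (ln c + 1 * u)) * exp (z * (ln c + 1 * u)) = c powr z * (exp (- (c * exp u)) * exp (z * u))"
      using c by (simp add: exp_add powr_def distrib_left)
    thus "ennreal (exp (- exp (ln c + 1 * u)) * exp (z * (ln c + 1 * u))) = ennreal (c powr z) * ennreal (exp (- (c * exp u)) * exp (z * u))"
      by (simp add: ennreal_mult)
  qed
  also have "\<dots> = ennreal (c powr z) * (\<integral>\<^sup>+u. ennreal (exp (- (c * exp u)) * exp (z * u)) \<partial>lborel)"
    by (rule nn_integral_cmult) measurable
  finally have "ennreal (c powr (- z)) * ennreal (Gamma z) =
     ennreal (c powr (- z)) * ennreal (c powr z) * (\<integral>\<^sup>+u. ennreal (exp (- (c * exp u)) * exp (z * u)) \<partial>lborel)"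
    by (simp add: mult.assoc)
  also have "ennreal (c powr (- z)) * ennreal (c powr z) = 1"
    using c by (simp add: ennreal_mult[symmetric] powr_minus)
  finally show ?thesis using z by (simp add: ennreal_mult)
qed

lemma theta_tail_nonneg: "x > 0 \<Longrightarrow> theta_tail x \<ge> 0"
  unfolding theta_tail_def by (intro suminf_nonneg summable_theta_tail) auto

lemma measurable_theta_tail [measurable]: "theta_tail \<in> borel_measurable borel"
  unfolding theta_tail_def[abs_def] by measurable

text \<open>Riemann's integral: the n-th Gaussian contributes the Gamma integral scaled by n^2,
  hence the factor n^(-s), and the terms are nonnegative, so sum and integral may be
  exchanged.\<close>

lemma nn_integral_theta_tail:
  assumes s: "s > 1"
  shows "(\<integral>\<^sup>+u. ennreal (theta_tail (exp u) * exp (s / 2 * u)) \<partial>lborel) =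
     ennreal (pi powr (- (s / 2)) * Gamma (s / 2) * (\<Sum>n. real (Suc n) powr (- s)))"
proof -
  have sm: "summable (\<lambda>n. real (Suc n) powr (- s))"
    using s by (subst summable_Suc_iff) (simp add: summable_real_powr_iff)
  have "(\<integral>\<^sup>+u. ennreal (theta_tail (exp u) * exp (s / 2 * u)) \<partial>lborel) =
     (\<integral>\<^sup>+u. (\<Sum>n. ennreal (exp (- (pi * (real (Suc n))\<^sup>2 * exp u)) * exp (s / 2 * u))) \<partial>lborel)"
  proof (rule nn_integral_cong)
    fix u :: real
    have "(\<lambda>n. exp (- (pi * exp u * (real (Suc n))\<^sup>2)) * exp (s / 2 * u)) sums (theta_tail (exp u) * exp (s / 2 * u))"
      unfolding theta_tail_def by (intro sums_mult2 summable_sums summable_theta_tail) simp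
    hence "(\<lambda>n. exp (- (pi * (real (Suc n))\<^sup>2 * exp u)) * exp (s / 2 * u)) sums (theta_tail (exp u) * exp (s / 2 * u))"
      by (simp only: mult.commute mult.left_commute mult.assoc)
    thus "ennreal (theta_tail (exp u) * exp (s / 2 * u)) = (\<Sum>n. ennreal (exp (- (pi * (real (Suc n))\<^sup>2 * exp u)) * exp (s / 2 * u)))"
      by (subst suminf_ennreal_eq) auto
  qed
  also have "\<dots> = (\<Sum>n. \<integral>\<^sup>+u. ennreal (exp (- (pi * (real (Suc n))\<^sup>2 * exp u)) * exp (s / 2 * u)) \<partial>lborel)"
    by (rule nn_integral_suminf) measurable
  also have "\<dots> = (\<Sum>n. ennreal (pi powr (- (s / 2)) * Gamma (s / 2) * real (Suc n) powr (- s)))"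
  proof (rule suminf_cong)
    fix n
    have "(pi * (real (Suc n))\<^sup>2) powr (- (s / 2)) = pi powr (- (s / 2)) * real (Suc n) powr (- s)"
      by (simp add: powr_mult powr_powr flip: powr_numeral)
    thus "(\<integral>\<^sup>+u. ennreal (exp (- (pi * (real (Suc n))\<^sup>2 * exp u)) * exp (s / 2 * u)) \<partial>lborel) =
       ennreal (pi powr (- (s / 2)) * Gamma (s / 2) * real (Suc n) powr (- s))"
      using s by (subst nn_integral_Gamma_exp) (auto simp: mult_ac)
  qed
  also have "\<dots> = ennreal (pi powr (- (s / 2)) * Gamma (s / 2) * (\<Sum>n. real (Suc n) powr (- s)))"
    using s Gamma_real_pos[of "s / 2"] sm by (subst suminf_ennreal2) (auto simp: suminf_mult intro!: summable_mult)
  finally show ?thesis .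
qed

lemma nn_integral_real_line_split:
  assumes [measurable]: "\<phi> \<in> borel_measurable borel"
  shows "(\<integral>\<^sup>+u. \<phi> u \<partial>lborel) = (\<integral>\<^sup>+u. \<phi> u \<partial>halfline) + (\<integral>\<^sup>+u. \<phi> (- u) \<partial>halfline)"
proof -
  have "(\<integral>\<^sup>+u. \<phi> (- u) \<partial>halfline) = (\<integral>\<^sup>+u. \<phi> (- u) * indicator {0..} u \<partial>lborel)"
    by (subst nn_integral_restrict_space) auto
  also have "\<dots> = (\<integral>\<^sup>+u. \<phi> (- (0 + (-1) * u)) * indicator {0..} (0 + (-1) * u) \<partial>lborel)"
    by (subst nn_integral_real_affine[where c = "-1" and t = 0]) auto
  also have "\<dots> = (\<integral>\<^sup>+u. \<phi> u * indicator {..0} u \<partial>lborel)"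
    by (intro nn_integral_cong) (auto simp: indicator_def)
  finally have "(\<integral>\<^sup>+u. \<phi> u \<partial>halfline) + (\<integral>\<^sup>+u. \<phi> (- u) \<partial>halfline) =
     (\<integral>\<^sup>+u. \<phi> u * indicator {0..} u \<partial>lborel) + (\<integral>\<^sup>+u. \<phi> u * indicator {..0} u \<partial>lborel)"
    by (simp add: nn_integral_restrict_space)
  also have "\<dots> = (\<integral>\<^sup>+u. \<phi> u * indicator {0..} u + \<phi> u * indicator {..0} u \<partial>lborel)"
    by (rule nn_integral_add[symmetric]) measurable
  also have "\<dots> = (\<integral>\<^sup>+u. \<phi> u \<partial>lborel)"
  proof (rule nn_integral_cong_AE)
    show "AE u in lborel. \<phi> u * indicator {0..} u + \<phi> u * indicator {..0} u = \<phi> u"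
      using AE_lborel_singleton[of "0::real"] by eventually_elim (auto simp: indicator_def)
  qed
  finally show ?thesis by simp
qed

lemma has_bochner_integral_exp_halfline:
  assumes "a > 0"
  shows "has_bochner_integral halfline (\<lambda>u. exp (- (a * u))) (1 / a)"
proof (rule has_bochner_integral_nn_integral)
  have "((\<lambda>x. - (exp (- (a * x)) / a)) \<longlongrightarrow> - (0 / a)) at_top"
    using assms by real_asymp
  hence "(\<integral>\<^sup>+u\<in>{0..}. ennreal (exp (- (a * u)))\<partial>lborel) = ennreal (- (0 / a) - - (exp (- (a * 0)) / a))"
    using assms by (intro nn_integral_FTC_atLeast) (auto intro!: derivative_eq_intros)
  thus "(\<integral>\<^sup>+u. ennreal (exp (- (a * u))) \<partial>halfline) = ennreal (1 / a)"
    by (simp add: nn_integral_restrict_space)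
qed (use assms in auto)

lemma theta_tail_exp_minus:
  "theta_tail (exp (- u)) = exp (u / 2) * theta_tail (exp u) + exp (u / 2) / 2 - 1 / 2"
proof -
  have "sqrt (exp (- u)) = exp (- (u / 2))"
    by (rule real_sqrt_unique) (auto simp: power2_eq_square exp_add[symmetric])
  moreover have "1 / exp (- u) = exp u" by (simp add: exp_minus inverse_eq_divide)
  ultimately have "1 + 2 * theta_tail (exp (- u)) = (1 + 2 * theta_tail (exp u)) / exp (- (u / 2))"
    using theta_functional_equation[of "exp (- u)"] by (simp only: exp_gt_zero)
  also have "\<dots> = (1 + 2 * theta_tail (exp u)) * exp (u / 2)"
    by (simp only: exp_minus divide_inverse inverse_inverse_eq)
  finally show ?thesis by (simp add: algebra_simps)
qed

text \<open>Riemann's splitting at u = 0. The functional equation of theta folds u < 0 onto u > 0,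
  and its two elementary terms integrate to 1/(s - 1) and -1/s. As the first claim holds for every s
  > 1, \<open>theta_tail (exp u)\<close> is integrable against every exponential.\<close>

lemma integral_theta_tail_halfline:
  assumes "s > 1"
  shows "integrable halfline (\<lambda>u. theta_tail (exp u) * exp (s / 2 * u))"
    and "pi powr (- (s / 2)) * Gamma (s / 2) * (\<Sum>n. real (Suc n) powr (- s)) =
      (\<integral>u. theta_tail (exp u) * exp (s / 2 * u) \<partial>halfline) +
      (\<integral>u. theta_tail (exp u) * exp ((1 - s) / 2 * u) \<partial>halfline) + 1 / (s - 1) - 1 / s"
proof -
  define V where "V = pi powr (- (s / 2)) * Gamma (s / 2) * (\<Sum>n. real (Suc n) powr (- s))"
  define p where "p u = theta_tail (exp u) * exp (s / 2 * u)" for u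
  have [measurable]: "p \<in> borel_measurable borel" unfolding p_def by measurable
  have p: "p u \<ge> 0" for u by (simp add: p_def theta_tail_nonneg)
  have sm: "summable (\<lambda>n. real (Suc n) powr (- s))"
    using assms by (subst summable_Suc_iff) (simp add: summable_real_powr_iff)
  have V: "V \<ge> 0" unfolding V_def using assms
    by (intro mult_nonneg_nonneg suminf_nonneg sm less_imp_le[OF Gamma_real_pos] powr_ge_zero) simp
  have split: "(\<integral>\<^sup>+u. ennreal (p u) \<partial>halfline) + (\<integral>\<^sup>+u. ennreal (p (- u)) \<partial>halfline) = ennreal V"
  proof -
    have "(\<integral>\<^sup>+u. ennreal (p u) \<partial>lborel) = ennreal V"
      unfolding p_def V_def by (rule nn_integral_theta_tail[OF assms])
    thus ?thesis by (subst (asm) nn_integral_real_line_split) auto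
  qed
  hence fin: "(\<integral>\<^sup>+u. ennreal (p u) \<partial>halfline) < \<infinity>" "(\<integral>\<^sup>+u. ennreal (p (- u)) \<partial>halfline) < \<infinity>"
    by (metis ennreal_add_eq_top ennreal_neq_top infinity_ennreal_def less_top)+
  have i1: "integrable halfline p" and i2: "integrable halfline (\<lambda>u. p (- u))"
    using fin p by (auto intro!: integrableI_nonneg)
  show "integrable halfline (\<lambda>u. theta_tail (exp u) * exp (s / 2 * u))"
    using i1 unfolding p_def .
  have nn: "0 \<le> integral\<^sup>L halfline p" "0 \<le> (\<integral>u. p (- u) \<partial>halfline)"
    using p by (auto intro!: integral_nonneg_AE)
  have "ennreal (integral\<^sup>L halfline p) + ennreal (\<integral>u. p (- u) \<partial>halfline) = ennreal V"
    using split p by (simp add: nn_integral_eq_integral i1 i2)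
  hence "ennreal (integral\<^sup>L halfline p + (\<integral>u. p (- u) \<partial>halfline)) = ennreal V"
    by (simp only: ennreal_plus[OF nn])
  hence V': "integral\<^sup>L halfline p + (\<integral>u. p (- u) \<partial>halfline) = V"
    using V nn by (subst (asm) ennreal_inj) auto
  define q where "q u = theta_tail (exp u) * exp ((1 - s) / 2 * u)" for u
  have pq: "p (- u) = q u + 1 / 2 * exp (- ((s - 1) / 2 * u)) - 1 / 2 * exp (- (s / 2 * u))" for u
  proof -
    have XY: "exp (u / 2) * exp (s / 2 * - u) = exp ((1 - s) / 2 * u)"
      unfolding exp_add[symmetric] by (simp add: field_simps)
    have "- ((s - 1) / 2 * u) = (1 - s) / 2 * u" by (simp add: field_simps)
    moreover have "- (s / 2 * u) = s / 2 * - u" by simp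
    moreover have "(X * T + X / 2 - 1 / 2) * Y = T * (X * Y) + 1 / 2 * (X * Y) - 1 / 2 * Y" for X Y T :: real
      by (simp add: algebra_simps)
    ultimately show ?thesis
      unfolding p_def q_def theta_tail_exp_minus XY[symmetric] by (simp only: XY)
  qed
  have e1: "has_bochner_integral halfline (\<lambda>u. 1 / 2 * exp (- ((s - 1) / 2 * u))) (1 / 2 * (1 / ((s - 1) / 2)))"
    and e2: "has_bochner_integral halfline (\<lambda>u. 1 / 2 * exp (- (s / 2 * u))) (1 / 2 * (1 / (s / 2)))"
    using assms by (intro has_bochner_integral_mult_right has_bochner_integral_exp_halfline; simp)+
  have qe: "q = (\<lambda>u. p (- u) - 1 / 2 * exp (- ((s - 1) / 2 * u)) + 1 / 2 * exp (- (s / 2 * u)))"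
    by (simp add: fun_eq_iff pq)
  have q: "has_bochner_integral halfline q ((\<integral>u. p (- u) \<partial>halfline) - 1 / 2 * (1 / ((s - 1) / 2)) + 1 / 2 * (1 / (s / 2)))"
    unfolding qe by (intro has_bochner_integral_add has_bochner_integral_diff e1 e2 has_bochner_integral_integrable i2)
  have "(\<integral>u. q u \<partial>halfline) = (\<integral>u. p (- u) \<partial>halfline) - 1 / (s - 1) + 1 / s"
    using has_bochner_integral_integral_eq[OF q] assms by simp
  hence "V = (\<integral>u. p u \<partial>halfline) + (\<integral>u. q u \<partial>halfline) + 1 / (s - 1) - 1 / s"
    using V' by simp
  thus "pi powr (- (s / 2)) * Gamma (s / 2) * (\<Sum>n. real (Suc n) powr (- s)) =
      (\<integral>u. theta_tail (exp u) * exp (s / 2 * u) \<partial>halfline) +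
      (\<integral>u. theta_tail (exp u) * exp ((1 - s) / 2 * u) \<partial>halfline) + 1 / (s - 1) - 1 / s"
    unfolding V_def p_def q_def .
qed

section \<open>The continuation of zeta by the theta transform\<close>

definition theta_mellin :: "complex \<Rightarrow> complex" where
  "theta_mellin z = laplace_half (\<lambda>u. theta_tail (exp u)) z"

text \<open>The transform converges at -(s/2) for arbitrarily large s, so every point of the plane
  lies to the right of a point of convergence.\<close>

lemma theta_mellin_holomorphic: "theta_mellin holomorphic_on UNIV"
proof -
  have cv: "laplace_half_conv (\<lambda>u. theta_tail (exp u)) (- (s / 2))" if "s > 1" for s
    using integral_theta_tail_halfline(1)[OF that] by (simp add: laplace_conv_def)
  have "theta_mellin field_differentiable (at z)" for z
  proof -
    define s where "s = 2 * \<bar>Re z\<bar> + 3"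
    have "laplace_half (\<lambda>u. theta_tail (exp u)) holomorphic_on {z. Re z > - (s / 2)}"
      by (rule laplace_holomorphic) (auto intro!: cv simp: s_def[symmetric], simp add: s_def)
    hence "theta_mellin holomorphic_on {z. Re z > - (s / 2)}"
      by (simp add: theta_mellin_def[abs_def])
    moreover have "open {z. Re z > - (s / 2)}" by (rule open_halfspace_Re_gt)
    moreover have "Re z > - (s / 2)" unfolding s_def using abs_ge_minus_self[of "Re z"] by (simp add: field_simps)
    hence "z \<in> {z. Re z > - (s / 2)}" by simp
    ultimately show ?thesis by (rule holomorphic_on_imp_differentiable_at)
  qed
  thus ?thesis by (simp add: holomorphic_on_def field_differentiable_at_within)
qed

text \<open>The identity theorem, since the midpoint of the interval is a limit point. It allows
  each identity between transforms to be verified for real arguments, where only real integrals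
  occur.\<close>

lemma holomorphic_eq_from_real_interval:
  assumes f: "f holomorphic_on S" and g: "g holomorphic_on S" and S: "open S" "connected S"
    and ab: "a < b" and sub: "\<And>x. a < x \<Longrightarrow> x < b \<Longrightarrow> complex_of_real x \<in> S"
    and eq: "\<And>x. a < x \<Longrightarrow> x < b \<Longrightarrow> f (complex_of_real x) = g (complex_of_real x)"
    and w: "w \<in> S"
  shows "f w = g w"
proof -
  define m where "m = (a + b) / 2"
  have m: "a < m" "m < b" using ab by (auto simp: m_def)
  have "m islimpt {a<..<b}" using m by (simp add: islimpt_greaterThanLessThan1 interior_limit_point)
  hence lim: "complex_of_real m islimpt (complex_of_real ` {a<..<b})"
    by (rule islimpt_isCont_image) (auto simp: eventually_at_filter)
  have "f w - g w = 0"
  proof (rule analytic_continuation[where f = "\<lambda>z. f z - g z", OF _ S _ _ lim _ w])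
    show "(\<lambda>z. f z - g z) holomorphic_on S" using f g by (rule holomorphic_on_diff)
  qed (use sub eq m in auto)
  thus ?thesis by simp
qed


text \<open>Riemann's formula solved for zeta. \<open>rGamma\<close> is entire, so no division by
  Gamma occurs, and the pole term -1/s is absorbed through rGamma(s/2) / s = rGamma(s/2 + 1) / 2,
  which removes the singularity at 0. At the pole 1 the value is the one prescribed for
  \<open>zeta\<close>.\<close>

definition zeta_by_theta :: "complex \<Rightarrow> complex" where
  "zeta_by_theta s = (if s = 1 then 0 else
     of_real pi powr (s / 2) * (rGamma (s / 2) * (theta_mellin (- s / 2) + theta_mellin ((s - 1) / 2) + 1 / (s - 1))
       - rGamma (s / 2 + 1) / 2))"

lemma zeta_by_theta_holomorphic: "zeta_by_theta holomorphic_on (- {1})"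
proof -
  have *: "(\<lambda>s. theta_mellin (h s)) holomorphic_on A" if "h holomorphic_on A" for h A
    using holomorphic_on_compose_gen[OF that theta_mellin_holomorphic] by (simp add: o_def)
  have "(\<lambda>s. of_real pi powr (s / 2) * (rGamma (s / 2) * (theta_mellin (- s / 2) + theta_mellin ((s - 1) / 2) + 1 / (s - 1))
       - rGamma (s / 2 + 1) / 2)) holomorphic_on (- {1})"
    by (intro holomorphic_intros * holomorphic_rGamma') auto
  thus ?thesis by (rule holomorphic_transform) (simp add: zeta_by_theta_def)
qed

text \<open>Indexed from \<open>Suc n\<close> so that the exponents ln(n + 1) are nonnegative, as
  the general transform requires; holomorphy and bounds are inherited from it.\<close>

definition dirichlet_series :: "(nat \<Rightarrow> real) \<Rightarrow> complex \<Rightarrow> complex" where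
  "dirichlet_series a = laplace (count_space UNIV) (\<lambda>n. ln (real (Suc n))) (\<lambda>n. a (Suc n))"

lemma dirichlet_series_conv:
  assumes a: "\<And>n. \<bar>a n\<bar> \<le> 1" and s: "s > 1"
  shows "laplace_conv (count_space UNIV) (\<lambda>n. ln (real (Suc n))) (\<lambda>n. a (Suc n)) s"
proof -
  have "summable (\<lambda>n. real (Suc n) powr (- s))"
    using s by (subst summable_Suc_iff) (simp add: summable_real_powr_iff)
  hence "summable (\<lambda>n. norm (a (Suc n) * exp (- (s * ln (real (Suc n))))))"
  proof (rule summable_comparison_test'[where N = 0])
    fix n
    have "\<bar>a (Suc n)\<bar> * exp (- (s * ln (real (Suc n)))) \<le> 1 * exp (- (s * ln (real (Suc n))))"
      by (intro mult_right_mono a) auto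
    thus "norm (norm (a (Suc n) * exp (- (s * ln (real (Suc n)))))) \<le> real (Suc n) powr (- s)"
      by (simp add: abs_mult powr_def)
  qed
  thus ?thesis by (simp add: laplace_conv_def integrable_count_space_nat_iff)
qed

lemma dirichlet_series_holomorphic:
  assumes a: "\<And>n. \<bar>a n\<bar> \<le> 1"
  shows "dirichlet_series a holomorphic_on {s. Re s > 1}"
proof -
  have "dirichlet_series a field_differentiable (at s)" if "Re s > 1" for s
  proof -
    define c where "c = (1 + Re s) / 2"
    have "dirichlet_series a holomorphic_on {s. Re s > c}"
      unfolding dirichlet_series_def using that
      by (intro laplace_holomorphic dirichlet_series_conv a) (auto simp: c_def)
    moreover have "open {s. Re s > c}" by (rule open_halfspace_Re_gt)
    moreover have "s \<in> {s. Re s > c}" using that by (simp add: c_def)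
    ultimately show ?thesis by (rule holomorphic_on_imp_differentiable_at)
  qed
  thus ?thesis by (auto simp: holomorphic_on_def intro: field_differentiable_at_within)
qed

lemma dirichlet_series_sums:
  assumes a: "\<And>n. \<bar>a n\<bar> \<le> 1" and s: "Re s > 1"
  shows "(\<lambda>n. of_real (a (Suc n)) * of_nat (Suc n) powr (- s)) sums dirichlet_series a s"
proof -
  have i: "integrable (count_space UNIV) (\<lambda>n. of_real (a (Suc n)) * exp (- (s * of_real (ln (real (Suc n))))))"
    using s by (intro laplace_integrable[OF _ _ _ dirichlet_series_conv[OF a]]) auto
  have e: "exp (- (s * of_real (ln (real (Suc n))))) = of_nat (Suc n) powr (- s)" for n
  proof -
    have "Ln (of_nat (Suc n)) = of_real (ln (real (Suc n)))"
      using Ln_of_real[of "real (Suc n)"] by simp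
    moreover have "complex_of_nat (Suc n) \<noteq> 0" by (rule of_nat_neq_0)
    ultimately show ?thesis by (simp only: powr_def if_False mult_minus_left)
  qed
  show "(\<lambda>n. of_real (a (Suc n)) * of_nat (Suc n) powr (- s)) sums dirichlet_series a s"
    using sums_integral_count_space_nat[OF i] unfolding dirichlet_series_def laplace_def e .
qed

lemma dirichlet_series_one:
  assumes "Re s > 1"
  shows "dirichlet_series (\<lambda>_. 1) s = (\<Sum>n. 1 / of_nat (Suc n) powr s)"
  using dirichlet_series_sums[of "\<lambda>_. 1" s] assms
  by (simp add: sums_iff powr_minus divide_inverse)

text \<open>The split integral is multiplied by pi^(x/2) rGamma(x/2), the reciprocal of the
  completing factor; \<open>rGamma_plus1\<close> restores the pole term -1/x.\<close>

lemma zeta_by_theta_of_real: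
  assumes x: "x > 1"
  shows "zeta_by_theta (of_real x) = dirichlet_series (\<lambda>_. 1) (of_real x)"
proof -
  define D where "D = (\<Sum>n. real (Suc n) powr (- x))"
  define A where "A = (\<integral>u. theta_tail (exp u) * exp (x / 2 * u) \<partial>halfline)"
  define B where "B = (\<integral>u. theta_tail (exp u) * exp ((1 - x) / 2 * u) \<partial>halfline)"
  have key: "pi powr (- (x / 2)) * Gamma (x / 2) * D = A + B + 1 / (x - 1) - 1 / x"
    unfolding D_def A_def B_def by (rule integral_theta_tail_halfline(2)[OF x])
  have A: "theta_mellin (- of_real x / 2) = of_real A"
    using laplace_of_real[of halfline "\<lambda>u. u" "\<lambda>u. theta_tail (exp u)" "- x / 2"]
    by (simp add: theta_mellin_def A_def)
  have B: "theta_mellin ((of_real x - 1) / 2) = of_real B"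
  proof -
    have "(1 - x) / 2 * u = - ((x - 1) / 2 * u)" for u by (simp add: field_simps)
    hence "B = (\<integral>u. theta_tail (exp u) * exp (- ((x - 1) / 2 * u)) \<partial>halfline)"
      unfolding B_def by (simp only:)
    thus ?thesis
      using laplace_of_real[of halfline "\<lambda>u. u" "\<lambda>u. theta_tail (exp u)" "(x - 1) / 2"]
      unfolding theta_mellin_def by simp
  qed
  have G: "rGamma (x / 2) = inverse (Gamma (x / 2))" "Gamma (x / 2) \<noteq> 0"
  proof -
    have "Gamma (x / 2) > 0" using x by (intro Gamma_real_pos) simp
    thus "Gamma (x / 2) \<noteq> 0" by simp
  qed (rule rGamma_inverse_Gamma)
  have G1: "rGamma (x / 2 + 1) / 2 = rGamma (x / 2) / x"
  proof -
    have "t / 2 = r / x" if "x / 2 * t = r" for r t :: real using that x by (auto simp: field_simps)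
    thus ?thesis using rGamma_plus1[of "x / 2"] by blast
  qed
  have pw: "pi powr (x / 2) * pi powr (- (x / 2)) = 1"
    by (simp add: powr_minus)
  have "pi powr (x / 2) * (rGamma (x / 2) * (A + B + 1 / (x - 1)) - rGamma (x / 2 + 1) / 2) =
     pi powr (x / 2) * (rGamma (x / 2) * (A + B + 1 / (x - 1) - 1 / x))"
    unfolding G1 by (simp add: algebra_simps)
  also have "\<dots> = (pi powr (x / 2) * pi powr (- (x / 2))) * (rGamma (x / 2) * Gamma (x / 2)) * D"
    unfolding key[symmetric] by (simp only: mult_ac)
  also have "\<dots> = D" unfolding pw using G by simp
  finally have r: "pi powr (x / 2) * (rGamma (x / 2) * (A + B + 1 / (x - 1)) - rGamma (x / 2 + 1) / 2) = D" .
  have "zeta_by_theta (of_real x) = of_real (pi powr (x / 2) * (rGamma (x / 2) * (A + B + 1 / (x - 1)) - rGamma (x / 2 + 1) / 2))"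
  proof -
    have r1: "rGamma (complex_of_real x / 2) = of_real (rGamma (x / 2))"
      using rGamma_complex_of_real[of "x / 2"] by simp
    have r2: "rGamma (complex_of_real x / 2 + 1) = of_real (rGamma (x / 2 + 1))"
      using rGamma_complex_of_real[of "x / 2 + 1"] by simp
    have r3: "complex_of_real pi powr (of_real x / 2) = of_real (pi powr (x / 2))"
      using powr_of_real[of pi "x / 2"] by simp
    have r4: "of_real p * (of_real g * (of_real A + of_real B + 1 / (of_real x - 1)) - of_real h / 2) =
        complex_of_real (p * (g * (A + B + 1 / (x - 1)) - h / 2))" for p g h :: real by simp
    have "complex_of_real x \<noteq> 1" using x by simp
    thus ?thesis unfolding zeta_by_theta_def A B r1 r2 r3 r4 by (simp only: if_False)
  qed
  also have "\<dots> = dirichlet_series (\<lambda>_. 1) (of_real x)"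
  proof -
    have "(\<integral>n. 1 * exp (- (x * ln (real (Suc n)))) \<partial>count_space UNIV) = D"
      using dirichlet_series_conv[of "\<lambda>_. 1" x] x
      by (simp add: D_def laplace_conv_def integral_count_space_nat powr_def)
    thus ?thesis unfolding dirichlet_series_def laplace_of_real r by simp
  qed
  finally show ?thesis .
qed

lemma connected_halfplane: "connected {s. Re s > a}"
  by (intro convex_connected convex_halfspace_Re_gt)

lemma zeta_by_theta_eq_dirichlet_series:
  assumes "Re s > 1"
  shows "zeta_by_theta s = dirichlet_series (\<lambda>_. 1) s"
proof (rule holomorphic_eq_from_real_interval[where a = 1 and b = 2 and S = "{s. Re s > 1}"
      and f = zeta_by_theta and g = "dirichlet_series (\<lambda>_. 1)" and w = s])
  show "zeta_by_theta holomorphic_on {s. Re s > 1}"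
    by (rule holomorphic_on_subset[OF zeta_by_theta_holomorphic]) auto
  show "dirichlet_series (\<lambda>_. 1) holomorphic_on {s. Re s > 1}"
    by (rule dirichlet_series_holomorphic) simp
  show "open {s. Re s > 1}" by (rule open_halfspace_Re_gt)
  show "connected {s. Re s > 1}" by (rule connected_halfplane)
qed (use assms zeta_by_theta_of_real in auto)

text \<open>Any function meeting the defining conditions agrees with \<open>zeta_by_theta\<close>
  for Re s > 1, hence on the connected punctured plane, and at 1 by prescription. Existence and
  uniqueness together evaluate \<open>THE\<close>.\<close>

lemma zeta_eq_zeta_by_theta: "zeta = zeta_by_theta"
  unfolding zeta_def
proof (rule the_equality)
  show "zeta_by_theta holomorphic_on - {1} \<and>
    (\<forall>s. 1 < Re s \<longrightarrow> zeta_by_theta s = (\<Sum>n. 1 / of_nat (Suc n) powr s)) \<and> zeta_by_theta 1 = 0"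
    using zeta_by_theta_holomorphic zeta_by_theta_eq_dirichlet_series dirichlet_series_one
    by (auto simp: zeta_by_theta_def)
  fix f :: "complex \<Rightarrow> complex"
  assume f: "f holomorphic_on - {1} \<and> (\<forall>s. 1 < Re s \<longrightarrow> f s = (\<Sum>n. 1 / of_nat (Suc n) powr s)) \<and> f 1 = 0"
  show "f = zeta_by_theta"
  proof
    fix z
    show "f z = zeta_by_theta z"
    proof (cases "z = 1")
      case True
      thus ?thesis using f by (simp add: zeta_by_theta_def)
    next
      case False
      show ?thesis
      proof (rule analytic_continuation_open[of "{s. Re s > 1}" "- {1}" f zeta_by_theta z])
        have "complex_of_real 2 \<in> {s. Re s > 1}" by simp
        thus "{s. Re s > 1} \<noteq> {}" by blast
        show "connected (- {1::complex})" by (rule connected_punctured_universe) simp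
      qed (use f False zeta_by_theta_holomorphic zeta_by_theta_eq_dirichlet_series dirichlet_series_one
            in \<open>auto simp: open_halfspace_Re_gt\<close>)
    qed
  qed
qed

lemma zeta_holomorphic: "zeta holomorphic_on (- {1})"
  by (simp add: zeta_eq_zeta_by_theta zeta_by_theta_holomorphic)

lemma zeta_eq_dirichlet_series: "Re s > 1 \<Longrightarrow> zeta s = dirichlet_series (\<lambda>_. 1) s"
  by (simp add: zeta_eq_zeta_by_theta zeta_by_theta_eq_dirichlet_series)

text \<open>Off the real axis the completing factors have no zeros, so the functional equation reflects zeros.\<close>

lemma zeta_zero_reflect:
  assumes s: "Im s \<noteq> 0" and z: "zeta s = 0"
  shows "zeta (1 - s) = 0"
proof -
  \<comment> \<open>The completed zeta function. Replacing s by 1 - s swaps the two transforms and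
    swaps the two pole terms.\<close>
  define \<Lambda> where "\<Lambda> s = theta_mellin (- s / 2) + theta_mellin ((s - 1) / 2) + 1 / (s - 1) - 1 / s" for s
  have zl: "zeta s = of_real pi powr (s / 2) * rGamma (s / 2) * \<Lambda> s" if "Im s \<noteq> 0" for s
  proof -
    have s: "s \<noteq> 0" "s \<noteq> 1" using that by auto
    have "rGamma (s / 2 + 1) / 2 = rGamma (s / 2) / s"
    proof -
      have "t / 2 = r / s" if "s / 2 * t = r" for r t :: complex
        unfolding that[symmetric] using s by simp
      thus ?thesis using rGamma_plus1[of "s / 2"] by blast
    qed
    thus ?thesis using s by (simp add: zeta_eq_zeta_by_theta zeta_by_theta_def \<Lambda>_def algebra_simps)
  qed
  have "\<Lambda> (1 - s) = \<Lambda> s"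
  proof -
    have "1 / (1 - s) = - (1 / (s - 1))" by (metis minus_diff_eq minus_divide_right)
    moreover have "1 / (1 - s - 1) = - (1 / s)" by simp
    moreover have "- (1 - s) / 2 = (s - 1) / 2" "(1 - s - 1) / 2 = - s / 2" by simp_all
    ultimately show ?thesis unfolding \<Lambda>_def by (simp only:) simp
  qed
  moreover have "\<Lambda> s = 0"
  proof -
    have "s / 2 \<notin> \<int>\<^sub>\<le>\<^sub>0"
    proof
      assume "s / 2 \<in> \<int>\<^sub>\<le>\<^sub>0"
      then obtain n where "s / 2 = - of_nat n" by (elim nonpos_Ints_cases')
      hence "Im (s / 2) = 0" by simp
      thus False using s by simp
    qed
    hence "rGamma (s / 2) \<noteq> 0" by (simp add: rGamma_eq_zero_iff)
    thus ?thesis using zl[OF s] z by simp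
  qed
  ultimately show ?thesis using zl[of "1 - s"] s by simp
qed

subsection \<open>Summatory functions\<close>

lemma prod_prime_factors_squarefree:
  fixes d :: nat
  assumes "squarefree d"
  shows "\<Prod>(prime_factors d) = d"
proof -
  have d: "d \<noteq> 0" using assms by (metis not_squarefree_0)
  have "multiplicity p d = 1" if "p \<in> prime_factors d" for p
  proof -
    have "prime p" "p dvd d" using that by auto
    hence "multiplicity p d > 0" using d by (simp add: prime_multiplicity_gt_zero_iff)
    moreover have "multiplicity p d \<le> 1"
      using assms d \<open>prime p\<close> squarefree_factorial_semiring''[of d] by auto
    ultimately show ?thesis by simp
  qed
  hence "(\<Prod>p\<in>prime_factors d. p ^ multiplicity p d) = (\<Prod>p\<in>prime_factors d. p)"
    by (intro prod.cong) auto
  thus ?thesis using prime_factorization_nat[of d] d by simp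
qed

text \<open>Only squarefree divisors count. They are the products of the sets of prime factors of n,
  so the sum is the expansion of the product of 1 - 1 over the primes dividing n, which is empty
  exactly for n = 1.\<close>

lemma sum_moebius_mu_divisors:
  assumes n: "n > 0"
  shows "(\<Sum>d | d dvd n. moebius_mu d) = (if n = 1 then 1 else 0)"
proof -
  define P where "P = prime_factors n"
  have P: "finite P" "\<And>p. p \<in> P \<Longrightarrow> prime p" by (auto simp: P_def)
  have fin: "finite {d. d dvd n}" using n by simp
  have "(\<Sum>d | d dvd n. moebius_mu d) = (\<Sum>d | d dvd n \<and> squarefree d. (- 1) ^ card (prime_factors d))"
    using fin by (intro sum.mono_neutral_cong_right) (auto simp: moebius_mu_def)
  also have "\<dots> = (\<Sum>S\<in>Pow P. (- 1) ^ card S)"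
  proof (rule sum.reindex_bij_witness[of _ "\<lambda>S. \<Prod>S" prime_factors])
    fix d assume d: "d \<in> {d. d dvd n \<and> squarefree d}"
    show "\<Prod>(prime_factors d) = d" using d by (simp add: prod_prime_factors_squarefree)
    show "prime_factors d \<in> Pow P" using d n dvd_prime_factors[of n d] by (auto simp: P_def)
  next
    fix S assume "S \<in> Pow P"
    hence S: "S \<subseteq> P" "finite S" using P finite_subset by auto
    show pf: "prime_factors (\<Prod>S) = S"
    proof -
      have "0 \<notin> S" using S P(2)[of 0] by auto
      hence "prime_factors (\<Prod>S) = (\<Union>p\<in>S. prime_factors p)"
        using prime_factors_prod[of S id] S by (simp add: id_def)
      also have "\<dots> = (\<Union>p\<in>S. {p})" using S P by (intro SUP_cong) (auto simp: prime_prime_factors)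
      finally show ?thesis by simp
    qed
    have "squarefree (\<Prod>S)"
      using S P by (intro squarefree_prod_coprime) (auto intro!: primes_coprime squarefree_prime)
    moreover have "\<Prod>S dvd n"
    proof -
      have "\<Prod>S dvd \<Prod>P" using S P by (intro prod_dvd_prod_subset) auto
      also have "\<Prod>P dvd (\<Prod>p\<in>P. p ^ multiplicity p n)"
        using n by (intro prod_dvd_prod dvd_power) (auto simp: P_def prime_factors_multiplicity)
      also have "\<dots> = n" using prime_factorization_nat[of n] n by (simp add: P_def)
      finally show ?thesis .
    qed
    ultimately show "\<Prod>S \<in> {d. d dvd n \<and> squarefree d}" by simp
  qed auto
  also have "\<dots> = (\<Prod>x\<in>P. 1 - 1 :: int)"
    using prod_diff_conv_sum[OF P(1), of "\<lambda>_. 1 :: int" "\<lambda>_. 1"] by simp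
  also have "\<dots> = (if n = 1 then 1 else 0)"
  proof (cases "n = 1")
    case False
    then obtain p where "prime p" "p dvd n" using prime_factor_nat by blast
    hence "p \<in> P" using n by (simp add: P_def prime_factors_dvd)
    thus ?thesis using P False by (auto simp: card_gt_0_iff)
  qed (simp add: P_def)
  finally show ?thesis .
qed

abbreviation mu_real :: "nat \<Rightarrow> real" where
  "mu_real n \<equiv> of_int (moebius_mu n)"

lemma abs_mu_real_le: "\<bar>mu_real n\<bar> \<le> 1"
  by (simp add: moebius_mu_def)

lemma dirichlet_series_of_real:
  assumes a: "\<And>n. \<bar>a n\<bar> \<le> 1" and s: "s > 1"
  shows "dirichlet_series a (of_real s) = of_real (\<Sum>n. a (Suc n) * real (Suc n) powr (- s))"
    and "summable (\<lambda>n. \<bar>a (Suc n) * real (Suc n) powr (- s)\<bar>)"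
proof -
  have e: "a (Suc n) * exp (- (s * ln (real (Suc n)))) = a (Suc n) * real (Suc n) powr (- s)" for n
    by (simp add: powr_def)
  have i: "integrable (count_space UNIV) (\<lambda>n. a (Suc n) * real (Suc n) powr (- s))"
    using dirichlet_series_conv[of a, OF a s] unfolding laplace_conv_def e .
  show "dirichlet_series a (of_real s) = of_real (\<Sum>n. a (Suc n) * real (Suc n) powr (- s))"
    unfolding dirichlet_series_def laplace_of_real e by (simp only: integral_count_space_nat[OF i])
  show "summable (\<lambda>n. \<bar>a (Suc n) * real (Suc n) powr (- s)\<bar>)"
    using i by (simp add: integrable_count_space_nat_iff)
qed

text \<open>Passes from ordered series to unordered sums over n \<ge> 1, in which pairs can be
  regrouped freely.\<close>

lemma infsum_Suc_eq_suminf: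
  fixes f :: "nat \<Rightarrow> real"
  assumes "summable (\<lambda>n. \<bar>f (Suc n)\<bar>)"
  shows "(f has_sum (\<Sum>n. f (Suc n))) {1..}" and "((\<lambda>n. \<bar>f n\<bar>) summable_on {1..})"
proof -
  have b: "bij_betw Suc UNIV {1..}" by (rule bij_betwI[of _ _ _ "\<lambda>n. n - 1"]) auto
  have "((\<lambda>n. f (Suc n)) has_sum (\<Sum>n. f (Suc n))) UNIV"
    by (rule norm_summable_imp_has_sum) (use assms summable_rabs_cancel in auto)
  thus "(f has_sum (\<Sum>n. f (Suc n))) {1..}"
    using has_sum_reindex_bij_betw[OF b, of f] by simp
  have "(\<lambda>n. \<bar>f (Suc n)\<bar>) summable_on UNIV"
    using assms by (intro summable_nonneg_imp_summable_on) auto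
  thus "(\<lambda>n. \<bar>f n\<bar>) summable_on {1..}"
    using summable_on_reindex_bij_betw[OF b, of "\<lambda>n. \<bar>f n\<bar>"] by simp
qed

text \<open>The absolutely convergent double sum over pairs (d, m) is regrouped by n = d m; the
  inner sum of the Moebius function over the divisors of n vanishes unless n = 1.\<close>

lemma dirichlet_series_mu_inverse_real:
  assumes s: "s > 1"
  shows "(\<Sum>n. mu_real (Suc n) * real (Suc n) powr (- s)) * (\<Sum>n. real (Suc n) powr (- s)) = 1"
proof -
  define c where "c n = mu_real n * real n powr (- s)" for n
  define e where "e n = real n powr (- s)" for n
  define D where "D n = {d::nat. d dvd n}" for n :: nat
  have "summable (\<lambda>n. \<bar>c (Suc n)\<bar>)"
    using dirichlet_series_of_real(2)[of mu_real, OF abs_mu_real_le s] unfolding c_def .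
  note sc = infsum_Suc_eq_suminf[OF this]
  have "summable (\<lambda>n. \<bar>e (Suc n)\<bar>)"
    using dirichlet_series_of_real(2)[of "\<lambda>_. 1", OF _ s] unfolding e_def by simp
  note se = infsum_Suc_eq_suminf[OF this]
  have ce: "(\<lambda>(d, m). c d * e m) summable_on {1..} \<times> {1..}"
  proof (rule Infinite_Sum.abs_summable_summable, rule Infinite_Sum.abs_summable_on_Sigma_iff[THEN iffD2], intro conjI ballI)
    fix d :: nat
    have "(\<lambda>m. \<bar>c d\<bar> * \<bar>e m\<bar>) summable_on {1..}"
      by (intro summable_on_cmult_right se(2))
    thus "(\<lambda>m. norm (case (d, m) of (d, m) \<Rightarrow> c d * e m)) summable_on {1..}"
      by (simp add: abs_mult)
  next
    have "(\<lambda>d. \<bar>c d\<bar> * \<bar>\<Sum>\<^sub>\<infinity>m\<in>{1..}. \<bar>e m\<bar>\<bar>) summable_on {1..}"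
      by (intro summable_on_cmult_left sc(2))
    thus "(\<lambda>d. norm (\<Sum>\<^sub>\<infinity>m\<in>{1..}. norm (case (d, m) of (d, m) \<Rightarrow> c d * e m))) summable_on {1..}"
      by (simp add: infsum_cmult_right' abs_mult)
  qed
  have "(\<Sum>\<^sub>\<infinity>(d, m)\<in>{1..}\<times>{1..}. c d * e m) = (\<Sum>\<^sub>\<infinity>d\<in>{1..}. \<Sum>\<^sub>\<infinity>m\<in>{1..}. c d * e m)"
    by (rule infsum_Sigma'_banach[symmetric]) (rule ce)
  also have "\<dots> = (\<Sum>n. c (Suc n)) * (\<Sum>n. e (Suc n))"
    unfolding infsum_cmult_right' infsum_cmult_left' infsumI[OF sc(1)] infsumI[OF se(1)] ..
  finally have prod: "(\<Sum>\<^sub>\<infinity>(d, m)\<in>{1..}\<times>{1..}. c d * e m) = (\<Sum>n. c (Suc n)) * (\<Sum>n. e (Suc n))" .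
  have bij: "bij_betw (\<lambda>(n, d). (d, n div d)) (Sigma {1..} D) ({1..} \<times> {1..})"
  proof (rule bij_betwI[of _ _ _ "\<lambda>(d, m). (d * m, d)"])
    show "(\<lambda>(n, d). (d, n div d)) \<in> Sigma {1..} D \<rightarrow> {1..} \<times> {1..}"
    proof
      fix p assume p: "p \<in> Sigma {1..} D"
      obtain n d where nd: "p = (n, d)" by (cases p)
      have "n \<ge> 1" "d dvd n" using p by (auto simp: nd D_def)
      then obtain k where k: "n = d * k" by (elim dvdE)
      have "d \<ge> 1" "k \<ge> 1" using \<open>n \<ge> 1\<close> k by (cases d; cases k; simp)+
      thus "(case p of (n, d) \<Rightarrow> (d, n div d)) \<in> {1..} \<times> {1..}" by (simp add: nd k)
    qed
  qed (auto simp: D_def intro: Nat.gr0I)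
  have t: "(case (case p of (n, d) \<Rightarrow> (d, n div d)) of (d, m) \<Rightarrow> c d * e m) = (case p of (n, d) \<Rightarrow> mu_real d * real n powr (- s))"
    if "p \<in> Sigma {1..} D" for p
  proof -
    obtain n d where p: "p = (n, d)" by (cases p)
    have "d * (n div d) = n" using that by (simp add: p D_def)
    hence "real d * real (n div d) = real n" by (metis of_nat_mult)
    hence "real n powr (- s) = (real d * real (n div d)) powr (- s)" by simp
    also have "\<dots> = real d powr (- s) * real (n div d) powr (- s)" by (simp add: powr_mult)
    finally have "real d powr (- s) * real (n div d) powr (- s) = real n powr (- s)" ..
    thus ?thesis by (simp add: p c_def e_def)
  qed
  have "(\<lambda>p. case (case p of (n, d) \<Rightarrow> (d, n div d)) of (d, m) \<Rightarrow> c d * e m) summable_on Sigma {1..} D"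
    by (rule summable_on_reindex_bij_betw[OF bij, of "\<lambda>(d, m). c d * e m", THEN iffD2]) (rule ce)
  hence sm: "(\<lambda>(n, d). mu_real d * real n powr (- s)) summable_on Sigma {1..} D"
    by (rule summable_on_cong[THEN iffD1, rotated]) (rule t)
  have "(\<Sum>\<^sub>\<infinity>(d, m)\<in>{1..}\<times>{1..}. c d * e m) = (\<Sum>\<^sub>\<infinity>p\<in>Sigma {1..} D. case (case p of (n, d) \<Rightarrow> (d, n div d)) of (d, m) \<Rightarrow> c d * e m)"
    by (rule infsum_reindex_bij_betw[OF bij, symmetric])
  also have "\<dots> = (\<Sum>\<^sub>\<infinity>(n, d)\<in>Sigma {1..} D. mu_real d * real n powr (- s))"
    by (rule infsum_cong) (rule t)
  also have "\<dots> = (\<Sum>\<^sub>\<infinity>n\<in>{1..}. \<Sum>\<^sub>\<infinity>d\<in>D n. mu_real d * real n powr (- s))"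
    by (rule infsum_Sigma'_banach[symmetric]) (rule sm)
  also have "\<dots> = (\<Sum>\<^sub>\<infinity>n\<in>{1::nat..}. if n = 1 then 1 else 0)"
  proof (rule infsum_cong)
    fix n :: nat assume "n \<in> {1..}"
    hence n: "n > 0" by simp
    hence "(\<Sum>\<^sub>\<infinity>d\<in>D n. mu_real d * real n powr (- s)) = (\<Sum>d\<in>D n. mu_real d) * real n powr (- s)"
      by (subst infsum_finite) (auto simp: D_def sum_distrib_right)
    also have "(\<Sum>d\<in>D n. mu_real d) = (if n = 1 then 1 else 0)"
      using sum_moebius_mu_divisors[OF n] unfolding D_def by (simp flip: of_int_sum)
    finally show "(\<Sum>\<^sub>\<infinity>d\<in>D n. mu_real d * real n powr (- s)) = (if n = 1 then 1 else 0)" by simp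
  qed
  also have "\<dots> = (\<Sum>\<^sub>\<infinity>n\<in>{1::nat}. 1 :: real)"
    by (rule infsum_cong_neutral) auto
  also have "\<dots> = 1" by simp
  finally show ?thesis using prod by (simp add: c_def e_def)
qed

lemma zeta_mult_dirichlet_series_mu:
  assumes "Re s > 1"
  shows "zeta s * dirichlet_series mu_real s = 1"
proof (rule holomorphic_eq_from_real_interval[where a = 1 and b = 2 and S = "{s. Re s > 1}"
      and f = "\<lambda>s. zeta s * dirichlet_series mu_real s" and g = "\<lambda>_. 1" and w = s])
  have "zeta holomorphic_on {s. Re s > 1}"
    by (rule holomorphic_on_subset[OF zeta_holomorphic]) auto
  thus "(\<lambda>s. zeta s * dirichlet_series mu_real s) holomorphic_on {s. Re s > 1}"
    by (intro holomorphic_on_mult dirichlet_series_holomorphic abs_mu_real_le)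
  fix x :: real assume x: "1 < x" "x < 2"
  show "zeta (of_real x) * dirichlet_series mu_real (of_real x) = 1"
  proof -
    have "zeta (of_real x) * dirichlet_series mu_real (of_real x) =
       of_real ((\<Sum>n. mu_real (Suc n) * real (Suc n) powr (- x)) * (\<Sum>n. real (Suc n) powr (- x)))"
      using x dirichlet_series_of_real(1)[of "\<lambda>_. 1" x] dirichlet_series_of_real(1)[of mu_real x, OF abs_mu_real_le]
      by (simp add: zeta_eq_dirichlet_series mult.commute)
    thus ?thesis unfolding dirichlet_series_mu_inverse_real[OF x(1)] by simp
  qed
qed (use assms in \<open>auto simp: open_halfspace_Re_gt connected_halfplane\<close>)

text \<open>Taken in the variable u = ln x, where Mellin transforms become Laplace transforms. A
  term with n = exp u counts in full, which differs from a half-weighted last term only on a null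
  set.\<close>

definition summatory :: "(nat \<Rightarrow> real) \<Rightarrow> real \<Rightarrow> real" where
  "summatory a u = (\<Sum>n | 1 \<le> n \<and> real n \<le> exp u. a n)"

lemma summatory_set: "{n. 1 \<le> n \<and> real n \<le> exp u} = {1..nat \<lfloor>exp u\<rfloor>}"
  by (auto simp: le_nat_floor le_nat_iff le_floor_iff)

lemma summatory_measurable [measurable]: "summatory a \<in> borel_measurable borel"
proof -
  have "(\<lambda>u. (\<lambda>k. sum a {1..k}) (nat \<lfloor>exp u :: real\<rfloor>)) \<in> borel_measurable borel"
    by (rule measurable_compose[of _ _ "count_space UNIV"]) auto
  thus ?thesis unfolding summatory_def summatory_set .
qed

lemma abs_summatory_le:
  assumes a: "\<And>n. \<bar>a n\<bar> \<le> 1"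
  shows "\<bar>summatory a u\<bar> \<le> exp u"
proof -
  have "\<bar>summatory a u\<bar> \<le> (\<Sum>n\<in>{1..nat \<lfloor>exp u\<rfloor>}. \<bar>a n\<bar>)"
    unfolding summatory_def summatory_set by (rule sum_abs)
  also have "\<dots> \<le> (\<Sum>n\<in>{1..nat \<lfloor>exp u\<rfloor>}. 1)" by (intro sum_mono a)
  also have "\<dots> \<le> exp u" by simp
  finally show ?thesis .
qed

lemma laplace_half_conv_bound:
  assumes [measurable]: "f \<in> borel_measurable borel"
    and f: "\<And>u. u \<ge> 0 \<Longrightarrow> \<bar>f u\<bar> \<le> C * exp (c * u)" and a: "a > c"
  shows "laplace_half_conv f a"
  unfolding laplace_conv_def
proof (rule Bochner_Integration.integrable_bound)
  show "integrable halfline (\<lambda>u. C * exp (- ((a - c) * u)))"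
    using has_bochner_integral_exp_halfline[of "a - c"] a by (auto simp: has_bochner_integral_iff)
  show "AE u in halfline. norm (f u * exp (- (a * u))) \<le> norm (C * exp (- ((a - c) * u)))"
  proof (rule AE_I2)
    fix u :: real assume "u \<in> space halfline"
    hence "\<bar>f u\<bar> * exp (- (a * u)) \<le> C * exp (c * u) * exp (- (a * u))"
      by (intro mult_right_mono f) auto
    also have "C * exp (c * u) * exp (- (a * u)) = C * exp (- ((a - c) * u))"
      by (simp add: exp_add[symmetric] algebra_simps)
    also have "\<dots> \<le> \<bar>C * exp (- ((a - c) * u))\<bar>" by (rule abs_ge_self)
    finally show "norm (f u * exp (- (a * u))) \<le> norm (C * exp (- ((a - c) * u)))"
      by (simp add: abs_mult)
  qed
qed measurable

lemma summatory_conv: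
  assumes a: "\<And>n. \<bar>a n\<bar> \<le> 1" and s: "s > 1"
  shows "laplace_half_conv (summatory a) s"
  using abs_summatory_le[OF a] s by (intro laplace_half_conv_bound[where C = 1 and c = 1]) auto

lemma laplace_half_holomorphic:
  assumes [measurable]: "f \<in> borel_measurable borel" and "\<And>a. a > c \<Longrightarrow> laplace_half_conv f a"
  shows "laplace_half f holomorphic_on {s. Re s > c}"
proof -
  have "laplace_half f field_differentiable (at s)" if "Re s > c" for s
  proof -
    define a where "a = (c + Re s) / 2"
    have "laplace_half f holomorphic_on {s. Re s > a}"
      using assms that by (intro laplace_holomorphic) (auto simp: a_def)
    moreover have "open {s. Re s > a}" by (rule open_halfspace_Re_gt)
    moreover have "s \<in> {s. Re s > a}" using that by (simp add: a_def)
    ultimately show ?thesis by (rule holomorphic_on_imp_differentiable_at)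
  qed
  thus ?thesis by (auto simp: holomorphic_on_def intro: field_differentiable_at_within)
qed

lemma has_bochner_integral_exp_tail:
  assumes s: "s > 0" and c: "c \<ge> 0"
  shows "has_bochner_integral halfline (\<lambda>u. indicator {c..} u * exp (- (s * u))) (exp (- (s * c)) / s)"
proof (rule has_bochner_integral_nn_integral)
  have "((\<lambda>x. - (exp (- (s * x)) / s)) \<longlongrightarrow> - (0 / s)) at_top"
    using s by real_asymp
  hence "(\<integral>\<^sup>+u\<in>{c..}. ennreal (exp (- (s * u)))\<partial>lborel) = ennreal (- (0 / s) - - (exp (- (s * c)) / s))"
    using s by (intro nn_integral_FTC_atLeast) (auto intro!: derivative_eq_intros)
  moreover have "(\<integral>\<^sup>+u. ennreal (indicator {c..} u * exp (- (s * u))) \<partial>halfline) = (\<integral>\<^sup>+u\<in>{c..}. ennreal (exp (- (s * u)))\<partial>lborel)"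
    using c by (subst nn_integral_restrict_space) (auto simp: indicator_def intro!: nn_integral_cong)
  ultimately show "(\<integral>\<^sup>+u. ennreal (indicator {c..} u * exp (- (s * u))) \<partial>halfline) = ennreal (exp (- (s * c)) / s)"
    by simp
qed (use s in auto)

text \<open>Partial summation as an interchange of sum and integral: each n contributes a_n times
  the integral of exp(-s u) over u \<ge> ln n, that is a_n n^(-s) / s. This is carried out for real
  s > 1, where the series converges absolutely, and then continued.\<close>

lemma dirichlet_series_eq_laplace_summatory:
  assumes a: "\<And>n. \<bar>a n\<bar> \<le> 1" and s: "Re s > 1"
  shows "dirichlet_series a s = s * laplace_half (summatory a) s"
proof (rule holomorphic_eq_from_real_interval[where a = 1 and b = 2 and S = "{s. Re s > 1}"
      and f = "dirichlet_series a" and g = "\<lambda>s. s * laplace_half (summatory a) s" and w = s])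
  show "(\<lambda>s. s * laplace_half (summatory a) s) holomorphic_on {s. Re s > 1}"
    by (intro holomorphic_intros laplace_half_holomorphic summatory_conv a) auto
  show "dirichlet_series a holomorphic_on {s. Re s > 1}" by (rule dirichlet_series_holomorphic[OF a])
  fix x :: real assume x: "1 < x" "x < 2"
  define f where "f n u = a (Suc n) * (indicator {ln (real (Suc n))..} u * exp (- (x * u)))" for n u
  have f: "has_bochner_integral halfline (f n) (a (Suc n) * (real (Suc n) powr (- x) / x))" for n
    using has_bochner_integral_mult_right[OF has_bochner_integral_exp_tail[of x "ln (real (Suc n))"], of "a (Suc n)"] x
    by (simp add: f_def[abs_def] powr_def del: of_nat_Suc)
  have zero: "f n u = 0" if "n \<notin> {n. real (Suc n) \<le> exp u}" for n u
  proof -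
    have "exp u < real (Suc n)" using that by (simp add: not_le del: of_nat_Suc)
    hence "ln (exp u) < ln (real (Suc n))" by (subst ln_less_cancel_iff) auto
    thus ?thesis by (simp add: f_def)
  qed
  have finset: "finite {n. real (Suc n) \<le> exp u}" for u
  proof (rule finite_subset)
    show "{n. real (Suc n) \<le> exp u} \<subseteq> {..nat \<lfloor>exp u\<rfloor>}" by (auto simp: le_nat_floor)
  qed simp
  have fs: "(\<Sum>n. f n u) = summatory a u * exp (- (x * u))" for u
  proof -
    have "(\<Sum>n. f n u) = (\<Sum>n | real (Suc n) \<le> exp u. f n u)"
      by (rule suminf_finite[OF finset]) (use zero in auto)
    also have "\<dots> = (\<Sum>n | real (Suc n) \<le> exp u. a (Suc n) * exp (- (x * u)))"
    proof (rule sum.cong)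
      fix n assume "n \<in> {n. real (Suc n) \<le> exp u}"
      hence "real (Suc n) \<le> exp u" by blast
      hence "ln (real (Suc n)) \<le> ln (exp u)" by (subst ln_le_cancel_iff) auto
      thus "f n u = a (Suc n) * exp (- (x * u))" by (simp add: f_def)
    qed simp
    also have "\<dots> = (\<Sum>n | 1 \<le> n \<and> real n \<le> exp u. a n * exp (- (x * u)))"
      by (rule sum.reindex_bij_witness[of _ "\<lambda>n. n - 1" Suc]) auto
    finally show ?thesis by (simp add: summatory_def sum_distrib_right)
  qed
  have sm: "summable (\<lambda>n. \<bar>a (Suc n) * real (Suc n) powr (- x)\<bar>)"
    by (rule dirichlet_series_of_real(2)[OF a x(1)])
  have "(\<lambda>n. integral\<^sup>L halfline (f n)) sums (\<integral>u. (\<Sum>n. f n u) \<partial>halfline)"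
  proof (rule sums_integral)
    show "integrable halfline (f n)" for n using f by (simp add: has_bochner_integral_iff)
    show "AE u in halfline. summable (\<lambda>n. norm (f n u))"
      by (intro AE_I2 summable_finite[OF finset]) (use zero in auto)
    have "(\<integral>u. norm (f n u) \<partial>halfline) = \<bar>a (Suc n) * real (Suc n) powr (- x)\<bar> / x" for n
    proof -
      have "has_bochner_integral halfline (\<lambda>u. \<bar>a (Suc n)\<bar> * (indicator {ln (real (Suc n))..} u * exp (- (x * u))))
          (\<bar>a (Suc n)\<bar> * (exp (- (x * ln (real (Suc n)))) / x))"
        using x by (intro has_bochner_integral_mult_right has_bochner_integral_exp_tail) auto
      from has_bochner_integral_integral_eq[OF this] show ?thesis
        by (simp add: f_def abs_mult powr_def)
    qed
    thus "summable (\<lambda>n. \<integral>u. norm (f n u) \<partial>halfline)" using summable_divide[OF sm, of x] by simp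
  qed
  moreover have "integral\<^sup>L halfline (f n) = a (Suc n) * real (Suc n) powr (- x) / x" for n
    using has_bochner_integral_integral_eq[OF f] by simp
  ultimately have "(\<lambda>n. a (Suc n) * real (Suc n) powr (- x) / x) sums (\<integral>u. summatory a u * exp (- (x * u)) \<partial>halfline)"
    by (simp add: fs)
  hence "(\<lambda>n. x * (a (Suc n) * real (Suc n) powr (- x) / x)) sums (x * (\<integral>u. summatory a u * exp (- (x * u)) \<partial>halfline))"
    by (rule sums_mult)
  hence "(\<Sum>n. a (Suc n) * real (Suc n) powr (- x)) = x * (\<integral>u. summatory a u * exp (- (x * u)) \<partial>halfline)"
    using x by (simp add: sums_iff)
  thus "dirichlet_series a (of_real x) = of_real x * laplace_half (summatory a) (of_real x)"
    using x by (simp add: dirichlet_series_of_real(1)[OF a] laplace_of_real)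
qed (use s in \<open>auto simp: open_halfspace_Re_gt connected_halfplane\<close>)

lemma laplace_half_exp:
  assumes "Re s > c"
  shows "laplace_half (\<lambda>u. exp (c * u)) s = 1 / (s - of_real c)"
proof (rule holomorphic_eq_from_real_interval[where a = c and b = "c + 1" and S = "{s. Re s > c}"
      and f = "laplace_half (\<lambda>u. exp (c * u))" and g = "\<lambda>s. 1 / (s - of_real c)" and w = s])
  show "laplace_half (\<lambda>u. exp (c * u)) holomorphic_on {s. Re s > c}"
    by (intro laplace_half_holomorphic laplace_half_conv_bound[where C = 1 and c = c]) auto
  show "(\<lambda>s. 1 / (s - of_real c)) holomorphic_on {s. Re s > c}"
    by (intro holomorphic_intros) auto
  fix x :: real assume x: "c < x"
  have "exp (c * u) * exp (- (x * u)) = exp (- ((x - c) * u))" for u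
    by (simp add: exp_add[symmetric] algebra_simps)
  thus "laplace_half (\<lambda>u. exp (c * u)) (of_real x) = 1 / (of_real x - of_real c)"
    using has_bochner_integral_integral_eq[OF has_bochner_integral_exp_halfline[of "x - c"]] x
    by (simp add: laplace_of_real)
qed (use assms in \<open>auto simp: open_halfspace_Re_gt connected_halfplane\<close>)

text \<open>This is \<open>(s - 1) \<zeta>(s)\<close> without the junk value of \<open>zeta\<close> at 1.\<close>

definition zeta_regular :: "complex \<Rightarrow> complex" where
  "zeta_regular s = s - s * (s - 1) * laplace_half (\<lambda>u. frac (exp u)) s"

lemma frac_exp_measurable [measurable]: "(\<lambda>u::real. frac (exp u)) \<in> borel_measurable borel"
  unfolding frac_def by measurable

lemma frac_exp_conv: "a > 0 \<Longrightarrow> laplace_half_conv (\<lambda>u. frac (exp u)) a"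
  by (rule laplace_half_conv_bound[where C = 1 and c = 0])
     (auto simp: frac_ge_0 frac_lt_1 less_imp_le)

lemma zeta_regular_holomorphic: "zeta_regular holomorphic_on {s. Re s > 0}"
  unfolding zeta_regular_def[abs_def]
  by (intro holomorphic_intros laplace_half_holomorphic frac_exp_conv frac_exp_measurable)

lemma summatory_one: "summatory (\<lambda>_. 1) u = exp u - frac (exp u)"
  unfolding summatory_def summatory_set frac_def by simp

text \<open>The summatory function of 1 is exp u - frac(exp u), so for real s > 1 zeta s = s/(s - 1)
  - s I with I the transform of the bounded fractional part; multiplication by s - 1 gives the
  formula. The half-plane Re s > 0 without the point 1 is still connected, so the identity spreads
  over it.\<close>

lemma zeta_regular_eq:
  assumes s: "Re s > 0" "s \<noteq> 1"
  shows "zeta_regular s = (s - 1) * zeta s"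
proof (rule holomorphic_eq_from_real_interval[where a = 1 and b = 2 and S = "{s. Re s > 0} - {1}"
      and f = "zeta_regular" and g = "\<lambda>s. (s - 1) * zeta s" and w = s])
  show "zeta_regular holomorphic_on {s. Re s > 0} - {1}"
    by (rule holomorphic_on_subset[OF zeta_regular_holomorphic]) auto
  have "zeta holomorphic_on {s. Re s > 0} - {1}"
    by (rule holomorphic_on_subset[OF zeta_holomorphic]) auto
  thus "(\<lambda>s. (s - 1) * zeta s) holomorphic_on {s. Re s > 0} - {1}"
    by (intro holomorphic_intros)
  show "open ({s. Re s > 0} - {1})" by (intro open_Diff open_halfspace_Re_gt) auto
  show "connected ({s. Re s > 0} - {1})"
    by (intro connected_open_delete connected_halfplane open_halfspace_Re_gt) simp
  fix x :: real assume x: "1 < x" "x < 2"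
  have i1: "integrable halfline (\<lambda>u. exp u * exp (- (x * u)))"
    using laplace_half_conv_bound[of "\<lambda>u. exp u" 1 1 x] x by (simp add: laplace_conv_def)
  have i2: "integrable halfline (\<lambda>u. frac (exp u) * exp (- (x * u)))"
    using frac_exp_conv[of x] x by (simp add: laplace_conv_def)
  have "(\<integral>u. exp u * exp (- (x * u)) \<partial>halfline) = 1 / (x - 1)"
  proof -
    have "complex_of_real (\<integral>u. exp u * exp (- (x * u)) \<partial>halfline) = of_real (1 / (x - 1))"
      using laplace_half_exp[of 1 "of_real x"] x by (simp add: laplace_of_real)
    thus ?thesis by (simp only: of_real_eq_iff)
  qed
  hence "(\<integral>u. summatory (\<lambda>_. 1) u * exp (- (x * u)) \<partial>halfline) = 1 / (x - 1) - (\<integral>u. frac (exp u) * exp (- (x * u)) \<partial>halfline)"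
    unfolding summatory_one left_diff_distrib using i1 i2 by simp
  hence "zeta (of_real x) = of_real (x * (1 / (x - 1) - (\<integral>u. frac (exp u) * exp (- (x * u)) \<partial>halfline)))"
    using x by (simp add: zeta_eq_dirichlet_series dirichlet_series_eq_laplace_summatory laplace_of_real)
  moreover have "zeta_regular (of_real x) = of_real (x - x * (x - 1) * (\<integral>u. frac (exp u) * exp (- (x * u)) \<partial>halfline))"
    by (simp add: zeta_regular_def laplace_of_real)
  moreover have "x - x * (x - 1) * I = (x - 1) * (x * (1 / (x - 1) - I))" for I
  proof -
    have "(x - 1) * (x * (1 / (x - 1) - I)) = x * ((x - 1) * (1 / (x - 1))) - x * (x - 1) * I"
      by (simp only: algebra_simps)
    thus ?thesis using x by simp
  qed
  ultimately show "zeta_regular (of_real x) = (of_real x - 1) * zeta (of_real x)"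
    by (simp only: of_real_mult of_real_diff of_real_1)
qed (use s in auto)

text \<open>The value is x + x (1 - x) I with I \<ge> 0. Thus (s - 1) / \<open>zeta_regular\<close>
  s is regular at every real point of [1/2, 1], both where Landau's theorem is applied and in the
  limit at 1/2.\<close>

lemma zeta_regular_nonzero_real:
  assumes x: "0 < x" "x \<le> 1"
  shows "zeta_regular (of_real x) \<noteq> 0"
proof -
  define I where "I = (\<integral>u. frac (exp u) * exp (- (x * u)) \<partial>halfline)"
  have I: "I \<ge> 0" unfolding I_def by (intro integral_nonneg_AE AE_I2) (auto simp: frac_ge_0)
  have "zeta_regular (of_real x) = of_real (x - x * (x - 1) * I)"
    by (simp add: zeta_regular_def laplace_of_real I_def)
  moreover have "x * (1 - x) * I \<ge> 0" using x I by (intro mult_nonneg_nonneg) auto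
  hence "x - x * (x - 1) * I > 0" using x by (simp add: algebra_simps)
  ultimately show ?thesis by (metis less_irrefl of_real_eq_0_iff)
qed

abbreviation mertens :: "real \<Rightarrow> real" where
  "mertens \<equiv> summatory mu_real"

text \<open>The relation 1 = zeta s times s F(s), with F the transform of the Mertens function,
  continues to any half-plane where F converges. Since s - 1 vanishes only at 1, convergence to the
  right of c excludes zeros of zeta there.\<close>

lemma zeta_regular_mertens:
  assumes conv: "\<And>a. a > c \<Longrightarrow> laplace_half_conv mertens a" and c: "c \<ge> 0" and s: "Re s > c"
  shows "s * laplace_half mertens s * zeta_regular s = s - 1"
proof (rule holomorphic_eq_from_real_interval[where a = "max c 1" and b = "max c 1 + 1" and S = "{s. Re s > c}"
      and f = "\<lambda>s. s * laplace_half mertens s * zeta_regular s" and g = "\<lambda>s. s - 1" and w = s])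
  have "zeta_regular holomorphic_on {s. Re s > c}"
    by (rule holomorphic_on_subset[OF zeta_regular_holomorphic]) (use c in auto)
  thus "(\<lambda>s. s * laplace_half mertens s * zeta_regular s) holomorphic_on {s. Re s > c}"
    by (intro holomorphic_intros laplace_half_holomorphic conv) auto
  fix x :: real assume x: "max c 1 < x"
  have "zeta_regular (of_real x) = (of_real x - 1) * zeta (of_real x)"
    using x by (intro zeta_regular_eq) auto
  moreover have "zeta (of_real x) * (of_real x * laplace_half mertens (of_real x)) = 1"
    using zeta_mult_dirichlet_series_mu[of "of_real x"] dirichlet_series_eq_laplace_summatory[of mu_real "of_real x", OF abs_mu_real_le] x
    by simp
  ultimately show "of_real x * laplace_half mertens (of_real x) * zeta_regular (of_real x) = of_real x - 1"
  proof -
    have "of_real x * L * ((of_real x - 1) * Z) = (of_real x - 1) * (Z * (of_real x * L))" for Z L :: complex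
      by (simp only: mult_ac)
    thus "zeta_regular (of_real x) = (of_real x - 1) * zeta (of_real x) \<Longrightarrow>
        zeta (of_real x) * (of_real x * laplace_half mertens (of_real x)) = 1 \<Longrightarrow>
        of_real x * laplace_half mertens (of_real x) * zeta_regular (of_real x) = of_real x - 1"
      by (simp only: mult_1_right)
  qed
next
  show "(\<lambda>s. s - 1) holomorphic_on {s. Re s > c}" by (intro holomorphic_intros)
qed (use s in \<open>auto simp: open_halfspace_Re_gt connected_halfplane\<close>)

subsection \<open>Growth of the reciprocal zeta function\<close>

text \<open>The map g / (2 B - g) takes the half-plane Re g < B into the unit disc and 0 to 0.
  Schwarz's lemma bounds it by |w|, and solving for g gives the estimate.\<close>

lemma borel_caratheodory:
  assumes f: "f holomorphic_on ball c R" and A: "\<And>z. z \<in> ball c R \<Longrightarrow> Re (f z) < A"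
    and z: "z \<in> ball c R"
  shows "norm (f z - f c) \<le> 2 * (A - Re (f c)) * norm (z - c) / (R - norm (z - c))"
proof -
  have R: "R > 0" using z by (metis ball_empty empty_iff not_le)
  define B where "B = A - Re (f c)"
  have B: "B > 0" unfolding B_def using A[of c] R by simp
  define g where "g w = f (c + of_real R * w) - f c" for w
  define \<phi> where "\<phi> w = g w / (of_real (2 * B) - g w)" for w
  have in_ball: "c + of_real R * w \<in> ball c R" if "norm w < 1" for w :: complex
    using that R by (simp add: dist_norm norm_mult)
  have g: "Re (g w) < B" if "norm w < 1" for w
    using A[OF in_ball[OF that]] by (simp add: g_def B_def)
  have nz: "of_real (2 * B) - g w \<noteq> 0" if "norm w < 1" for w
  proof
    assume "of_real (2 * B) - g w = 0"
    hence "Re (g w) = 2 * B" by (metis Re_complex_of_real eq_iff_diff_eq_0)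
    thus False using g[OF that] B by simp
  qed
  have \<phi>1: "norm (\<phi> w) < 1" if "norm w < 1" for w
  proof -
    have "(norm (of_real (2 * B) - g w))\<^sup>2 - (norm (g w))\<^sup>2 = 4 * B * (B - Re (g w))"
      unfolding cmod_power2 by (simp add: power2_eq_square algebra_simps)
    also have "\<dots> > 0" using B g[OF that] by simp
    finally have "(norm (g w))\<^sup>2 < (norm (of_real (2 * B) - g w))\<^sup>2" by simp
    hence "norm (g w) < norm (of_real (2 * B) - g w)" by (rule power_less_imp_less_base) simp
    thus ?thesis using nz[OF that] by (simp add: \<phi>_def norm_divide)
  qed
  have hol: "\<phi> holomorphic_on ball 0 1"
  proof -
    have "(\<lambda>w. f (c + of_real R * w)) holomorphic_on ball 0 1"
      using holomorphic_on_compose_gen[of "\<lambda>w. c + of_real R * w" "ball 0 1" f "ball c R"] f in_ball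
      by (force simp: o_def intro!: holomorphic_intros)
    hence "g holomorphic_on ball 0 1" unfolding g_def[abs_def] by (intro holomorphic_intros)
    thus ?thesis unfolding \<phi>_def[abs_def] using nz by (intro holomorphic_intros) auto
  qed
  define w where "w = (z - c) / of_real R"
  have w: "norm w = norm (z - c) / R" using R by (simp add: w_def norm_divide)
  have w1: "norm w < 1" using z R by (simp add: w dist_norm norm_minus_commute)
  have "norm (\<phi> w) \<le> norm w"
    by (rule Schwarz_Lemma(1)[OF hol _ \<phi>1 w1]) (simp_all add: \<phi>_def g_def)
  moreover have "norm (g w) \<le> norm (\<phi> w) * (2 * B + norm (g w))"
  proof -
    have "norm (g w) = norm (\<phi> w) * norm (of_real (2 * B) - g w)"
      using nz[OF w1] by (simp add: \<phi>_def norm_divide)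
    also have "norm (of_real (2 * B) - g w) \<le> norm (complex_of_real (2 * B)) + norm (g w)"
      by (rule norm_triangle_ineq4)
    also have "norm (complex_of_real (2 * B)) = 2 * B" using B by (simp only: norm_of_real)
    finally show ?thesis by (simp add: mult_left_mono)
  qed
  ultimately have "norm (g w) \<le> norm w * (2 * B + norm (g w))"
    using B by (meson add_nonneg_nonneg less_imp_le mult_right_mono norm_ge_zero order_trans zero_le_mult_iff zero_le_numeral)
  hence "norm (g w) * (1 - norm w) \<le> 2 * B * norm w" by (simp add: algebra_simps)
  hence "norm (g w) \<le> 2 * B * norm w / (1 - norm w)" using w1 by (simp add: pos_le_divide_eq)
  also have "2 * B * norm w / (1 - norm w) = 2 * B * norm (z - c) / (R - norm (z - c))"
    using R z by (simp add: w field_simps dist_norm norm_minus_commute)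
  also have "g w = f z - f c" using R by (simp add: g_def w_def)
  finally show ?thesis by (simp add: B_def)
qed

lemma holomorphic_coeff_bound:
  assumes f: "f holomorphic_on ball c R" and r: "0 < r" "r < R"
    and B: "\<And>z. norm (z - c) = r \<Longrightarrow> norm (f z - f c) \<le> B"
  shows "norm ((deriv ^^ n) (\<lambda>z. f z - f c) c / fact n) \<le> B / r ^ n"
proof -
  have sub: "cball c r \<subseteq> ball c R" using r by auto
  have "norm ((deriv ^^ n) (\<lambda>z. f z - f c) c) \<le> fact n * B / r ^ n"
  proof (rule Cauchy_inequality)
    show "(\<lambda>z. f z - f c) holomorphic_on ball c r"
      using r by (intro holomorphic_intros holomorphic_on_subset[OF f]) auto
    show "continuous_on (cball c r) (\<lambda>z. f z - f c)"
      by (intro continuous_intros continuous_on_subset[OF holomorphic_on_imp_continuous_on[OF f] sub])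
    show "norm (f x - f c) \<le> B" if "norm (c - x) = r" for x
      using that by (intro B) (simp add: norm_minus_commute)
  qed (use r in simp)
  thus ?thesis by (simp add: norm_divide field_simps)
qed

text \<open>
  The Taylor coefficients at the centre are bounded independently of \<open>A\<close> by the inner disc, and
  linearly in \<open>A\<close> by the outer disc, where the geometric factor makes a late tail small.
\<close>

lemma real_part_growth:
  fixes \<rho> r R K \<epsilon> :: real
  assumes \<rho>: "0 < \<rho>" "\<rho> \<le> R" and r: "0 < r" "r < R" and K: "K > 0" and \<epsilon>: "\<epsilon> > 0"
  shows "\<exists>C. \<forall>f c A z. f holomorphic_on ball c R \<longrightarrow> A \<ge> 0 \<longrightarrow> (\<forall>z\<in>ball c R. Re (f z) < A) \<longrightarrow>
    (\<forall>z\<in>ball c \<rho>. Re (f z) < K) \<longrightarrow> Re (f c) > - K \<longrightarrow> norm (z - c) \<le> r \<longrightarrow> Re (f z) \<le> C + \<epsilon> * A"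
proof -
  define R1 where "R1 = (r + R) / 2"
  have R1: "r < R1" "R1 < R" "0 < R1" using r by (auto simp: R1_def)
  define q where "q = r / R1"
  have q: "0 < q" "q < 1" using r R1 by (auto simp: q_def)
  define \<alpha> where "\<alpha> = 2 * R1 / (R - R1)"
  have \<alpha>: "\<alpha> > 0" using R1 by (simp add: \<alpha>_def)
  have "(\<lambda>n. \<alpha> * q ^ n / (1 - q)) \<longlonglongrightarrow> \<alpha> * 0 / (1 - q)"
    using q by (intro tendsto_intros LIMSEQ_power_zero) auto
  hence "\<forall>\<^sub>F n in sequentially. \<alpha> * q ^ n / (1 - q) < \<epsilon>"
    using \<epsilon> by (intro order_tendstoD(2)[where y = "\<alpha> * 0 / (1 - q)"]) auto
  then obtain N where N: "\<alpha> * q ^ N / (1 - q) < \<epsilon>" by (auto simp: eventually_sequentially)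
  \<comment> \<open>Bounds the head of the Taylor series through the inner disc, where Cauchy's
    estimate on radius \<rho>/2 gives 4 K / (\<rho>/2)^n. Neither \<open>N\<close> nor
    \<open>S\<close> depends on f, c or A, so one constant serves the discs at every height. In the
    constant below, K bounds Re (f c), and \<epsilon> K + \<epsilon> A bounds the tail.\<close>
  define S where "S = (\<Sum>n<N. 4 * K * (2 * r / \<rho>) ^ n)"
  show ?thesis
  proof (intro exI[of _ "K + S + \<epsilon> * K"] allI impI)
    fix f c A z
    assume f: "f holomorphic_on ball c R" and A0: "A \<ge> 0" and A: "\<forall>z\<in>ball c R. Re (f z) < A"
      and fK: "\<forall>z\<in>ball c \<rho>. Re (f z) < K" and fc: "Re (f c) > - K" and z: "norm (z - c) \<le> r"
    define a where "a n = (deriv ^^ n) (\<lambda>z. f z - f c) c / fact n" for n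
    have a1: "norm (a n) \<le> \<alpha> * (A + K) / R1 ^ n" for n
      unfolding a_def
    proof (rule holomorphic_coeff_bound[OF f])
      fix w assume w: "norm (w - c) = R1"
      have "norm (f w - f c) \<le> 2 * (A - Re (f c)) * norm (w - c) / (R - norm (w - c))"
        using w R1 A by (intro borel_caratheodory[OF f]) (auto simp: dist_norm norm_minus_commute)
      also have "\<dots> = \<alpha> * (A - Re (f c))" by (simp add: w \<alpha>_def)
      also have "\<dots> \<le> \<alpha> * (A + K)" using \<alpha> fc by (intro mult_left_mono) auto
      finally show "norm (f w - f c) \<le> \<alpha> * (A + K)" .
    qed (use R1 in auto)
    have a2: "norm (a n) \<le> 4 * K / (\<rho> / 2) ^ n" for n
      unfolding a_def
    proof (rule holomorphic_coeff_bound[where R = \<rho>])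
      show f\<rho>: "f holomorphic_on ball c \<rho>" using \<rho> by (intro holomorphic_on_subset[OF f]) auto
      fix w assume w: "norm (w - c) = \<rho> / 2"
      have "norm (f w - f c) \<le> 2 * (K - Re (f c)) * norm (w - c) / (\<rho> - norm (w - c))"
        using w \<rho> fK by (intro borel_caratheodory[OF f\<rho>]) (auto simp: dist_norm norm_minus_commute)
      also have "\<dots> = 2 * (K - Re (f c))" using \<rho> by (simp add: w)
      also have "\<dots> \<le> 4 * K" using fc by simp
      finally show "norm (f w - f c) \<le> 4 * K" .
    qed (use \<rho> in auto)
    have "(\<lambda>n. a n * (z - c) ^ n) sums (f z - f c)"
      unfolding a_def using z r
      by (intro holomorphic_power_series[where r = R] holomorphic_intros f) (auto simp: dist_norm norm_minus_commute)
    hence eq: "f z - f c = (\<Sum>n. a n * (z - c) ^ n)" by (simp add: sums_iff)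
    define b where "b n = (if n \<in> {..<N} then 4 * K * (2 * r / \<rho>) ^ n else 0) + (if n < N then 0 else \<alpha> * (A + K) * q ^ n)" for n
    have nb: "norm (a n * (z - c) ^ n) \<le> b n" for n
    proof -
      have "norm (a n * (z - c) ^ n) \<le> norm (a n) * r ^ n"
        unfolding norm_mult norm_power using z by (intro mult_left_mono power_mono) auto
      also have "\<dots> \<le> b n"
      proof (cases "n < N")
        case True
        have "norm (a n) * r ^ n \<le> 4 * K / (\<rho> / 2) ^ n * r ^ n" using a2 r by (intro mult_right_mono) auto
        also have "\<dots> = b n" using True \<rho> by (simp add: b_def power_divide power_mult_distrib)
        finally show ?thesis .
      next
        case False
        have "norm (a n) * r ^ n \<le> \<alpha> * (A + K) / R1 ^ n * r ^ n" using a1 r by (intro mult_right_mono) auto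
        also have "\<dots> = b n" using False by (simp add: b_def q_def power_divide)
        finally show ?thesis .
      qed
      finally show ?thesis .
    qed
    have bs: "b sums (S + \<alpha> * (A + K) * q ^ N / (1 - q))"
      unfolding b_def
    proof (rule sums_add)
      show "(\<lambda>n. if n \<in> {..<N} then 4 * K * (2 * r / \<rho>) ^ n else 0) sums S"
        unfolding S_def by (rule sums_If_finite_set) simp
      define h where "h n = (if n < N then 0 else \<alpha> * (A + K) * q ^ n)" for n
      have "(\<lambda>n. \<alpha> * (A + K) * q ^ N * q ^ n) sums (\<alpha> * (A + K) * q ^ N * (1 / (1 - q)))"
        using q by (intro sums_mult geometric_sums) auto
      hence "(\<lambda>n. h (n + N)) sums (\<alpha> * (A + K) * q ^ N / (1 - q))"
        by (simp add: h_def power_add mult_ac)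
      hence "h sums (\<alpha> * (A + K) * q ^ N / (1 - q) + (\<Sum>i<N. h i))"
        by (simp only: sums_iff_shift)
      thus "(\<lambda>n. if n < N then 0 else \<alpha> * (A + K) * q ^ n) sums (\<alpha> * (A + K) * q ^ N / (1 - q))"
        by (simp add: h_def[abs_def])
    qed
    have "norm (f z - f c) \<le> suminf b"
      unfolding eq using nb bs by (intro norm_suminf_le) (auto simp: sums_iff)
    also have "\<dots> = S + (A + K) * (\<alpha> * q ^ N / (1 - q))" using bs by (simp add: sums_iff mult_ac)
    also have "\<dots> \<le> S + (A + K) * \<epsilon>" using N A0 K by (intro add_left_mono mult_left_mono) auto
    finally have "norm (f z - f c) \<le> S + (A + K) * \<epsilon>" .
    moreover have "Re (f z) - Re (f c) \<le> norm (f z - f c)"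
      using complex_Re_le_cmod[of "f z - f c"] by simp
    moreover have "Re (f c) < K" using fK \<rho> by simp
    ultimately show "Re (f z) \<le> K + S + \<epsilon> * K + \<epsilon> * A" by (simp add: algebra_simps)
  qed
qed

text \<open>One bound for all coefficient sequences, because it is applied both to 1 and to the
  Moebius function: zeta and its reciprocal are then at most Z in absolute value on Re s \<ge> 3/2,
  which bounds log |zeta| from both sides.\<close>

lemma dirichlet_series_bound:
  "\<exists>Z\<ge>1. \<forall>a. (\<forall>n. \<bar>a n\<bar> \<le> 1) \<longrightarrow> (\<forall>s. Re s \<ge> 3 / 2 \<longrightarrow> norm (dirichlet_series a s) \<le> Z)"
proof -
  define Z where "Z = (\<integral>n. exp (- (3 / 2 * ln (real (Suc n)))) \<partial>count_space UNIV)"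
  have c1: "laplace_conv (count_space UNIV) (\<lambda>n. ln (real (Suc n))) (\<lambda>_. 1) (3 / 2)"
    using dirichlet_series_conv[of "\<lambda>_. 1" "3 / 2"] by simp
  have "norm (dirichlet_series a s) \<le> max 1 Z" if a: "\<And>n. \<bar>a n\<bar> \<le> 1" and s: "Re s \<ge> 3 / 2" for a s
  proof -
    have c: "laplace_conv (count_space UNIV) (\<lambda>n. ln (real (Suc n))) (\<lambda>n. a (Suc n)) (3 / 2)"
      using a by (intro dirichlet_series_conv) auto
    have "norm (dirichlet_series a s) \<le> (\<integral>n. \<bar>a (Suc n)\<bar> * exp (- (3 / 2 * ln (real (Suc n)))) \<partial>count_space UNIV)"
      unfolding dirichlet_series_def using s by (intro norm_laplace_le c) auto
    also have "\<dots> \<le> (\<integral>n. 1 * exp (- (3 / 2 * ln (real (Suc n)))) \<partial>count_space UNIV)"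
    proof (rule integral_mono)
      show "integrable (count_space UNIV) (\<lambda>n. \<bar>a (Suc n)\<bar> * exp (- (3 / 2 * ln (real (Suc n)))))"
        using integrable_norm[OF c[unfolded laplace_conv_def]] by (simp add: abs_mult del: of_nat_Suc)
      show "integrable (count_space UNIV) (\<lambda>n. 1 * exp (- (3 / 2 * ln (real (Suc n)))))"
        using c1 unfolding laplace_conv_def .
    qed (intro mult_right_mono a, simp)
    finally show ?thesis by (simp add: Z_def)
  qed
  thus ?thesis by (intro exI[of _ "max 1 Z"]) auto
qed

text \<open>Littlewood's argument on discs about 2 + i t. On the larger disc D = 1/zeta is
  holomorphic, has no zeros and is at most C' |s|, so a holomorphic logarithm exists with real part
  O(ln |t|). Near the centre that real part is bounded by a constant, and
  \<open>real_part_growth\<close> then reduces ln |t| by the factor \<epsilon> on the disc in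
  between.\<close>

lemma mertens_transform_bound:
  assumes conv: "\<And>a. a > c \<Longrightarrow> laplace_half_conv mertens a" and c: "c \<ge> 1 / 2"
    and s1: "s1 > c" and \<epsilon>: "\<epsilon> > 0"
  shows "\<exists>C. \<forall>s. Re s \<ge> s1 \<longrightarrow> \<bar>Im s\<bar> \<ge> 3 \<longrightarrow> norm (s * laplace_half mertens s) \<le> C * (\<bar>Im s\<bar> + 5) powr \<epsilon>"
proof -
  define D where "D s = s * laplace_half mertens s" for s
  obtain Z where Z1: "Z \<ge> 1" and Z2: "\<forall>a. (\<forall>n. \<bar>a n\<bar> \<le> 1) \<longrightarrow> (\<forall>s. Re s \<ge> 3 / 2 \<longrightarrow> norm (dirichlet_series a s) \<le> Z)"
    using dirichlet_series_bound by blast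
  note Z = Z1 Z2[rule_format]
  have D1: "D s = dirichlet_series mu_real s" if "Re s > 1" for s
    unfolding D_def using dirichlet_series_eq_laplace_summatory[of mu_real s, OF abs_mu_real_le that] by simp
  have DZ: "norm (D s) \<le> Z" if "Re s \<ge> 3 / 2" for s
    using that Z(2)[of mu_real s, OF abs_mu_real_le] by (simp add: D1)
  have DZ': "1 \<le> norm (D s) * Z" if "Re s \<ge> 3 / 2" for s
  proof -
    have "1 = norm (zeta s * D s)" using zeta_mult_dirichlet_series_mu[of s] that by (simp add: D1)
    also have "\<dots> = norm (D s) * norm (zeta s)" by (simp add: norm_mult)
    also have "\<dots> \<le> norm (D s) * Z"
      using Z(2)[of "\<lambda>_. 1" s] that by (intro mult_left_mono) (auto simp: zeta_eq_dirichlet_series)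
    finally show ?thesis .
  qed
  show ?thesis
  proof (cases "s1 \<ge> 3 / 2")
    case True
    show ?thesis
    proof (intro exI[of _ Z] allI impI)
      fix s assume s: "Re s \<ge> s1" "\<bar>Im s\<bar> \<ge> 3"
      have "1 \<le> (\<bar>Im s\<bar> + 5) powr \<epsilon>" using s \<epsilon> by (intro ge_one_powr_ge_zero) auto
      hence "Z * 1 \<le> Z * (\<bar>Im s\<bar> + 5) powr \<epsilon>" using Z(1) by (intro mult_left_mono) auto
      thus "norm (s * laplace_half mertens s) \<le> Z * (\<bar>Im s\<bar> + 5) powr \<epsilon>"
        using DZ[of s] s True by (simp add: D_def)
    qed
  next
    case False
    \<comment> \<open>Room between c and s1: the discs of radii r < R about 2 + i t extend to the
      left as far as the lines Re s = s1 and Re s = s2, and the bound linear in |s| holds from s2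
      on.\<close>
    define s2 where "s2 = (c + s1) / 2"
    have s2: "c < s2" "s2 < s1" using s1 by (auto simp: s2_def)
    define R where "R = 2 - s2"
    define r where "r = 2 - s1"
    have Rr: "0 < r" "r < R" "1 / 2 \<le> R" "R < 3 / 2" using False s2 c by (auto simp: R_def r_def)
    define C' where "C' = max 1 (\<integral>u. \<bar>mertens u\<bar> * exp (- (s2 * u)) \<partial>halfline)"
    have C': "norm (D s) \<le> C' * norm s" if "Re s \<ge> s2" for s
    proof -
      have "norm (laplace_half mertens s) \<le> (\<integral>u. \<bar>mertens u\<bar> * exp (- (s2 * u)) \<partial>halfline)"
        using that by (intro norm_laplace_le conv s2) auto
      hence "norm (laplace_half mertens s) \<le> C'" unfolding C'_def by linarith
      hence "norm (laplace_half mertens s) * norm s \<le> C' * norm s" by (rule mult_right_mono) simp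
      thus ?thesis by (simp add: D_def norm_mult mult.commute)
    qed
    define K where "K = ln Z + 1"
    have K: "K > 0" using Z(1) by (simp add: K_def add_nonneg_pos)
    obtain G where "\<forall>f c A z. f holomorphic_on ball c R \<longrightarrow> A \<ge> 0 \<longrightarrow> (\<forall>z\<in>ball c R. Re (f z) < A) \<longrightarrow>
      (\<forall>z\<in>ball c (1 / 2). Re (f z) < K) \<longrightarrow> Re (f c) > - K \<longrightarrow> norm (z - c) \<le> r \<longrightarrow> Re (f z) \<le> G + \<epsilon> * A"
      using real_part_growth[OF _ Rr(3) Rr(1,2) K \<epsilon>] by auto
    note G = this[rule_format]
    define C where "C = max Z (exp (G + \<epsilon> * (ln C' + 1)))"
    show ?thesis
    proof (intro exI[of _ C] allI impI)
      fix s assume s: "Re s \<ge> s1" "\<bar>Im s\<bar> \<ge> 3"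
      define t where "t = Im s"
      have t1: "1 \<le> (\<bar>t\<bar> + 5) powr \<epsilon>" using \<epsilon> by (intro ge_one_powr_ge_zero) auto
      have "norm (D s) \<le> C * (\<bar>t\<bar> + 5) powr \<epsilon>"
      proof (cases "Re s \<ge> 3 / 2")
        case True
        have "norm (D s) \<le> Z * 1" using DZ[OF True] by simp
        also have "\<dots> \<le> C * (\<bar>t\<bar> + 5) powr \<epsilon>" using Z(1) t1 by (intro mult_mono) (auto simp: C_def)
        finally show ?thesis .
      next
        case False
        define p where "p = Complex 2 t"
        \<comment> \<open>Since R < 3/2, points of the disc have |Re w| < 7/2 and |Im w| < |t| +
          3/2, whence the 5. The condition |t| \<ge> 3 keeps the disc away from s = 1.\<close>
        have reg: "Re w > s2" "w \<noteq> 1" "norm w \<le> \<bar>t\<bar> + 5" if "w \<in> ball p R" for w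
        proof -
          have n: "norm (w - p) < R" using that by (simp add: dist_norm norm_minus_commute)
          have "\<bar>Re w - 2\<bar> < R" using abs_Re_le_cmod[of "w - p"] n by (simp add: p_def)
          thus "Re w > s2" by (simp add: R_def abs_less_iff)
          have im: "\<bar>Im w - t\<bar> < R" using abs_Im_le_cmod[of "w - p"] n by (simp add: p_def)
          thus "w \<noteq> 1" using s(2) Rr by (auto simp: t_def)
          have "norm w \<le> \<bar>Re w\<bar> + \<bar>Im w\<bar>" by (rule cmod_le)
          thus "norm w \<le> \<bar>t\<bar> + 5" using \<open>\<bar>Re w - 2\<bar> < R\<close> im Rr by linarith
        qed
        have holD: "D holomorphic_on ball p R"
          unfolding D_def
          by (intro holomorphic_intros holomorphic_on_subset[OF laplace_half_holomorphic[of mertens s2]] conv)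
            (use reg s2 in auto)
        have nzD: "D w \<noteq> 0" if "w \<in> ball p R" for w
        proof -
          have "Re w > c" using reg(1)[OF that] s2 by simp
          hence "D w * zeta_regular w = w - 1"
            using zeta_regular_mertens[OF conv, of c w] c by (simp add: D_def)
          thus ?thesis using reg(2)[OF that] by auto
        qed
        obtain f where f: "f holomorphic_on ball p R" "\<And>w. w \<in> ball p R \<Longrightarrow> D w = exp (f w)"
        proof -
          have "\<exists>g. g holomorphic_on ball p R \<and> (\<forall>w\<in>ball p R. D w = exp (g w))"
            by (rule contractible_imp_holomorphic_log[OF _ _ _]) (use holD nzD in \<open>auto simp: convex_imp_contractible\<close>)
          thus ?thesis using that by blast
        qed
        have ref: "Re (f w) = ln (norm (D w))" if "w \<in> ball p R" for w
          using f(2)[OF that] by simp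
        define A where "A = ln (C' * (\<bar>t\<bar> + 5)) + 1"
        have C'1: "C' \<ge> 1" by (simp add: C'_def)
        have ct: "C' * (\<bar>t\<bar> + 5) \<ge> 1"
          using mult_mono[of 1 C' 1 "\<bar>t\<bar> + 5"] C'1 by simp
        have ps: "s \<in> ball p R" "norm (s - p) \<le> r"
        proof -
          have "s - p = of_real (Re s - 2)" by (simp add: p_def t_def complex_eq_iff)
          hence "norm (s - p) = \<bar>Re s - 2\<bar>" by (simp only: norm_of_real)
          thus "norm (s - p) \<le> r" using s False by (simp add: r_def abs_le_iff)
          thus "s \<in> ball p R" using Rr by (simp add: dist_norm norm_minus_commute)
        qed
        have "Re (f s) \<le> G + \<epsilon> * A"
        proof (rule G[OF f(1)])
          show "0 \<le> A" unfolding A_def using ct by simp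
          fix z assume z: "z \<in> ball p R"
          show "Re (f z) < A"
          proof -
            have "norm (D z) \<le> C' * norm z" using reg(1)[OF z] by (intro C') auto
            also have "\<dots> \<le> C' * (\<bar>t\<bar> + 5)" using reg(3)[OF z] C'1 by (intro mult_left_mono) auto
            finally have "ln (norm (D z)) \<le> ln (C' * (\<bar>t\<bar> + 5))"
              using nzD[OF z] by (intro ln_mono) auto
            thus "Re (f z) < A" by (simp add: ref[OF z] A_def)
          qed
        next
          fix z assume z: "z \<in> ball p (1 / 2)"
          show "Re (f z) < K"
          proof -
            from z have zR: "z \<in> ball p R" using Rr by auto
            have "\<bar>Re (z - p)\<bar> < 1 / 2" using z abs_Re_le_cmod[of "z - p"] by (simp add: dist_norm norm_minus_commute)
            hence "- (1 / 2) < Re (z - p)" unfolding abs_less_iff by simp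
            hence "Re z \<ge> 3 / 2" by (simp add: p_def)
            hence "ln (norm (D z)) \<le> ln Z" using nzD[OF zR] DZ by (intro ln_mono) auto
            thus "Re (f z) < K" by (simp add: ref[OF zR] K_def)
          qed
        next
          show "Re (f p) > - K"
          proof -
            have pR: "p \<in> ball p R" using Rr by simp
            have "1 \<le> norm (D p) * Z" by (rule DZ') (simp add: p_def)
            hence "0 \<le> ln (norm (D p) * Z)" by simp
            also have "\<dots> = ln (norm (D p)) + ln Z" using nzD[OF pR] Z(1) by (intro ln_mult_pos) auto
            finally show ?thesis by (simp add: ref[OF pR] K_def)
          qed
        qed (rule ps)
        hence "ln (norm (D s)) \<le> G + \<epsilon> * (ln C' + 1) + \<epsilon> * ln (\<bar>t\<bar> + 5)"
        proof -
          have "A = ln C' + ln (\<bar>t\<bar> + 5) + 1" unfolding A_def using C'1 by (subst ln_mult_pos) auto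
          thus "Re (f s) \<le> G + \<epsilon> * A \<Longrightarrow> ?thesis" by (simp add: ref[OF ps(1)] algebra_simps)
        qed
        hence "exp (ln (norm (D s))) \<le> exp (G + \<epsilon> * (ln C' + 1) + \<epsilon> * ln (\<bar>t\<bar> + 5))" by (simp only: exp_le_cancel_iff)
        hence "norm (D s) \<le> exp (G + \<epsilon> * (ln C' + 1)) * (\<bar>t\<bar> + 5) powr \<epsilon>"
          using nzD[OF ps(1)] by (simp add: exp_add powr_def)
        also have "\<dots> \<le> C * (\<bar>t\<bar> + 5) powr \<epsilon>" by (intro mult_right_mono) (auto simp: C_def)
        finally show ?thesis .
      qed
      thus "norm (s * laplace_half mertens s) \<le> C * (\<bar>Im s\<bar> + 5) powr \<epsilon>" by (simp add: D_def t_def)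
    qed
  qed
qed

text \<open>Division by |s| turns growth of exponent \<epsilon> into decay of exponent \<epsilon> -
  1; for |t| < 3 a constant suffices because 1 + |t| < 4. This decay just fails to be integrable,
  which is why a Gaussian factor is introduced afterwards.\<close>

lemma mertens_transform_line_bound:
  assumes conv: "\<And>a. a > c \<Longrightarrow> laplace_half_conv mertens a" and c: "c \<ge> 1 / 2"
    and \<sigma>: "\<sigma> > c" and \<epsilon>: "0 < \<epsilon>" "\<epsilon> < 1"
  shows "\<exists>C. \<forall>t. norm (laplace_half mertens (Complex \<sigma> t)) \<le> C * (1 + \<bar>t\<bar>) powr (\<epsilon> - 1)"
proof -
  obtain C1 where C1: "\<And>s. Re s \<ge> \<sigma> \<Longrightarrow> \<bar>Im s\<bar> \<ge> 3 \<Longrightarrow> norm (s * laplace_half mertens s) \<le> C1 * (\<bar>Im s\<bar> + 5) powr \<epsilon>"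
    using mertens_transform_bound[OF conv c \<sigma> \<epsilon>(1)] by blast
  define C2 where "C2 = (\<integral>u. \<bar>mertens u\<bar> * exp (- (\<sigma> * u)) \<partial>halfline)"
  have C2: "norm (laplace_half mertens (Complex \<sigma> t)) \<le> C2" for t
    unfolding C2_def by (intro norm_laplace_le conv \<sigma>) auto
  have C20: "C2 \<ge> 0" unfolding C2_def by (intro integral_nonneg_AE AE_I2) auto
  define C where "C = max (4 * C2) (10 * \<bar>C1\<bar>)"
  show ?thesis
  proof (intro exI[of _ C] allI)
    fix t :: real
    show "norm (laplace_half mertens (Complex \<sigma> t)) \<le> C * (1 + \<bar>t\<bar>) powr (\<epsilon> - 1)"
    proof (cases "\<bar>t\<bar> \<ge> 3")
      case True
      define L where "L = norm (laplace_half mertens (Complex \<sigma> t))"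
      have tn: "\<bar>t\<bar> \<le> norm (Complex \<sigma> t)" using abs_Im_le_cmod[of "Complex \<sigma> t"] by simp
      have "(1 + \<bar>t\<bar>) / 2 * L \<le> \<bar>t\<bar> * L" using True by (intro mult_right_mono) (auto simp: L_def)
      also have "\<dots> \<le> norm (Complex \<sigma> t) * L" using tn by (intro mult_right_mono) (auto simp: L_def)
      also have "\<dots> \<le> C1 * (\<bar>t\<bar> + 5) powr \<epsilon>" using C1[of "Complex \<sigma> t"] True by (simp add: L_def norm_mult)
      also have "\<dots> \<le> \<bar>C1\<bar> * (5 * (1 + \<bar>t\<bar>)) powr \<epsilon>"
        using \<epsilon> by (intro mult_mono powr_mono2) auto
      also have "\<dots> = \<bar>C1\<bar> * 5 powr \<epsilon> * (1 + \<bar>t\<bar>) powr \<epsilon>" by (subst powr_mult) simp_all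
      also have "\<dots> \<le> \<bar>C1\<bar> * 5 powr 1 * (1 + \<bar>t\<bar>) powr \<epsilon>"
        using \<epsilon> by (intro mult_right_mono mult_left_mono powr_mono) auto
      finally have "L * (1 + \<bar>t\<bar>) \<le> 10 * \<bar>C1\<bar> * (1 + \<bar>t\<bar>) powr \<epsilon>" by (simp add: mult_ac)
      hence "L \<le> 10 * \<bar>C1\<bar> * (1 + \<bar>t\<bar>) powr \<epsilon> / (1 + \<bar>t\<bar>)"
        by (simp add: pos_le_divide_eq add_pos_nonneg)
      also have "\<dots> = 10 * \<bar>C1\<bar> * (1 + \<bar>t\<bar>) powr (\<epsilon> - 1)"
        by (simp add: powr_diff)
      also have "\<dots> \<le> C * (1 + \<bar>t\<bar>) powr (\<epsilon> - 1)" by (intro mult_right_mono) (auto simp: C_def)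
      finally show ?thesis by (simp add: L_def)
    next
      case False
      have "1 / 4 = (4::real) powr (- 1)" by (simp add: powr_minus)
      also have "\<dots> \<le> (1 + \<bar>t\<bar>) powr (- 1)" using False by (intro powr_mono2') auto
      also have "\<dots> \<le> (1 + \<bar>t\<bar>) powr (\<epsilon> - 1)" using \<epsilon> by (intro powr_mono) auto
      finally have "(4 * C2) * (1 / 4) \<le> C * (1 + \<bar>t\<bar>) powr (\<epsilon> - 1)"
        using C20 by (intro mult_mono) (auto simp: C_def)
      thus ?thesis using C2[of t] by simp
    qed
  qed
qed

subsection \<open>A pointwise bound by Gaussian smoothing\<close>

lemma sigma_finite_halfline: "sigma_finite_measure halfline"
  by (intro sigma_finite_measure_restrict_space sigma_finite_lborel) simp

lemma integrable_gaussian: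
  assumes "h > 0" shows "has_bochner_integral lborel (\<lambda>w. exp (- (h\<^sup>2 * w\<^sup>2) / 2)) (sqrt (2 * pi) / h)"
proof -
  have "has_bochner_integral lborel (\<lambda>w. Re (iexp (0 * w) * of_real (exp (- (h\<^sup>2 * w\<^sup>2) / 2))))
     (Re (of_real (sqrt (2 * pi) / h * exp (- 0\<^sup>2 / (2 * h\<^sup>2)))))"
    by (rule has_bochner_integral_Re[OF gaussian_fourier[OF assms]])
  thus ?thesis by simp
qed

text \<open>Fubini's theorem for f(u) exp(-\<sigma> u) against a Gaussian in t: integrating over t
  first gives a Gaussian in v - u, integrating over u first gives the transform on the line Re s =
  \<sigma>. The Gaussian makes the double integral absolutely convergent without any decay of the
  transform.\<close>

lemma laplace_gaussian_smoothing:
  assumes [measurable]: "f \<in> borel_measurable borel" and f: "laplace_half_conv f \<sigma>" and h: "h > 0"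
  shows "of_real (sqrt (2 * pi) / h * (\<integral>u. f u * exp (- (\<sigma> * u)) * exp (- (v - u)\<^sup>2 / (2 * h\<^sup>2)) \<partial>halfline)) =
    (\<integral>t. iexp (v * t) * of_real (exp (- (h\<^sup>2 * t\<^sup>2) / 2)) * laplace_half f (Complex \<sigma> t) \<partial>lborel)"
    and "integrable lborel (\<lambda>t. iexp (v * t) * of_real (exp (- (h\<^sup>2 * t\<^sup>2) / 2)) * laplace_half f (Complex \<sigma> t))"
proof -
  interpret pair_sigma_finite halfline lborel
    by (intro pair_sigma_finite.intro sigma_finite_halfline sigma_finite_lborel)
  define X where "X u = f u * exp (- (\<sigma> * u))" for u
  have [measurable]: "X \<in> borel_measurable borel" unfolding X_def by measurable
  have [measurable]: "X \<in> borel_measurable halfline" by measurable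
  have X: "integrable halfline X" using f unfolding laplace_conv_def X_def .
  define G where "G t = exp (- (h\<^sup>2 * t\<^sup>2) / 2)" for t
  have G: "integrable lborel G" using integrable_gaussian[OF h] unfolding has_bochner_integral_iff G_def by (rule conjunct1)
  have G0: "G t \<ge> 0" for t by (simp add: G_def)
  have [measurable]: "G \<in> borel_measurable borel" unfolding G_def by measurable
  define k where "k u t = of_real (X u) * (iexp ((v - u) * t) * of_real (G t))" for u t
  have km: "case_prod k \<in> borel_measurable (halfline \<Otimes>\<^sub>M lborel)"
  proof -
    have [measurable]: "(\<lambda>p. fst p) \<in> halfline \<Otimes>\<^sub>M lborel \<rightarrow>\<^sub>M borel"
      by (rule measurable_compose[OF measurable_fst]) (rule measurable_halfline, simp)
    have [measurable]: "(\<lambda>p. snd p) \<in> halfline \<Otimes>\<^sub>M lborel \<rightarrow>\<^sub>M borel"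
      by (rule measurable_compose[OF measurable_snd]) simp
    show ?thesis unfolding k_def case_prod_beta by measurable
  qed
  have nk: "norm (k u t) = \<bar>X u\<bar> * G t" for u t by (simp add: k_def norm_mult G_def)
  have "integrable (halfline \<Otimes>\<^sub>M lborel) (case_prod k)"
  proof (rule Fubini_integrable[OF km])
    have "integrable halfline (\<lambda>u. \<bar>X u\<bar> * integral\<^sup>L lborel G)" using X by simp
    thus "integrable halfline (\<lambda>u. \<integral>t. norm (case_prod k (u, t)) \<partial>lborel)" by (simp add: nk)
    show "AE u in halfline. integrable lborel (\<lambda>t. case_prod k (u, t))"
    proof (rule AE_I2)
      fix u
      show "integrable lborel (\<lambda>t. case_prod k (u, t))"
      proof (rule Bochner_Integration.integrable_bound)
        show "integrable lborel (\<lambda>t. \<bar>X u\<bar> * G t)" using G by simp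
        show "(\<lambda>t. case_prod k (u, t)) \<in> borel_measurable lborel" unfolding k_def prod.case by measurable
      qed (simp add: nk abs_mult G0)
    qed
  qed
  note kint = this
  from Fubini_integral[OF kint]
  have "(\<integral>t. (\<integral>u. k u t \<partial>halfline) \<partial>lborel) = (\<integral>u. (\<integral>t. k u t \<partial>lborel) \<partial>halfline)" .
  moreover have "(\<integral>t. k u t \<partial>lborel) = of_real (sqrt (2 * pi) / h * (X u * exp (- (v - u)\<^sup>2 / (2 * h\<^sup>2))))" for u
  proof -
    have "(\<integral>t. k u t \<partial>lborel) = of_real (X u) * of_real (sqrt (2 * pi) / h * exp (- (v - u)\<^sup>2 / (2 * h\<^sup>2)))"
      using has_bochner_integral_integral_eq[OF gaussian_fourier[OF h, of "v - u"]]
      unfolding k_def G_def by (subst integral_mult_right_zero) simp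
    thus ?thesis by simp
  qed
  moreover have inner: "(\<integral>u. k u t \<partial>halfline) = iexp (v * t) * of_real (G t) * laplace_half f (Complex \<sigma> t)" for t
  proof -
    have "k u t = (iexp (v * t) * of_real (G t)) * (of_real (f u) * exp (- (Complex \<sigma> t * of_real u)))" for u
    proof -
      have "of_real (exp (- (\<sigma> * u))) * iexp ((v - u) * t) = iexp (v * t) * exp (- (Complex \<sigma> t * of_real u))"
        unfolding exp_of_real[symmetric] exp_add[symmetric] by (simp add: Complex_eq algebra_simps)
      thus ?thesis by (simp add: k_def X_def)
    qed
    thus ?thesis unfolding laplace_def by simp
  qed
  ultimately have "(\<integral>t. iexp (v * t) * of_real (G t) * laplace_half f (Complex \<sigma> t) \<partial>lborel) =
     (\<integral>u. complex_of_real (sqrt (2 * pi) / h * (X u * exp (- (v - u)\<^sup>2 / (2 * h\<^sup>2)))) \<partial>halfline)"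
    by simp
  also have "\<dots> = of_real (\<integral>u. sqrt (2 * pi) / h * (X u * exp (- (v - u)\<^sup>2 / (2 * h\<^sup>2))) \<partial>halfline)"
    by (rule integral_complex_of_real)
  finally show "of_real (sqrt (2 * pi) / h * (\<integral>u. f u * exp (- (\<sigma> * u)) * exp (- (v - u)\<^sup>2 / (2 * h\<^sup>2)) \<partial>halfline)) =
    (\<integral>t. iexp (v * t) * of_real (exp (- (h\<^sup>2 * t\<^sup>2) / 2)) * laplace_half f (Complex \<sigma> t) \<partial>lborel)"
    unfolding X_def G_def by simp
  show "integrable lborel (\<lambda>t. iexp (v * t) * of_real (exp (- (h\<^sup>2 * t\<^sup>2) / 2)) * laplace_half f (Complex \<sigma> t))"
    using integrable_snd[OF kint] unfolding inner G_def .
qed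

lemma integrable_powr_line:
  fixes a :: real
  assumes a: "a > 0"
  shows "integrable lborel (\<lambda>t::real. (1 + \<bar>t\<bar>) powr (- 1 - a))"
proof (rule integrableI_nonneg)
  define F where "F t = (1 + t) powr (- a) / (- a)" for t :: real
  have "(F \<longlongrightarrow> 0 / (- a)) at_top"
    unfolding F_def using a
    by (intro tendsto_divide tendsto_const tendsto_neg_powr filterlim_tendsto_add_at_top filterlim_ident) auto
  moreover have "(F has_real_derivative (1 + x) powr (- 1 - a)) (at x)" if "x \<ge> 0" for x
  proof -
    have "((\<lambda>t. (1 + t) powr (- a)) has_real_derivative (- a) * (1 + x) powr (- a - 1) * 1) (at x)"
      using that by (intro DERIV_chain2[OF has_real_derivative_powr]) (auto intro!: derivative_eq_intros)
    moreover have e: "- a - 1 = - 1 - a" by simp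
    ultimately have "((\<lambda>t. (1 + t) powr (- a)) has_real_derivative (- a) * (1 + x) powr (- 1 - a) * 1) (at x)"
      by (simp only: e)
    from DERIV_cdivide[OF this, of "- a"] show ?thesis
      unfolding F_def using a by simp
  qed
  ultimately have "(\<integral>\<^sup>+t\<in>{0..}. ennreal ((1 + t) powr (- 1 - a))\<partial>lborel) = ennreal (0 / (- a) - F 0)"
    by (intro nn_integral_FTC_atLeast) auto
  moreover have "(\<integral>\<^sup>+t. ennreal ((1 + \<bar>t\<bar>) powr (- 1 - a)) \<partial>halfline) = (\<integral>\<^sup>+t\<in>{0..}. ennreal ((1 + t) powr (- 1 - a))\<partial>lborel)"
    by (subst nn_integral_restrict_space) (auto simp: indicator_def intro!: nn_integral_cong)
  ultimately have "(\<integral>\<^sup>+t. ennreal ((1 + \<bar>t\<bar>) powr (- 1 - a)) \<partial>halfline) = ennreal (0 / (- a) - F 0)"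
    by simp
  thus "(\<integral>\<^sup>+t. ennreal ((1 + \<bar>t\<bar>) powr (- 1 - a)) \<partial>lborel) < \<infinity>"
    by (subst nn_integral_real_line_split) (auto simp: less_top[symmetric])
qed auto

text \<open>Pointwise exp(-(h t)^2 / 2) is at most 2 (h (1 + |t|))^(-2 \<epsilon>), so the integrand
  is at most 2 h^(-2 \<epsilon>) times the integrable (1 + |t|)^(-1 - \<epsilon>). Here h \<le> 1
  gives h (1 + |t|) \<le> 1 + h |t|, and 2 \<epsilon> \<le> 1 replaces a power of 1 + y by 1 + y
  itself.\<close>

lemma gaussian_powr_integral_bound:
  fixes \<epsilon> :: real
  assumes \<epsilon>: "0 < \<epsilon>" "\<epsilon> \<le> 1 / 2"
  shows "\<exists>C. \<forall>h. 0 < h \<longrightarrow> h \<le> 1 \<longrightarrow>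
    integrable lborel (\<lambda>t. exp (- (h\<^sup>2 * t\<^sup>2) / 2) * (1 + \<bar>t\<bar>) powr (\<epsilon> - 1)) \<and>
    (\<integral>t. exp (- (h\<^sup>2 * t\<^sup>2) / 2) * (1 + \<bar>t\<bar>) powr (\<epsilon> - 1) \<partial>lborel) \<le> C * h powr (- 2 * \<epsilon>)"
proof (intro exI allI impI)
  fix h :: real assume h: "0 < h" "h \<le> 1"
  define g where "g t = (1 + \<bar>t\<bar>) powr (- 1 - \<epsilon>)" for t :: real
  have g: "integrable lborel g" unfolding g_def using \<epsilon>(1) by (rule integrable_powr_line)
  have b: "exp (- (h\<^sup>2 * t\<^sup>2) / 2) * (1 + \<bar>t\<bar>) powr (\<epsilon> - 1) \<le> 2 * h powr (- 2 * \<epsilon>) * g t" for t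
  proof -
    define y where "y = h * \<bar>t\<bar>"
    have y: "y \<ge> 0" using h by (simp add: y_def)
    have "(h * (1 + \<bar>t\<bar>)) powr (2 * \<epsilon>) \<le> (1 + y) powr (2 * \<epsilon>)"
      using h \<epsilon> by (intro powr_mono2) (auto simp: y_def algebra_simps)
    also have "\<dots> \<le> (1 + y) powr 1" using y \<epsilon> by (intro powr_mono) auto
    also have "\<dots> \<le> 2 * exp (y\<^sup>2 / 2)"
    proof -
      have "1 + y \<le> 2 * (1 + y\<^sup>2 / 2)"
        using sum_squares_ge_zero[of "y - 1 / 2" 0] by (simp add: power2_eq_square algebra_simps)
      also have "\<dots> \<le> 2 * exp (y\<^sup>2 / 2)" by (intro mult_left_mono exp_ge_add_one_self) auto
      finally show ?thesis using y by simp
    qed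
    finally have "h powr (2 * \<epsilon>) * (1 + \<bar>t\<bar>) powr (2 * \<epsilon>) \<le> 2 * exp (y\<^sup>2 / 2)"
      using h by (simp add: powr_mult)
    hence "exp (- (y\<^sup>2 / 2)) * (h powr (- 2 * \<epsilon>) * (h powr (2 * \<epsilon>) * (1 + \<bar>t\<bar>) powr (2 * \<epsilon>))) \<le>
        exp (- (y\<^sup>2 / 2)) * (h powr (- 2 * \<epsilon>) * (2 * exp (y\<^sup>2 / 2)))"
      by (intro mult_left_mono) auto
    moreover have c1: "h powr (- 2 * \<epsilon>) * (h powr (2 * \<epsilon>) * Y) = Y" for Y
      using h by (simp add: powr_minus)
    moreover have c2: "exp (- (y\<^sup>2 / 2)) * (Y * (2 * exp (y\<^sup>2 / 2))) = 2 * Y" for Y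
      by (simp add: exp_minus)
    ultimately have "exp (- (y\<^sup>2 / 2)) * (1 + \<bar>t\<bar>) powr (2 * \<epsilon>) \<le> 2 * h powr (- 2 * \<epsilon>)"
      by (simp only: c1 c2)
    hence "exp (- (y\<^sup>2 / 2)) * (1 + \<bar>t\<bar>) powr (2 * \<epsilon>) * g t \<le> 2 * h powr (- 2 * \<epsilon>) * g t"
      by (rule mult_right_mono) (simp add: g_def)
    moreover have "(1 + \<bar>t\<bar>) powr (2 * \<epsilon>) * g t = (1 + \<bar>t\<bar>) powr (\<epsilon> - 1)"
      unfolding g_def powr_add[symmetric] by simp
    moreover have "- (y\<^sup>2 / 2) = - (h\<^sup>2 * t\<^sup>2) / 2" by (simp add: y_def power_mult_distrib)
    ultimately show ?thesis by (simp add: mult.assoc)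
  qed
  have i: "integrable lborel (\<lambda>t. 2 * h powr (- 2 * \<epsilon>) * g t)" using g by simp
  show int: "integrable lborel (\<lambda>t. exp (- (h\<^sup>2 * t\<^sup>2) / 2) * (1 + \<bar>t\<bar>) powr (\<epsilon> - 1)) \<and>
    (\<integral>t. exp (- (h\<^sup>2 * t\<^sup>2) / 2) * (1 + \<bar>t\<bar>) powr (\<epsilon> - 1) \<partial>lborel) \<le> (2 * (\<integral>t. (1 + \<bar>t\<bar>) powr (- 1 - \<epsilon>) \<partial>lborel)) * h powr (- 2 * \<epsilon>)"
  proof
    show I: "integrable lborel (\<lambda>t. exp (- (h\<^sup>2 * t\<^sup>2) / 2) * (1 + \<bar>t\<bar>) powr (\<epsilon> - 1))"
    proof (rule Bochner_Integration.integrable_bound[OF i])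
      show "AE t in lborel. norm (exp (- (h\<^sup>2 * t\<^sup>2) / 2) * (1 + \<bar>t\<bar>) powr (\<epsilon> - 1)) \<le> norm (2 * h powr (- 2 * \<epsilon>) * g t)"
        using b by (intro AE_I2) (simp add: g_def abs_mult)
    qed measurable
    have "(\<integral>t. exp (- (h\<^sup>2 * t\<^sup>2) / 2) * (1 + \<bar>t\<bar>) powr (\<epsilon> - 1) \<partial>lborel) \<le> (\<integral>t. 2 * h powr (- 2 * \<epsilon>) * g t \<partial>lborel)"
      by (intro integral_mono I i b)
    thus "(\<integral>t. exp (- (h\<^sup>2 * t\<^sup>2) / 2) * (1 + \<bar>t\<bar>) powr (\<epsilon> - 1) \<partial>lborel) \<le> (2 * (\<integral>t. (1 + \<bar>t\<bar>) powr (- 1 - \<epsilon>) \<partial>lborel)) * h powr (- 2 * \<epsilon>)"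
      by (simp add: g_def mult_ac)
  qed
qed

text \<open>An interval of length d contains at most d + 1 integers when it is half-open, as here;
  the 1 is the rounding loss.\<close>

lemma summatory_diff_le:
  assumes a: "\<And>n. \<bar>a n\<bar> \<le> 1"
  shows "\<bar>summatory a u - summatory a v\<bar> \<le> \<bar>exp u - exp v\<bar> + 1"
proof -
  have *: "\<bar>summatory a u - summatory a v\<bar> \<le> \<bar>exp u - exp v\<bar> + 1" if "v \<le> u" for u v
  proof -
    define m n where "m = nat \<lfloor>exp v\<rfloor>" and "n = nat \<lfloor>exp u\<rfloor>"
    have mn: "m \<le> n" unfolding m_def n_def using that by (intro nat_mono floor_mono) simp
    have "summatory a u - summatory a v = sum a {1..n} - sum a {1..m}"
      unfolding summatory_def summatory_set m_def n_def ..
    also have "\<dots> = sum a ({1..n} - {1..m})" using mn by (subst sum_diff) auto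
    finally have "\<bar>summatory a u - summatory a v\<bar> \<le> (\<Sum>k\<in>{1..n} - {1..m}. \<bar>a k\<bar>)" by simp
    also have "\<dots> \<le> (\<Sum>k\<in>{1..n} - {1..m}. 1)" by (intro sum_mono a)
    also have "\<dots> = real n - real m" using mn by (simp add: card_Diff_subset of_nat_diff)
    also have "\<dots> \<le> exp u - exp v + 1"
    proof -
      have "real n \<le> exp u" unfolding n_def by simp
      moreover have "exp v \<le> real m + 1" unfolding m_def
        using real_of_int_floor_add_one_ge[of "exp v"] by (simp add: of_nat_nat)
      ultimately show ?thesis by simp
    qed
    finally show ?thesis by linarith
  qed
  show ?thesis using *[of v u] *[of u v] by (cases "v \<le> u") auto
qed

lemma abs_exp_minus_one_le: "\<bar>exp x - 1\<bar> \<le> \<bar>x\<bar> * exp \<bar>x :: real\<bar>"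
proof (cases "x \<ge> 0")
  case True
  have "1 - x \<le> exp (- x)" using exp_ge_add_one_self[of "- x"] by simp
  hence "(1 - x) * exp x \<le> 1" by (simp add: exp_minus field_simps)
  thus ?thesis using True by (simp add: algebra_simps)
next
  case False
  have "1 + x \<le> exp x" by (rule exp_ge_add_one_self)
  moreover have "exp x \<le> 1" using False by simp
  ultimately have "\<bar>exp x - 1\<bar> \<le> - x" by linarith
  hence "\<bar>exp x - 1\<bar> \<le> \<bar>x\<bar> * 1" using False by simp
  also have "\<dots> \<le> \<bar>x\<bar> * exp \<bar>x\<bar>" by (intro mult_left_mono) auto
  finally show ?thesis .
qed

text \<open>Completing the square gives (\<sigma> + 2) y \<le> (\<sigma> + 2)^2 + y^2 / 4: half of
  the Gaussian exponent absorbs the exponential factors and half is kept for integration. It is used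
  with r = (u - v) / h.\<close>

lemma gaussian_weight_bound:
  fixes r \<sigma> :: real
  assumes \<sigma>: "\<sigma> \<ge> 0"
  shows "(\<bar>r\<bar> * exp \<bar>r\<bar> + 1) * exp (\<sigma> * \<bar>r\<bar>) * exp (- (r\<^sup>2 / 2)) \<le> 2 * exp ((\<sigma> + 2)\<^sup>2) * exp (- (r\<^sup>2 / 4))"
proof -
  define y where "y = \<bar>r\<bar>"
  have y: "y \<ge> 0" by (simp add: y_def)
  have "y \<le> exp y" using exp_ge_add_one_self[of y] by linarith
  hence "y * exp y \<le> exp y * exp y" by (intro mult_right_mono) auto
  hence "y * exp y \<le> exp (2 * y)" by (simp add: exp_add[symmetric])
  moreover have "1 \<le> exp (2 * y)" using y by simp
  ultimately have "y * exp y + 1 \<le> 2 * exp (2 * y)" by linarith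
  hence "(y * exp y + 1) * exp (\<sigma> * y) * exp (- (r\<^sup>2 / 2)) \<le> 2 * exp (2 * y) * exp (\<sigma> * y) * exp (- (r\<^sup>2 / 2))"
    by (intro mult_right_mono) auto
  also have "\<dots> = 2 * exp (2 * y + \<sigma> * y - r\<^sup>2 / 2)"
  proof -
    have "exp (2 * y + \<sigma> * y - r\<^sup>2 / 2) = exp (2 * y) * exp (\<sigma> * y) * exp (- (r\<^sup>2 / 2))"
      unfolding exp_add[symmetric] by simp
    thus ?thesis by simp
  qed
  also have "\<dots> \<le> 2 * exp ((\<sigma> + 2)\<^sup>2 - r\<^sup>2 / 4)"
  proof -
    have "0 \<le> ((\<sigma> + 2) - y / 2)\<^sup>2" by simp
    moreover have "r\<^sup>2 = y\<^sup>2" by (simp add: y_def)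
    ultimately have "2 * y + \<sigma> * y - r\<^sup>2 / 2 \<le> (\<sigma> + 2)\<^sup>2 - r\<^sup>2 / 4"
      by (simp add: power2_eq_square algebra_simps)
    thus ?thesis by simp
  qed
  also have "\<dots> = 2 * exp ((\<sigma> + 2)\<^sup>2) * exp (- (r\<^sup>2 / 4))"
  proof -
    have "exp ((\<sigma> + 2)\<^sup>2 - r\<^sup>2 / 4) = exp ((\<sigma> + 2)\<^sup>2) * exp (- (r\<^sup>2 / 4))"
      unfolding exp_add[symmetric] by simp
    thus ?thesis by simp
  qed
  finally show ?thesis by (simp add: y_def)
qed

text \<open>
  Smoothing on the scale \<open>e\<^sup>-\<^sup>v\<close> moves the argument of the summatory function by a bounded
  amount, hence its value by a bounded amount, and costs only an \<open>\<epsilon>\<close>-power.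
\<close>

lemma summatory_pointwise_bound:
  fixes \<epsilon> \<sigma> C0 :: real
  assumes a: "\<And>n. \<bar>a n\<bar> \<le> 1" and conv: "laplace_half_conv (summatory a) \<sigma>" and \<sigma>: "\<sigma> > 0"
    and \<epsilon>: "0 < \<epsilon>" "\<epsilon> \<le> 1 / 2"
    and F: "\<And>t. norm (laplace_half (summatory a) (Complex \<sigma> t)) \<le> C0 * (1 + \<bar>t\<bar>) powr (\<epsilon> - 1)"
  shows "\<exists>C. \<forall>v\<ge>0. \<bar>summatory a v\<bar> \<le> C * exp ((\<sigma> + 2 * \<epsilon>) * v)"
proof -
  let ?M = "summatory a"
  let ?e = "\<lambda>u. exp (- (\<sigma> * u))" and ?G = "\<lambda>h t. exp (- (h\<^sup>2 * t\<^sup>2) / 2)"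
  let ?p = "\<lambda>t. (1 + \<bar>t\<bar>) powr (\<epsilon> - 1)" and ?d = "\<lambda>u v. \<bar>exp u - exp v\<bar> + 1"
  obtain C1 where C1: "\<forall>h. 0 < h \<longrightarrow> h \<le> 1 \<longrightarrow>
    integrable lborel (\<lambda>t. ?G h t * ?p t) \<and>
    (\<integral>t. ?G h t * ?p t \<partial>lborel) \<le> C1 * h powr (- 2 * \<epsilon>)"
    using gaussian_powr_integral_bound[OF \<epsilon>] by blast
  have "0 \<le> norm (laplace_half ?M (Complex \<sigma> 0))" by simp
  also have "\<dots> \<le> C0" using F[of 0] by simp
  finally have C0: "C0 \<ge> 0" .
  define C2 where "C2 = 2 * exp ((\<sigma> + 2)\<^sup>2)"
  \<comment> \<open>The factor exp(\<sigma> + 1/2) undoes the loss in the lower bound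
    \<open>W0\<close>. The two summands come from the smoothed value \<open>J\<close> and from the
    variation of the summatory function under the kernel.\<close>
  define C where "C = exp (\<sigma> + 1 / 2) * (C0 * C1 / sqrt (2 * pi) + C2 * (2 * sqrt pi))"
  show ?thesis
  proof (intro exI[of _ C] allI impI)
    fix v :: real assume v: "v \<ge> 0"
    \<comment> \<open>At this scale a step h in u changes exp u by about h exp v = 1, and the loss
      h^(-2 \<epsilon>) of the smoothing is exp(2 \<epsilon> v).\<close>
    define h where "h = exp (- v)"
    have h: "0 < h" "h \<le> 1" using v by (auto simp: h_def)
    have he: "h * exp v = 1" by (simp add: h_def exp_add[symmetric])
    define E where "E u = exp (- (v - u)\<^sup>2 / (2 * h\<^sup>2))" for u
    have [measurable]: "E \<in> borel_measurable borel" unfolding E_def by measurable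
    have E01: "0 \<le> E u" "E u \<le> 1" for u by (auto simp: E_def)
    define J where "J = (\<integral>u. ?M u * ?e u * E u \<partial>halfline)"
    have J: "\<bar>J\<bar> \<le> h / sqrt (2 * pi) * (C0 * (C1 * h powr (- 2 * \<epsilon>)))"
    proof -
      have "sqrt (2 * pi) / h * \<bar>J\<bar> = norm (complex_of_real (sqrt (2 * pi) / h * J))"
        using h by (simp only: norm_of_real) (simp add: abs_mult)
      also have "\<dots> = norm (\<integral>t. iexp (v * t) * of_real (?G h t) * laplace_half ?M (Complex \<sigma> t) \<partial>lborel)"
        unfolding J_def E_def by (subst laplace_gaussian_smoothing(1)[OF _ conv h(1)]) auto
      also have "\<dots> \<le> (\<integral>t. C0 * (?G h t * ?p t) \<partial>lborel)"
      proof (rule Bochner_Integration.integral_norm_bound_integral)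
        show "integrable lborel (\<lambda>t. C0 * (?G h t * ?p t))"
          using C1 h by simp
        show "integrable lborel (\<lambda>t. iexp (v * t) * of_real (?G h t) * laplace_half ?M (Complex \<sigma> t))"
          by (rule laplace_gaussian_smoothing(2)[OF summatory_measurable conv h(1)])
        fix t :: real
        have "norm (iexp (v * t) * of_real (?G h t) * laplace_half ?M (Complex \<sigma> t)) =
          ?G h t * norm (laplace_half ?M (Complex \<sigma> t))" by (simp add: norm_mult)
        also have "\<dots> \<le> ?G h t * (C0 * ?p t)" by (intro mult_left_mono F) auto
        finally show "norm (iexp (v * t) * of_real (?G h t) * laplace_half ?M (Complex \<sigma> t)) \<le>
           C0 * (?G h t * ?p t)" by (simp add: mult_ac)
      qed
      also have "\<dots> \<le> C0 * (C1 * h powr (- 2 * \<epsilon>))" using C1 h C0 by (simp add: mult_left_mono)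
      finally show ?thesis using h by (simp add: field_simps)
    qed
    \<comment> \<open>The window [v, v + h] alone provides the mass: there the kernel is at least
      exp(-1/2), and since h \<le> 1 the exponential weight drops at most by the factor
      exp(-\<sigma>).\<close>
    have W0: "exp (- (\<sigma> + 1 / 2)) * h * ?e v \<le> (\<integral>u. ?e u * E u \<partial>halfline)"
    proof -
      have "(\<integral>u. exp (- (\<sigma> + 1 / 2)) * ?e v * indicator {v..v + h} u \<partial>halfline) \<le> (\<integral>u. ?e u * E u \<partial>halfline)"
      proof (rule integral_mono_AE')
        show "integrable halfline (\<lambda>u. ?e u * E u)"
        proof (rule Bochner_Integration.integrable_bound)
          show "integrable halfline (\<lambda>u. ?e u)"
            using has_bochner_integral_exp_halfline[OF \<sigma>] by (simp add: has_bochner_integral_iff)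
          show "AE u in halfline. norm (?e u * E u) \<le> norm (?e u)"
            using E01 by (intro AE_I2) (simp add: abs_mult mult_left_le)
        qed measurable
        show "AE u in halfline. exp (- (\<sigma> + 1 / 2)) * ?e v * indicator {v..v + h} u \<le> ?e u * E u"
        proof (rule AE_I2)
          fix u
          show "exp (- (\<sigma> + 1 / 2)) * ?e v * indicator {v..v + h} u \<le> ?e u * E u"
          proof (cases "u \<in> {v..v + h}")
            case True
            have "(v - u)\<^sup>2 \<le> h\<^sup>2" using True by (simp add: power2_commute[of v u] power_mono)
            hence "(v - u)\<^sup>2 / (2 * h\<^sup>2) \<le> 1 / 2" using h by (simp add: field_simps)
            hence 1: "exp (- (1 / 2)) \<le> E u" by (simp add: E_def)
            have "\<sigma> * u \<le> \<sigma> * (v + 1)" using True h \<sigma> by (intro mult_left_mono) auto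
            hence 2: "exp (- \<sigma>) * ?e v \<le> ?e u"
              by (simp add: exp_add[symmetric] algebra_simps)
            have "exp (- \<sigma>) * ?e v * exp (- (1 / 2)) \<le> ?e u * E u"
              using 1 2 by (intro mult_mono) auto
            moreover have "exp (- (\<sigma> + 1 / 2)) = exp (- \<sigma>) * exp (- (1 / 2))"
              by (simp add: exp_add[symmetric])
            ultimately show ?thesis using True by (simp add: mult_ac)
          qed (use E01 in simp)
        qed
      qed (use E01 in auto)
      moreover have "(\<integral>u. exp (- (\<sigma> + 1 / 2)) * ?e v * indicator {v..v + h} u \<partial>halfline) = exp (- (\<sigma> + 1 / 2)) * ?e v * h"
      proof -
        have "(\<integral>u. indicat_real {v..v + h} u \<partial>halfline) = (\<integral>u. indicat_real {0..} u *\<^sub>R indicat_real {v..v + h} u \<partial>lborel)"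
          by (rule integral_restrict_space) simp
        also have "\<dots> = (\<integral>u. indicat_real {v..v + h} u \<partial>lborel)"
          using v by (intro Bochner_Integration.integral_cong) (auto simp: indicator_def)
        also have "\<dots> = h" using h by simp
        finally show ?thesis by simp
      qed
      ultimately show ?thesis by (simp add: mult_ac)
    qed
    have cont: "?d u v * ?e u * E u \<le> ?e v * C2 * exp (- ((1 / (sqrt 2 * h))\<^sup>2 * (u - v)\<^sup>2) / 2)" for u
    proof -
      define r where "r = (u - v) / h"
      have uv: "u - v = h * r" using h by (simp add: r_def)
      have hr: "\<bar>h * r\<bar> \<le> \<bar>r\<bar>" using h by (simp add: abs_mult mult_left_le_one_le)
      have "\<bar>exp u - exp v\<bar> = exp v * \<bar>exp (h * r) - 1\<bar>"
      proof -
        have "exp u = exp v * exp (h * r)" unfolding uv[symmetric] by (simp add: exp_add[symmetric])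
        hence "exp u - exp v = exp v * (exp (h * r) - 1)" by (simp add: algebra_simps)
        thus ?thesis by (simp add: abs_mult)
      qed
      also have "\<dots> \<le> exp v * (\<bar>h * r\<bar> * exp \<bar>h * r\<bar>)" by (intro mult_left_mono abs_exp_minus_one_le) auto
      also have "\<dots> = (h * exp v) * (\<bar>r\<bar> * exp \<bar>h * r\<bar>)" using h by (simp add: abs_mult)
      also have "\<dots> \<le> \<bar>r\<bar> * exp \<bar>r\<bar>" unfolding he using hr by (simp add: mult_left_mono)
      finally have 1: "?d u v \<le> \<bar>r\<bar> * exp \<bar>r\<bar> + 1" by simp
      have "- (\<sigma> * u) = - (\<sigma> * v) + \<sigma> * (- (h * r))" unfolding uv[symmetric] by (simp add: algebra_simps)
      also have "\<dots> \<le> - (\<sigma> * v) + \<sigma> * \<bar>r\<bar>"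
        using hr \<sigma> by (intro add_left_mono mult_left_mono) linarith+
      finally have 2: "?e u \<le> ?e v * exp (\<sigma> * \<bar>r\<bar>)" by (simp add: exp_add[symmetric])
      have 3: "E u = exp (- (r\<^sup>2 / 2))"
        using h by (simp add: E_def r_def power_divide power2_commute[of v u])
      have "?d u v * ?e u * E u \<le>
         (\<bar>r\<bar> * exp \<bar>r\<bar> + 1) * (?e v * exp (\<sigma> * \<bar>r\<bar>)) * exp (- (r\<^sup>2 / 2))"
        unfolding 3 using 1 2 by (intro mult_mono) auto
      also have "\<dots> = ?e v * ((\<bar>r\<bar> * exp \<bar>r\<bar> + 1) * exp (\<sigma> * \<bar>r\<bar>) * exp (- (r\<^sup>2 / 2)))" by (simp only: mult_ac)
      also have "\<dots> \<le> ?e v * (2 * exp ((\<sigma> + 2)\<^sup>2) * exp (- (r\<^sup>2 / 4)))"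
        using \<sigma> by (intro mult_left_mono gaussian_weight_bound) auto
      also have "r\<^sup>2 / 4 = ((1 / (sqrt 2 * h))\<^sup>2 * (u - v)\<^sup>2) / 2"
        by (simp add: r_def power_divide power_mult_distrib)
      finally show ?thesis by (simp add: C2_def mult.assoc)
    qed
    \<comment> \<open>Chosen so that k^2 (u - v)^2 / 2 = r^2 / 4. The total mass of this wider
      Gaussian is sqrt(2 pi) / k = 2 sqrt(pi) h, again of order h.\<close>
    define k where "k = 1 / (sqrt 2 * h)"
    have k: "k > 0" using h by (simp add: k_def)
    have gk: "has_bochner_integral lborel (\<lambda>u. exp (- (k\<^sup>2 * (u - v)\<^sup>2) / 2)) (2 * sqrt pi * h)"
    proof -
      have "has_bochner_integral lborel (\<lambda>u. exp (- (k\<^sup>2 * (- v + 1 * u)\<^sup>2) / 2)) ((sqrt (2 * pi) / k) /\<^sub>R \<bar>1\<bar>)"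
        using integrable_gaussian[OF k] by (subst (asm) lborel_has_bochner_integral_real_affine_iff[where c = 1 and t = "- v"]) auto
      moreover have "sqrt (2 * pi) / k = 2 * sqrt pi * h" by (simp add: k_def real_sqrt_mult)
      ultimately show ?thesis by (simp add: add.commute[of "- v"])
    qed
    have iD: "integrable halfline (\<lambda>u. ?d u v * ?e u * E u)"
      and D: "(\<integral>u. ?d u v * ?e u * E u \<partial>halfline) \<le> ?e v * C2 * (2 * sqrt pi * h)"
    proof -
      define b where "b u = ?e v * C2 * exp (- (k\<^sup>2 * (u - v)\<^sup>2) / 2)" for u
      have b: "has_bochner_integral lborel b (?e v * C2 * (2 * sqrt pi * h))"
        unfolding b_def by (intro has_bochner_integral_mult_right gk)
      have b0: "b u \<ge> 0" for u by (simp add: b_def C2_def)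
      have cb: "?d u v * ?e u * E u \<le> b u" for u
        using cont[of u] unfolding b_def k_def .
      have bi: "integrable lborel b" using b by (simp add: has_bochner_integral_iff)
      have ib: "integrable lborel (\<lambda>u. indicator {0..} u *\<^sub>R b u)"
        by (rule integrable_mult_indicator[OF _ bi]) simp
      have bh: "integrable halfline b" using ib by (subst integrable_restrict_space) auto
      show I: "integrable halfline (\<lambda>u. ?d u v * ?e u * E u)"
      proof (rule Bochner_Integration.integrable_bound[OF bh])
        show "AE u in halfline. norm (?d u v * ?e u * E u) \<le> norm (b u)"
        proof (rule AE_I2)
          fix u
          have nn: "0 \<le> ?d u v * ?e u * E u"
            by (intro mult_nonneg_nonneg E01) auto
          show "norm (?d u v * ?e u * E u) \<le> norm (b u)"
            unfolding real_norm_def abs_of_nonneg[OF nn] abs_of_nonneg[OF b0] by (rule cb)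
        qed
      qed measurable
      have "(\<integral>u. ?d u v * ?e u * E u \<partial>halfline) \<le> integral\<^sup>L halfline b"
        by (intro integral_mono I bh cb)
      also have "\<dots> = (\<integral>u. indicator {0..} u *\<^sub>R b u \<partial>lborel)" by (subst integral_restrict_space) auto
      also have "\<dots> \<le> integral\<^sup>L lborel b"
        using b0 by (intro integral_mono ib bi) (auto simp: indicator_def)
      also have "\<dots> = ?e v * C2 * (2 * sqrt pi * h)" using b by (rule has_bochner_integral_integral_eq)
      finally show "(\<integral>u. ?d u v * ?e u * E u \<partial>halfline) \<le> ?e v * C2 * (2 * sqrt pi * h)" .
    qed
    define W where "W = (\<integral>u. ?e u * E u \<partial>halfline)"
    have iW: "integrable halfline (\<lambda>u. ?e u * E u)"
    proof (rule Bochner_Integration.integrable_bound[OF iD])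
      show "AE u in halfline. norm (?e u * E u) \<le> norm (?d u v * ?e u * E u)"
        using E01 by (intro AE_I2) (simp add: abs_mult mult_right_mono mult_le_cancel_right1)
    qed measurable
    have iJ: "integrable halfline (\<lambda>u. ?M u * ?e u * E u)"
    proof (rule Bochner_Integration.integrable_bound[OF conv[unfolded laplace_conv_def]])
      show "AE u in halfline. norm (?M u * ?e u * E u) \<le> norm (?M u * ?e u)"
        using E01 by (intro AE_I2) (simp add: abs_mult mult_left_le)
    qed measurable
    \<comment> \<open>The value at v, weighted by the mass \<open>W\<close>, is compared with the
      smoothed value \<open>J\<close>. The error and the lower bound for the mass are both of order
      h exp(-\<sigma> v), so h cancels at the end.\<close>
    have "\<bar>?M v * W - J\<bar> \<le> ?e v * C2 * (2 * sqrt pi * h)"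
    proof -
      have i1: "integrable halfline (\<lambda>u. ?M v * (?e u * E u))"
        by (intro integrable_mult_right iW)
      have eq: "?M v * W - J = (\<integral>u. ?M v * (?e u * E u) - ?M u * ?e u * E u \<partial>halfline)"
        unfolding W_def J_def Bochner_Integration.integral_diff[OF i1 iJ] integral_mult_right_zero ..
      have "norm (\<integral>u. ?M v * (?e u * E u) - ?M u * ?e u * E u \<partial>halfline) \<le>
         (\<integral>u. ?d u v * ?e u * E u \<partial>halfline)"
      proof (rule Bochner_Integration.integral_norm_bound_integral)
        show "integrable halfline (\<lambda>u. ?M v * (?e u * E u) - ?M u * ?e u * E u)"
          by (rule Bochner_Integration.integrable_diff[OF i1 iJ])
        show "integrable halfline (\<lambda>u. ?d u v * ?e u * E u)" by (rule iD)
        fix u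
        have e: "0 \<le> ?e u * E u" by (intro mult_nonneg_nonneg E01) auto
        have "?M v * (?e u * E u) - ?M u * ?e u * E u = (?M v - ?M u) * (?e u * E u)"
          by (simp add: algebra_simps)
        hence "norm (?M v * (?e u * E u) - ?M u * ?e u * E u) = norm ((?M v - ?M u) * (?e u * E u))"
          by (simp only:)
        also have "\<dots> = \<bar>?M u - ?M v\<bar> * (?e u * E u)"
          unfolding real_norm_def abs_mult[of "?M v - ?M u"] abs_of_nonneg[OF e] by (subst abs_minus_commute) (rule refl)
        also have "\<dots> \<le> ?d u v * (?e u * E u)"
          by (intro mult_right_mono summatory_diff_le a e)
        finally show "norm (?M v * (?e u * E u) - ?M u * ?e u * E u) \<le> ?d u v * ?e u * E u"
          by (simp add: mult.assoc)
      qed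
      hence "\<bar>?M v * W - J\<bar> \<le> (\<integral>u. ?d u v * ?e u * E u \<partial>halfline)"
        unfolding eq real_norm_def .
      thus ?thesis using D by (rule order_trans)
    qed
    hence "\<bar>?M v * W\<bar> \<le> h / sqrt (2 * pi) * (C0 * (C1 * h powr (- 2 * \<epsilon>))) + ?e v * C2 * (2 * sqrt pi * h)"
      using J by linarith
    moreover have "\<bar>?M v\<bar> * (exp (- (\<sigma> + 1 / 2)) * h * ?e v) \<le> \<bar>?M v\<bar> * W"
      using W0 unfolding W_def by (intro mult_left_mono) auto
    moreover have "W \<ge> 0" unfolding W_def using E01 by (intro integral_nonneg_AE AE_I2) auto
    ultimately have "\<bar>?M v\<bar> * (exp (- (\<sigma> + 1 / 2)) * h * ?e v) \<le>
       h / sqrt (2 * pi) * (C0 * (C1 * h powr (- 2 * \<epsilon>))) + ?e v * C2 * (2 * sqrt pi * h)"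
      by (simp add: abs_mult)
    also have "\<dots> = h * (C0 * C1 / sqrt (2 * pi) * exp (2 * \<epsilon> * v) + C2 * (2 * sqrt pi) * ?e v)"
      by (simp add: h_def powr_def algebra_simps)
    finally have "h * (\<bar>?M v\<bar> * (exp (- (\<sigma> + 1 / 2)) * ?e v)) \<le>
       h * (C0 * C1 / sqrt (2 * pi) * exp (2 * \<epsilon> * v) + C2 * (2 * sqrt pi) * ?e v)"
      by (simp add: mult_ac)
    hence "\<bar>?M v\<bar> * (exp (- (\<sigma> + 1 / 2)) * ?e v) \<le>
       C0 * C1 / sqrt (2 * pi) * exp (2 * \<epsilon> * v) + C2 * (2 * sqrt pi) * ?e v"
      using h by (subst (asm) mult_le_cancel_left_pos) auto
    hence "exp (\<sigma> + 1 / 2) * exp (\<sigma> * v) * (\<bar>?M v\<bar> * (exp (- (\<sigma> + 1 / 2)) * ?e v)) \<le>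
       exp (\<sigma> + 1 / 2) * exp (\<sigma> * v) * (C0 * C1 / sqrt (2 * pi) * exp (2 * \<epsilon> * v) + C2 * (2 * sqrt pi) * ?e v)"
      by (intro mult_left_mono) auto
    moreover have "exp x * exp y * (Y * (exp (- x) * exp (- y))) = Y" for x y Y :: real
      by (simp add: exp_minus field_simps)
    ultimately have "\<bar>?M v\<bar> \<le> exp (\<sigma> + 1 / 2) * exp (\<sigma> * v) * (C0 * C1 / sqrt (2 * pi) * exp (2 * \<epsilon> * v) + C2 * (2 * sqrt pi) * ?e v)"
      by (simp only:)
    also have "\<dots> \<le> exp (\<sigma> + 1 / 2) * exp (\<sigma> * v) * (C0 * C1 / sqrt (2 * pi) * exp (2 * \<epsilon> * v) + C2 * (2 * sqrt pi) * exp (2 * \<epsilon> * v))"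
      using v \<sigma> \<epsilon> by (intro mult_left_mono add_left_mono) (auto simp: C2_def intro: order_trans[of _ 0])
    also have "\<dots> = C * exp ((\<sigma> + 2 * \<epsilon>) * v)"
    proof -
      have "exp ((\<sigma> + 2 * \<epsilon>) * v) = exp (\<sigma> * v) * exp (2 * \<epsilon> * v)" by (simp add: exp_add[symmetric] algebra_simps)
      moreover have "A * B * (P * Q + R * Q) = A * (P + R) * (B * Q)" for A B P Q R :: real by (simp add: algebra_simps)
      ultimately show ?thesis unfolding C_def by (simp only:)
    qed
    finally show "\<bar>?M v\<bar> \<le> C * exp ((\<sigma> + 2 * \<epsilon>) * v)" .
  qed
qed

subsection \<open>Transforms over sparse sets\<close>

text \<open>The margin \<eta> is spent in two halves: one moves the line of integration to c +
  \<eta>/2, the other covers the smoothing loss 2 \<epsilon>.\<close>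

lemma mertens_pointwise_bound:
  assumes conv: "\<And>a. a > c \<Longrightarrow> laplace_half_conv mertens a" and c: "c \<ge> 1 / 2" and \<eta>: "\<eta> > 0"
  shows "\<exists>K. \<forall>v\<ge>0. \<bar>mertens v\<bar> \<le> K * exp ((c + \<eta>) * v)"
proof -
  define \<sigma> where "\<sigma> = c + \<eta> / 2"
  define \<epsilon> where "\<epsilon> = min (\<eta> / 4) (1 / 2)"
  have \<epsilon>: "0 < \<epsilon>" "\<epsilon> \<le> 1 / 2" "\<epsilon> < 1" "2 * \<epsilon> \<le> \<eta> / 2" using \<eta> by (auto simp: \<epsilon>_def)
  have \<sigma>: "\<sigma> > c" "\<sigma> > 0" using c \<eta> by (auto simp: \<sigma>_def)
  obtain C0 where C0: "\<And>t. norm (laplace_half mertens (Complex \<sigma> t)) \<le> C0 * (1 + \<bar>t\<bar>) powr (\<epsilon> - 1)"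
    using mertens_transform_line_bound[OF conv c \<sigma>(1) \<epsilon>(1,3)] by blast
  obtain K where K: "\<And>v. v \<ge> 0 \<Longrightarrow> \<bar>mertens v\<bar> \<le> K * exp ((\<sigma> + 2 * \<epsilon>) * v)"
    using summatory_pointwise_bound[OF abs_mu_real_le conv[OF \<sigma>(1)] \<sigma>(2) \<epsilon>(1,2) C0] by blast
  have K0: "K \<ge> 0" using K[of 0] by simp
  show ?thesis
  proof (intro exI[of _ K] allI impI)
    fix v :: real assume v: "v \<ge> 0"
    have "(\<sigma> + 2 * \<epsilon>) * v \<le> (c + \<eta>) * v" using \<epsilon> v by (intro mult_right_mono) (auto simp: \<sigma>_def)
    hence "K * exp ((\<sigma> + 2 * \<epsilon>) * v) \<le> K * exp ((c + \<eta>) * v)" using K0 by (intro mult_left_mono) auto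
    thus "\<bar>mertens v\<bar> \<le> K * exp ((c + \<eta>) * v)" using K[OF v] by linarith
  qed
qed

text \<open>The derivative of exp is at least exp a on [a, b]. This carries a sparsity bound from
  the variable x = exp u to the variable u.\<close>

lemma emeasure_exp_ge:
  assumes [measurable]: "B \<in> sets borel" and ab: "a \<le> b"
  shows "ennreal (exp a) * emeasure lborel (B \<inter> {a..b}) \<le> emeasure lborel {x\<in>{exp a..exp b}. ln x \<in> B}"
proof -
  have "emeasure lborel {x\<in>{exp a..exp b}. ln x \<in> B} = (\<integral>\<^sup>+x. indicator {x\<in>{exp a..exp b}. ln x \<in> B} x \<partial>lborel)"
    by simp
  also have "\<dots> = (\<integral>\<^sup>+x. ennreal (indicator B (ln x) * indicator {exp a..exp b} x) \<partial>lborel)"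
    by (intro nn_integral_cong) (auto simp: indicator_def)
  also have "\<dots> = (\<integral>\<^sup>+u. ennreal (indicator B (ln (exp u)) * exp u * indicator {a..b} u) \<partial>lborel)"
    using ab by (intro nn_integral_substitution) (auto intro!: derivative_eq_intros continuous_intros simp: set_borel_measurable_def)
  also have "\<dots> \<ge> (\<integral>\<^sup>+u. ennreal (exp a) * indicator (B \<inter> {a..b}) u \<partial>lborel)"
    by (intro nn_integral_mono) (auto simp: indicator_def)
  finally show ?thesis by (simp add: nn_integral_cmult)
qed

text \<open>In the variable u the interval [T, 2 T] becomes a block of length ln 2, on which B has
  measure at most T^(-\<delta>). As |f| exp(-a u) is of order T^(\<kappa> - a) on it, the blocks are
  dominated by a geometric series, which converges because a > \<kappa> - \<delta>.\<close>

lemma sparse_set_conv: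
  assumes [measurable]: "B \<in> sets borel" "f \<in> borel_measurable borel"
    and f: "\<And>u. u \<ge> 0 \<Longrightarrow> \<bar>f u\<bar> \<le> K * exp (\<kappa> * u)"
    and B: "\<And>T. T \<ge> M \<Longrightarrow> emeasure lborel {x\<in>{T..2 * T}. ln x \<in> B} \<le> ennreal (T powr (1 - \<delta>))"
    and a: "a > \<kappa> - \<delta>"
  shows "laplace_half_conv (\<lambda>u. indicator B u * f u) a"
proof -
  define L where "L = ln (2::real)"
  have L: "L > 0" "exp L = 2" by (auto simp: L_def)
  define p where "p = a - \<kappa>"
  let ?w = "\<lambda>u. indicator B u * exp (- (p * u))" and ?r = "\<lambda>k. exp (- (\<delta> * (real k * L)))"
    and ?J = "\<lambda>k. {real k * L..real (Suc k) * L}"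
  have K0: "K \<ge> 0" using f[of 0] by simp
  \<comment> \<open>Half-open blocks are disjoint and cover the half-line; the closed blocks
    \<open>?J k\<close> are the images under ln of the closed intervals in the hypothesis.\<close>
  define I where "I k = {real k * L..<real (Suc k) * L}" for k
  have dI: "disjoint_family I"
  proof (unfold disjoint_family_on_def, intro ballI impI)
    have *: "I m \<inter> I n = {}" if "m < n" for m n
    proof -
      have "real (Suc m) * L \<le> real n * L" using that L by (intro mult_right_mono) auto
      thus ?thesis by (auto simp: I_def)
    qed
    show "I m \<inter> I n = {}" if "m \<noteq> n" for m n
      using *[of m n] *[of n m] that by (cases "m < n") auto
  qed
  have cover: "\<exists>k. u \<in> I k" if "u \<ge> 0" for u
  proof
    define k where "k = nat \<lfloor>u / L\<rfloor>"
    have "u / L \<ge> 0" using that L by simp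
    hence "real k \<le> u / L" "u / L < real k + 1" unfolding k_def by linarith+
    thus "u \<in> I k" using L by (simp add: I_def field_simps)
  qed
  \<comment> \<open>\<open>p\<close> may be negative, so the variation of exp(-p u) over a block is
    bounded through |p|.\<close>
  define c where "c k = exp (\<bar>p\<bar> * L) * exp (- (p * (real k * L)))" for k
  define m where "m k = emeasure lborel (B \<inter> ?J k)" for k
  have term_le: "(\<integral>\<^sup>+u. ennreal (?w u) * indicator (I k) u \<partial>lborel) \<le> ennreal (c k) * m k" for k
  proof -
    have "(\<integral>\<^sup>+u. ennreal (?w u) * indicator (I k) u \<partial>lborel) \<le>
        (\<integral>\<^sup>+u. ennreal (c k) * indicator (B \<inter> ?J k) u \<partial>lborel)"
    proof (rule nn_integral_mono)
      fix u
      show "ennreal (?w u) * indicator (I k) u \<le> ennreal (c k) * indicator (B \<inter> ?J k) u"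
      proof (cases "u \<in> B \<and> u \<in> I k")
        case True
        hence u: "0 \<le> u - real k * L" "u - real k * L \<le> L" by (auto simp: I_def algebra_simps)
        have "- (p * (u - real k * L)) \<le> \<bar>p\<bar> * (u - real k * L)"
          using u(1) by (metis abs_ge_minus_self mult_minus_left mult_right_mono)
        also have "\<dots> \<le> \<bar>p\<bar> * L" using u by (intro mult_left_mono) auto
        finally have "- (p * u) \<le> \<bar>p\<bar> * L + - (p * (real k * L))" by (simp add: algebra_simps)
        hence "exp (- (p * u)) \<le> c k" unfolding c_def exp_add[symmetric] by simp
        moreover have "u \<in> ?J k" using True by (auto simp: I_def)
        ultimately show ?thesis using True by (simp add: ennreal_leI)
      qed (auto simp: indicator_def)
    qed
    also have "\<dots> = ennreal (c k) * m k" unfolding m_def by (subst nn_integral_cmult) auto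
    finally show ?thesis .
  qed
  obtain k0 :: nat where k0: "M / L < real k0" using reals_Archimedean2 by blast
  have m_small: "m k \<le> ennreal (?r k)" if k: "k \<ge> k0" for k
  proof -
    define T where "T = exp (real k * L)"
    have "M \<le> real k0 * L" using k0 L by (simp add: field_simps)
    also have "\<dots> \<le> real k * L" using k L by (intro mult_right_mono) auto
    also have "\<dots> \<le> T" unfolding T_def using exp_ge_add_one_self[of "real k * L"] by linarith
    finally have T: "T \<ge> M" .
    have T2: "exp (real (Suc k) * L) = 2 * T" by (simp add: T_def distrib_right exp_add L)
    have "ennreal T * m k \<le> emeasure lborel {x\<in>{T..2 * T}. ln x \<in> B}"
      unfolding m_def T2[symmetric] unfolding T_def using L by (intro emeasure_exp_ge) auto
    also have "\<dots> \<le> ennreal (T powr (1 - \<delta>))" by (rule B[OF T])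
    finally have "ennreal (1 / T) * (ennreal T * m k) \<le> ennreal (1 / T) * ennreal (T powr (1 - \<delta>))"
      by (intro mult_left_mono) auto
    moreover have "ennreal (1 / T) * (ennreal T * m k) = m k"
      by (simp add: T_def mult.assoc[symmetric] ennreal_mult[symmetric])
    moreover have "ennreal (1 / T) * ennreal (T powr (1 - \<delta>)) = ennreal (?r k)"
    proof -
      have "1 / T * T powr (1 - \<delta>) = T powr (- \<delta>)" by (simp add: T_def powr_diff powr_minus field_simps)
      also have "\<dots> = ?r k" by (simp add: T_def powr_def)
      finally show ?thesis by (simp add: T_def ennreal_mult[symmetric])
    qed
    ultimately show ?thesis by simp
  qed
  have m_fin: "m k \<le> ennreal L" for k
  proof -
    have "m k \<le> emeasure lborel (?J k)" unfolding m_def by (intro emeasure_mono) auto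
    also have "\<dots> = ennreal L" using L by (simp add: algebra_simps)
    finally show ?thesis .
  qed
  \<comment> \<open>Below \<open>k0\<close> the sparsity bound is not yet available, and the length
    L of the block replaces it.\<close>
  define b where "b k = c k * (if k < k0 then L else ?r k)" for k
  have b0: "b k \<ge> 0" for k using L by (simp add: b_def c_def)
  have mb: "ennreal (c k) * m k \<le> ennreal (b k)" for k
  proof -
    have "m k \<le> ennreal (if k < k0 then L else ?r k)"
      using m_small[of k] m_fin[of k] by simp
    hence "ennreal (c k) * m k \<le> ennreal (c k) * ennreal (if k < k0 then L else ?r k)"
      by (intro mult_left_mono) auto
    also have "\<dots> = ennreal (b k)" unfolding b_def using L by (subst ennreal_mult) (auto simp: c_def)
    finally show ?thesis .
  qed
  have sb: "summable b"
  proof -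
    have "p + \<delta> > 0" using a by (simp add: p_def)
    hence "exp (- ((p + \<delta>) * L)) < 1" using L by simp
    hence "summable (\<lambda>k. exp (\<bar>p\<bar> * L) * exp (- ((p + \<delta>) * L)) ^ k)"
      by (intro summable_mult summable_geometric) auto
    moreover have "b k = exp (\<bar>p\<bar> * L) * exp (- ((p + \<delta>) * L)) ^ k" if "k \<ge> k0" for k
    proof -
      have "exp (- ((p + \<delta>) * L)) ^ k = exp (- (p * (real k * L))) * ?r k"
        unfolding exp_of_nat_mult[symmetric] exp_add[symmetric] by (simp add: algebra_simps)
      thus ?thesis using that by (simp add: b_def c_def)
    qed
    hence "\<forall>\<^sub>F k in sequentially. b k = exp (\<bar>p\<bar> * L) * exp (- ((p + \<delta>) * L)) ^ k"
      by (auto simp: eventually_sequentially)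
    ultimately show ?thesis by (subst summable_cong) auto
  qed
  have "(\<integral>\<^sup>+u. ennreal (?w u) \<partial>halfline) = (\<integral>\<^sup>+u. ennreal (?w u) * indicator {0..} u \<partial>lborel)"
    by (subst nn_integral_restrict_space) auto
  also have "\<dots> \<le> (\<integral>\<^sup>+u. (\<Sum>k. ennreal (?w u) * indicator (I k) u) \<partial>lborel)"
  proof (rule nn_integral_mono)
    fix u :: real
    show "ennreal (?w u) * indicator {0..} u \<le> (\<Sum>k. ennreal (?w u) * indicator (I k) u)"
    proof (cases "u \<ge> 0")
      case True
      then obtain k where k: "u \<in> I k" using cover by blast
      show ?thesis using suminf_cmult_indicator[OF dI k, of "\<lambda>_. ennreal (?w u)"] True by simp
    qed simp
  qed
  also have "\<dots> = (\<Sum>k. \<integral>\<^sup>+u. ennreal (?w u) * indicator (I k) u \<partial>lborel)"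
    by (rule nn_integral_suminf) (simp add: I_def)
  also have "\<dots> \<le> (\<Sum>k. ennreal (b k))"
    by (intro suminf_le order_trans[OF term_le mb]) auto
  also have "\<dots> < \<infinity>" using sb b0 by (simp add: suminf_ennreal2 less_top)
  finally have fin: "(\<integral>\<^sup>+u. ennreal (?w u) \<partial>halfline) < \<infinity>" .
  have "integrable halfline (\<lambda>u. ?w u)"
    by (rule integrableI_nonneg) (use fin in auto)
  hence i: "integrable halfline (\<lambda>u. K * (?w u))" by simp
  show ?thesis
    unfolding laplace_conv_def
  proof (rule Bochner_Integration.integrable_bound[OF i])
    show "AE u in halfline. norm (indicator B u * f u * exp (- (a * u))) \<le> norm (K * (?w u))"
    proof (rule AE_I2)
      fix u :: real assume "u \<in> space halfline"
      hence "\<bar>f u\<bar> * exp (- (a * u)) \<le> K * exp (\<kappa> * u) * exp (- (a * u))"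
        by (intro mult_right_mono f) auto
      also have "\<dots> = K * exp (- (p * u))" unfolding mult.assoc exp_add[symmetric] by (simp add: p_def algebra_simps)
      finally show "norm (indicator B u * f u * exp (- (a * u))) \<le> norm (K * (?w u))"
        using K0 by (simp add: abs_mult indicator_def)
    qed
  qed measurable
qed

lemma laplace_half_linear:
  assumes [measurable]: "f \<in> borel_measurable borel" "g \<in> borel_measurable borel"
    and f: "laplace_half_conv f a" and g: "laplace_half_conv g a" and s: "a \<le> Re s"
  shows "laplace_half (\<lambda>u. x * f u + y * g u) s = of_real x * laplace_half f s + of_real y * laplace_half g s"
proof -
  have i: "integrable halfline (\<lambda>u. of_real (f u) * exp (- (s * of_real u)))"
    "integrable halfline (\<lambda>u. of_real (g u) * exp (- (s * of_real u)))"
    by (intro laplace_integrable[OF _ _ _ f s] laplace_integrable[OF _ _ _ g s]; simp)+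
  have "laplace_half (\<lambda>u. x * f u + y * g u) s =
     (\<integral>u. of_real x * (of_real (f u) * exp (- (s * of_real u))) + of_real y * (of_real (g u) * exp (- (s * of_real u))) \<partial>halfline)"
    unfolding laplace_def by (intro Bochner_Integration.integral_cong) (auto simp: algebra_simps)
  also have "\<dots> = of_real x * laplace_half f s + of_real y * laplace_half g s"
    unfolding laplace_def using i by (subst Bochner_Integration.integral_add) auto
  finally show ?thesis .
qed

lemma laplace_half_conv_linear:
  assumes "laplace_half_conv f a" "laplace_half_conv g a"
  shows "laplace_half_conv (\<lambda>u. x * f u + y * g u) a"
proof -
  have "integrable halfline (\<lambda>u. x * (f u * exp (- (a * u))) + y * (g u * exp (- (a * u))))"
    using assms unfolding laplace_conv_def by auto
  thus ?thesis unfolding laplace_conv_def by (simp add: algebra_simps)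
qed

lemma laplace_half_conv_mono:
  "f \<in> borel_measurable borel \<Longrightarrow> laplace_half_conv f a \<Longrightarrow> a \<le> b \<Longrightarrow> laplace_half_conv f b"
  by (rule laplace_conv_mono) auto

lemma exp_half_conv: "a > 1 / 2 \<Longrightarrow> laplace_half_conv (\<lambda>u. exp (1 / 2 * u)) a"
  by (rule laplace_half_conv_bound[where C = 1 and c = "1 / 2"]) auto

subsection \<open>Sparse excess sets\<close>

text \<open>What a failure of the claim would provide, for both sets at once through the sign
  \<tau>. The aim is that C is then at least the residue quotient. The square root of x is written
  \<open>exp (1 / 2 * ln x)\<close> to match the variable u = ln x.\<close>

locale sparse_excess =
  fixes \<tau> C \<delta> T0 :: real
  assumes \<tau>: "\<bar>\<tau>\<bar> = 1" and \<delta>: "\<delta> > 0"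
    and sparse: "\<And>T. T \<ge> T0 \<Longrightarrow>
      emeasure lborel {x\<in>{T..2 * T}. \<tau> * mertens (ln x) > C * exp (1 / 2 * ln x)} \<le> ennreal (T powr (1 - \<delta>))"
begin

definition f :: "real \<Rightarrow> real" where "f u = C * exp (1 / 2 * u) + (- \<tau>) * mertens u"
definition B :: "real set" where "B = {u. \<tau> * mertens u > C * exp (1 / 2 * u)}"
definition fB :: "real \<Rightarrow> real" where "fB u = indicator B u * f u"
text \<open>This is \<open>f\<close> off \<open>B\<close>, hence nonnegative. The coefficients 1 and
  -1 are written out to fit the linearity lemmas for the transform.\<close>

definition fN :: "real \<Rightarrow> real" where "fN u = 1 * f u + (- 1) * fB u"

lemma measurable_f [measurable]:
  "f \<in> borel_measurable borel" "B \<in> sets borel" "fB \<in> borel_measurable borel" "fN \<in> borel_measurable borel"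
  unfolding f_def[abs_def] B_def fB_def[abs_def] fN_def[abs_def] by measurable

lemma fN_nonneg: "fN u \<ge> 0"
  by (auto simp: fN_def fB_def f_def B_def indicator_def)

lemma conv_f: "laplace_half_conv mertens a \<Longrightarrow> a > 1 / 2 \<Longrightarrow> laplace_half_conv f a"
  unfolding f_def[abs_def] by (intro laplace_half_conv_linear exp_half_conv)

text \<open>The pointwise bound with exponent c + \<eta> and the sparsity \<delta> give convergence
  to the right of c + \<eta> - \<delta>; \<eta> is taken small enough to put this point below
  a.\<close>

lemma conv_fB:
  assumes conv: "\<And>a. a > c \<Longrightarrow> laplace_half_conv mertens a" and c: "c \<ge> 1 / 2" and a: "a > c - \<delta>"
  shows "laplace_half_conv fB a"
proof -
  define \<eta> where "\<eta> = min \<delta> (a - c + \<delta>) / 2"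
  have \<eta>: "\<eta> > 0" "c + \<eta> - \<delta> < a" using \<delta> a by (auto simp: \<eta>_def min_def field_simps)
  obtain K where K: "\<And>v. v \<ge> 0 \<Longrightarrow> \<bar>mertens v\<bar> \<le> K * exp ((c + \<eta>) * v)"
    using mertens_pointwise_bound[OF conv c \<eta>(1)] by blast
  have "\<bar>f u\<bar> \<le> (\<bar>C\<bar> + K) * exp ((c + \<eta>) * u)" if u: "u \<ge> 0" for u
  proof -
    have "1 / 2 * u \<le> (c + \<eta>) * u" using c \<eta> u by (intro mult_right_mono) auto
    hence "\<bar>C\<bar> * exp (1 / 2 * u) \<le> \<bar>C\<bar> * exp ((c + \<eta>) * u)" by (intro mult_left_mono) auto
    moreover have "\<bar>f u\<bar> \<le> \<bar>C * exp (1 / 2 * u)\<bar> + \<bar>(- \<tau>) * mertens u\<bar>"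
      unfolding f_def by (rule abs_triangle_ineq)
    moreover have "\<bar>(- \<tau>) * mertens u\<bar> = \<bar>mertens u\<bar>" using \<tau> unfolding abs_mult abs_minus_cancel by simp
    moreover have "\<bar>C * exp (1 / 2 * u)\<bar> = \<bar>C\<bar> * exp (1 / 2 * u)" by (simp add: abs_mult)
    ultimately show ?thesis using K[OF u] unfolding distrib_right[of "\<bar>C\<bar>"] by linarith
  qed
  thus ?thesis
    unfolding fB_def[abs_def]
  proof (intro sparse_set_conv[where \<delta> = \<delta> and \<kappa> = "c + \<eta>" and M = T0 and K = "\<bar>C\<bar> + K"])
    show "emeasure lborel {x\<in>{T..2 * T}. ln x \<in> B} \<le> ennreal (T powr (1 - \<delta>))" if "T \<ge> T0" for T
      using sparse[OF that] by (simp add: B_def)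
  qed (use \<eta> in auto)
qed

text \<open>Apart from the points 0 and 1/2, the right-hand side makes sense wherever
  \<open>zeta_regular\<close> has no zero and the transform of \<open>fB\<close> converges, so it
  continues the left-hand side beyond c.\<close>

lemma laplace_fN:
  assumes conv: "\<And>a. a > c \<Longrightarrow> laplace_half_conv mertens a" and c: "c \<ge> 1 / 2" and s: "Re s > c"
  shows "laplace_half fN s = of_real C / (s - 1 / 2) - of_real \<tau> * ((s - 1) / (s * zeta_regular s)) - laplace_half fB s"
proof -
  have cm: "laplace_half_conv mertens (Re s)" using conv[OF s] .
  have s2: "Re s > 1 / 2" using s c by simp
  have fBc: "laplace_half_conv fB (Re s)" using conv_fB[OF conv c, of "Re s"] s \<delta> by simp
  have M: "laplace_half mertens s = (s - 1) / (s * zeta_regular s)"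
  proof -
    have "zeta_regular s \<noteq> 0"
    proof (cases "s = 1")
      case True
      thus ?thesis by (simp add: zeta_regular_def)
    next
      case False
      thus ?thesis using zeta_regular_mertens[OF conv _ s] c by auto
    qed
    moreover have "s \<noteq> 0" using s2 by auto
    moreover have "s * laplace_half mertens s * zeta_regular s = s - 1"
      using zeta_regular_mertens[OF conv _ s] c by simp
    ultimately show ?thesis by (simp add: field_simps)
  qed
  have "laplace_half fN s = of_real 1 * laplace_half f s + of_real (- 1) * laplace_half fB s"
    unfolding fN_def[abs_def] by (rule laplace_half_linear[where a = "Re s"]) (auto intro: conv_f cm s2 fBc)
  also have "laplace_half f s = of_real C * laplace_half (\<lambda>u. exp (1 / 2 * u)) s + of_real (- \<tau>) * laplace_half mertens s"
    unfolding f_def[abs_def] by (rule laplace_half_linear[OF _ _ exp_half_conv[OF s2] cm]) auto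
  also have "laplace_half (\<lambda>u. exp (1 / 2 * u)) s = 1 / (s - 1 / 2)"
    using laplace_half_exp[of "1 / 2" s] s2 by simp
  finally show ?thesis by (simp add: M)
qed

text \<open>
  Landau's theorem for the nonnegative part: the abscissa of convergence of the transform of the
  Mertens function is a regular point as long as it exceeds 1/2, so it does not.
\<close>

lemma conv_mertens_half:
  assumes a: "a > 1 / 2"
  shows "laplace_half_conv mertens a"
proof -
  \<comment> \<open>The restriction s > 1/2 keeps the set bounded below and makes 1/2 the value to
    be shown for its infimum.\<close>
  define S where "S = {s. s > 1 / 2 \<and> laplace_half_conv mertens s}"
  define c where "c = Inf S"
  have S1: "s \<in> S" if "s > 1" for s using that summatory_conv[OF abs_mu_real_le] by (simp add: S_def)
  have Sne: "S \<noteq> {}" using S1[of 2] by auto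
  have bdd: "bdd_below S" by (rule bdd_belowI[of _ "1 / 2"]) (auto simp: S_def)
  have conv: "laplace_half_conv mertens s" if "s > c" for s
  proof -
    have "Inf S < s" using that by (simp add: c_def)
    from cInf_lessD[OF Sne this] obtain t where "t \<in> S" "t < s" by blast
    thus ?thesis by (intro laplace_half_conv_mono[of mertens t s]) (auto simp: S_def)
  qed
  have c_half: "c \<ge> 1 / 2" unfolding c_def by (intro cInf_greatest Sne) (auto simp: S_def)
  have c_one: "c \<le> 1"
  proof (rule field_le_epsilon)
    fix e :: real assume "e > 0"
    thus "c \<le> 1 + e" unfolding c_def using S1[of "1 + e"] by (intro cInf_lower bdd) auto
  qed
  have "c = 1 / 2"
  proof (rule ccontr)
    assume "c \<noteq> 1 / 2"
    hence c: "c > 1 / 2" using c_half by simp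
    \<comment> \<open>To the right of d the transform of \<open>fB\<close> converges and 1/(s - 1/2)
      is regular.\<close>
    define d where "d = max (1 / 2) (c - \<delta>)"
    have d: "d < c" using c \<delta> by (simp add: d_def)
    have "zeta_regular (of_real c) \<noteq> 0" using c c_one by (intro zeta_regular_nonzero_real) auto
    moreover have "isCont zeta_regular (of_real c)"
      using zeta_regular_holomorphic c
      by (intro holomorphic_on_imp_continuous_on[THEN continuous_on_interior] ) (auto simp: interior_open open_halfspace_Re_gt)
    ultimately obtain e where e: "e > 0" "\<And>z. dist (of_real c) z < e \<Longrightarrow> zeta_regular z \<noteq> 0"
      using continuous_at_avoid[of "complex_of_real c" zeta_regular 0] by auto
    define r where "r = min e (c - d)"
    have r: "r > 0" using e d by (simp add: r_def)
    have Re: "Re z > d" if "z \<in> ball (of_real c) r" for z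
    proof -
      have "\<bar>Re (of_real c - z)\<bar> < r" using that abs_Re_le_cmod[of "of_real c - z"] by (simp add: dist_norm)
      hence "c - Re z < r" unfolding abs_less_iff by simp
      thus ?thesis by (simp add: r_def)
    qed
    have nz: "zeta_regular z \<noteq> 0" if "z \<in> ball (of_real c) r" for z
      using that by (intro e) (auto simp: r_def)
    define H where "H s = of_real C / (s - 1 / 2) - of_real \<tau> * ((s - 1) / (s * zeta_regular s)) - laplace_half fB s" for s
    have "\<exists>b<c. laplace_half_conv fN b"
    proof (rule laplace_landau[OF _ _ _ _ _ r])
      show "H holomorphic_on ball (of_real c) r"
      proof -
        have z: "zeta_regular holomorphic_on ball (of_real c) r"
          by (rule holomorphic_on_subset[OF zeta_regular_holomorphic]) (use Re in \<open>force simp: d_def\<close>)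
        have b: "laplace_half fB holomorphic_on ball (of_real c) r"
        proof (rule holomorphic_on_subset[OF laplace_half_holomorphic])
          show "laplace_half_conv fB a" if "a > d" for a using that by (intro conv_fB[OF conv c_half]) (auto simp: d_def)
        qed (use Re in auto)
        have n0: "s \<noteq> 0" "s - 1 / 2 \<noteq> 0" if "s \<in> ball (of_real c) r" for s :: complex
        proof -
          have "Re s > 1 / 2" using Re[OF that] by (simp add: d_def)
          thus "s \<noteq> 0" "s - 1 / 2 \<noteq> 0" by (auto simp: complex_eq_iff)
        qed
        show ?thesis unfolding H_def[abs_def] using n0 nz by (intro holomorphic_intros z b) auto
      qed
      show "H s = laplace_half fN s" if "Re s > c" for s
        unfolding H_def by (rule laplace_fN[OF conv c_half that, symmetric])
      show "laplace_half_conv fN s" if "s > c" for s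
        unfolding fN_def[abs_def] using that c \<delta>
        by (intro laplace_half_conv_linear conv_f conv conv_fB[OF conv c_half]) auto
    qed (use fN_nonneg in auto)
    then obtain b0 where b0: "b0 < c" "laplace_half_conv fN b0" by blast
    \<comment> \<open>Kept above d, where the transforms of \<open>fB\<close> and of exp(u/2)
      converge, so that the Mertens function can be recovered from \<open>fN\<close> by linear
      combination.\<close>
    define b where "b = max b0 ((d + c) / 2)"
    have b: "b < c" "b0 \<le> b" "b > d" using b0 d by (auto simp: b_def max_def)
    have fNb: "laplace_half_conv fN b" using b0 b by (intro laplace_half_conv_mono[of fN b0 b]) auto
    have fBb: "laplace_half_conv fB b" using b by (intro conv_fB[OF conv c_half]) (auto simp: d_def)
    have "laplace_half_conv (\<lambda>u. 1 * fN u + 1 * fB u) b" by (intro laplace_half_conv_linear fNb fBb)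
    hence fb: "laplace_half_conv f b" by (simp add: fN_def[abs_def])
    have "laplace_half_conv (\<lambda>u. (- \<tau>) * f u + (\<tau> * C) * exp (1 / 2 * u)) b"
      using b by (intro laplace_half_conv_linear fb exp_half_conv) (auto simp: d_def)
    moreover have "(- \<tau>) * f u + (\<tau> * C) * exp (1 / 2 * u) = mertens u" for u
    proof -
      have "\<tau> * \<tau> = 1" using \<tau> by (metis abs_mult_self_eq mult_1)
      moreover have "(- \<tau>) * f u + (\<tau> * C) * exp (1 / 2 * u) = (\<tau> * \<tau>) * mertens u"
        by (simp add: f_def algebra_simps)
      ultimately show ?thesis by simp
    qed
    ultimately have "laplace_half_conv mertens b" by simp
    hence "b \<in> S" using b by (simp add: S_def d_def)
    hence "c \<le> b" unfolding c_def by (intro cInf_lower bdd)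
    thus False using b by simp
  qed
  thus ?thesis using conv a by simp
qed

lemma zeta_nonzero_right: "Re s > 1 / 2 \<Longrightarrow> s \<noteq> 1 \<Longrightarrow> zeta s \<noteq> 0"
  using zeta_regular_mertens[of "1 / 2" s] conv_mertens_half zeta_regular_eq[of s] by auto

lemma zeta_zero_on_line:
  assumes "zeta s = 0" "Im s > 0"
  shows "Re s = 1 / 2"
proof (rule ccontr)
  assume "Re s \<noteq> 1 / 2"
  then consider "Re s > 1 / 2" | "Re s < 1 / 2" by linarith
  thus False
  proof cases
    case 1
    moreover have "s \<noteq> 1" using assms(2) by auto
    ultimately show ?thesis using zeta_nonzero_right[of s] assms(1) by simp
  next
    case 2
    have "zeta (1 - s) = 0" using assms by (intro zeta_zero_reflect) auto
    moreover have "1 - s \<noteq> 1" using assms by auto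
    ultimately show ?thesis using zeta_nonzero_right[of "1 - s"] 2 by simp
  qed
qed

text \<open>For a nonnegative function the transform at \<sigma> + i \<gamma> is bounded by the
  transform at \<sigma>. Multiply by d = \<sigma> - 1/2 and let d tend to 0: the right side tends to
  C, from the pole of C / (s - 1/2), while 1 / (s zeta s) contributes 1 / |s0 zeta'(s0)| on the
  left. In product form the claim does not presuppose that the zero is simple.\<close>

lemma deriv_zeta_bound:
  assumes z: "zeta s0 = 0" and im: "Im s0 > 0"
  shows "1 \<le> C * norm s0 * norm (deriv zeta s0)"
proof -
  define \<gamma> where "\<gamma> = Im s0"
  have s0: "s0 = Complex (1 / 2) \<gamma>" using zeta_zero_on_line[OF z im] by (simp add: \<gamma>_def complex_eq_iff)
  define s where "s d = Complex (1 / 2 + d) \<gamma>" for d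
  define x where "x d = complex_of_real (1 / 2 + d)" for d
  define D where "D = laplace_half fB"
  \<comment> \<open>The term with 1/zeta on the real axis. It stays bounded near 1/2 because
    \<open>zeta_regular\<close> does not vanish there, and so disappears after multiplication by
    d.\<close>
  define Q where "Q d = (x d - 1) / (x d * zeta_regular (x d))" for d
  have fBh: "D holomorphic_on {s. Re s > 1 / 2 - \<delta>}"
    unfolding D_def by (intro laplace_half_holomorphic conv_fB[where c = "1 / 2", OF conv_mertens_half]) auto
  have isC: "isCont D w" if "Re w > 1 / 2 - \<delta>" for w
    using fBh that by (intro holomorphic_on_imp_continuous_on[THEN continuous_on_interior]) (auto simp: interior_open open_halfspace_Re_gt)
  have xt: "(x \<longlongrightarrow> of_real (1 / 2)) (at_right 0)" unfolding x_def
    by (rule tendsto_eq_intros refl | simp)+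
  have st: "(s \<longlongrightarrow> s0) (at_right 0)"
  proof -
    have "((\<lambda>d. s0 + of_real d) \<longlongrightarrow> s0 + of_real 0) (at_right 0)" by (intro tendsto_intros)
    moreover have "s0 + of_real d = s d" for d by (simp add: s0 s_def complex_eq_iff)
    ultimately show ?thesis by simp
  qed
  have Dx: "((\<lambda>d. D (x d)) \<longlongrightarrow> D (of_real (1 / 2))) (at_right 0)"
    using \<delta> by (intro isCont_tendsto_compose[OF isC xt]) auto
  have Ds: "((\<lambda>d. D (s d)) \<longlongrightarrow> D s0) (at_right 0)"
    using \<delta> by (intro isCont_tendsto_compose[OF isC st]) (auto simp: s0)
  have Qt: "(Q \<longlongrightarrow> (of_real (1 / 2) - 1) / (of_real (1 / 2) * zeta_regular (of_real (1 / 2)))) (at_right 0)"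
  proof -
    have "isCont zeta_regular (of_real (1 / 2))"
      using zeta_regular_holomorphic
      by (intro holomorphic_on_imp_continuous_on[THEN continuous_on_interior]) (auto simp: interior_open open_halfspace_Re_gt)
    hence "((\<lambda>d. zeta_regular (x d)) \<longlongrightarrow> zeta_regular (of_real (1 / 2))) (at_right 0)"
      by (rule isCont_tendsto_compose[OF _ xt])
    moreover have "zeta_regular (of_real (1 / 2)) \<noteq> 0" by (rule zeta_regular_nonzero_real) auto
    ultimately show ?thesis unfolding Q_def by (intro tendsto_intros xt) auto
  qed
  have ss: "s d - s0 = of_real d" for d by (simp add: s_def s0 complex_eq_iff)
  \<comment> \<open>d times the bounds for everything except the term 1 / (s zeta s). It tends to C:
    s0 is not real, so |C| / |s d - 1/2| stays bounded, and on the real axis d (C / d) = C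
    survives.\<close>
  define R where "R d = \<bar>C\<bar> * (d / norm (s d - 1 / 2)) + d * norm (D (s d)) + (C - Re (of_real d * (of_real \<tau> * Q d + D (x d))))" for d
  have key: "d / norm (s d * zeta (s d)) \<le> R d" if d: "d > 0" for d
  proof -
    have re: "Re (s d) > 1 / 2" "Re (x d) > 1 / 2" using d by (auto simp: s_def x_def)
    have sd1: "s d \<noteq> 1" using im by (auto simp: s_def \<gamma>_def complex_eq_iff)
    have fNc: "laplace_half_conv fN (1 / 2 + d)"
      unfolding fN_def[abs_def] using d \<delta>
      by (intro laplace_half_conv_linear conv_f conv_mertens_half conv_fB[where c = "1 / 2", OF conv_mertens_half]) auto
    have "norm (laplace_half fN (s d)) \<le> (\<integral>u. \<bar>fN u\<bar> * exp (- ((1 / 2 + d) * u)) \<partial>halfline)"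
      by (rule norm_laplace_le) (auto simp: fNc s_def)
    also have "\<dots> = Re (laplace_half fN (x d))"
      unfolding x_def laplace_of_real using fN_nonneg by simp
    finally have le: "norm (laplace_half fN (s d)) \<le> Re (laplace_half fN (x d))" .
    have e1: "laplace_half fN (s d) = of_real C / (s d - 1 / 2) - of_real \<tau> * (1 / (s d * zeta (s d))) - D (s d)"
    proof -
      have "(s d - 1) / (s d * zeta_regular (s d)) = 1 / (s d * zeta (s d))"
        using sd1 re by (subst zeta_regular_eq) auto
      thus ?thesis using laplace_fN[OF conv_mertens_half _ re(1)] by (simp add: D_def)
    qed
    have e2: "laplace_half fN (x d) = of_real C / of_real d - (of_real \<tau> * Q d + D (x d))"
      using laplace_fN[OF conv_mertens_half _ re(2)] by (simp add: D_def Q_def x_def)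
    have "norm (1 / (s d * zeta (s d))) = norm (of_real \<tau> * (1 / (s d * zeta (s d))))"
      by (simp only: norm_mult norm_of_real \<tau> mult_1)
    also have "of_real \<tau> * (1 / (s d * zeta (s d))) = of_real C / (s d - 1 / 2) - laplace_half fN (s d) - D (s d)"
      unfolding e1 by simp
    also have "norm \<dots> \<le> norm (of_real C / (s d - 1 / 2)) + norm (laplace_half fN (s d)) + norm (D (s d))"
      by (meson add_right_mono norm_triangle_ineq4 order_trans)
    also have "\<dots> \<le> \<bar>C\<bar> / norm (s d - 1 / 2) + Re (laplace_half fN (x d)) + norm (D (s d))"
      using le by (simp add: norm_divide)
    finally have "d * norm (1 / (s d * zeta (s d))) \<le> d * (\<bar>C\<bar> / norm (s d - 1 / 2) + Re (laplace_half fN (x d)) + norm (D (s d)))"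
      using d by (intro mult_left_mono) auto
    moreover have "d * Re (laplace_half fN (x d)) = C - Re (of_real d * (of_real \<tau> * Q d + D (x d)))"
    proof -
      have "of_real d * laplace_half fN (x d) = of_real C - of_real d * (of_real \<tau> * Q d + D (x d))"
        unfolding e2 using d by (simp add: right_diff_distrib)
      moreover have "d * Re (laplace_half fN (x d)) = Re (of_real d * laplace_half fN (x d))" by simp
      ultimately show ?thesis by simp
    qed
    ultimately show ?thesis by (simp add: R_def norm_divide algebra_simps)
  qed
  have Rt: "(R \<longlongrightarrow> C) (at_right 0)"
  proof -
    have dt: "((\<lambda>d::real. d) \<longlongrightarrow> 0) (at_right 0)" by (rule tendsto_ident_at)
    have n: "norm (s0 - 1 / 2) \<noteq> 0"
    proof
      assume "norm (s0 - 1 / 2) = 0"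
      hence "s0 = 1 / 2" by simp
      hence "Im s0 = Im (1 / 2 :: complex)" by (rule arg_cong)
      thus False using im by simp
    qed
    have t1: "((\<lambda>d. \<bar>C\<bar> * (d / norm (s d - 1 / 2))) \<longlongrightarrow> \<bar>C\<bar> * (0 / norm (s0 - 1 / 2))) (at_right 0)"
      by (intro tendsto_mult tendsto_const tendsto_divide dt tendsto_norm tendsto_diff st n)
    have t2: "((\<lambda>d. d * norm (D (s d))) \<longlongrightarrow> 0 * norm (D s0)) (at_right 0)"
      by (intro tendsto_mult dt tendsto_norm Ds)
    note t3 = tendsto_mult[OF tendsto_of_real[OF dt] tendsto_add[OF tendsto_mult[OF tendsto_const[of "of_real \<tau>"] Qt] Dx]]
    note tendsto_add[OF tendsto_add[OF t1 t2] tendsto_diff[OF tendsto_const[of C] tendsto_Re[OF t3]]]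
    thus ?thesis unfolding R_def by simp
  qed
  have "(zeta has_field_derivative deriv zeta s0) (at s0)"
    using im by (intro holomorphic_derivI[OF zeta_holomorphic]) (auto simp: complex_eq_iff)
  hence "((\<lambda>w. (zeta w - zeta s0) / (w - s0)) \<longlongrightarrow> deriv zeta s0) (at s0)"
    by (simp add: has_field_derivative_iff)
  moreover have "filterlim s (at s0) (at_right 0)"
    unfolding filterlim_at using st ss
    by (auto simp: eventually_at_right_less intro!: eventually_at_rightI[of 0 1]) (metis cancel_comm_monoid_add_class.diff_cancel less_irrefl of_real_eq_0_iff)
  ultimately have "((\<lambda>d. (zeta (s d) - zeta s0) / (s d - s0)) \<longlongrightarrow> deriv zeta s0) (at_right 0)"
    by (rule filterlim_compose)
  hence zt: "((\<lambda>d. norm (zeta (s d) / of_real d)) \<longlongrightarrow> norm (deriv zeta s0)) (at_right 0)"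
    unfolding ss z by (intro tendsto_norm) simp
  have "((\<lambda>d. R d * norm (s d) * norm (zeta (s d) / of_real d)) \<longlongrightarrow> C * norm s0 * norm (deriv zeta s0)) (at_right 0)"
    by (intro tendsto_intros Rt st zt)
  moreover have "\<forall>\<^sub>F d in at_right 0. 1 \<le> R d * norm (s d) * norm (zeta (s d) / of_real d)"
  proof (rule eventually_at_rightI[of 0 1])
    fix d :: real assume "d \<in> {0<..<1}"
    hence d: "d > 0" by simp
    have "zeta (s d) \<noteq> 0" using d im by (intro zeta_nonzero_right) (auto simp: s_def \<gamma>_def complex_eq_iff)
    moreover have "s d \<noteq> 0" using d by (auto simp: s_def complex_eq_iff)
    ultimately have p: "norm (s d * zeta (s d)) > 0" by simp
    have "1 = d / norm (s d * zeta (s d)) * (norm (s d * zeta (s d)) / d)" using p d by simp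
    also have "\<dots> \<le> R d * (norm (s d * zeta (s d)) / d)" using key[OF d] d by (intro mult_right_mono) auto
    also have "\<dots> = R d * norm (s d) * norm (zeta (s d) / of_real d)" using d by (simp add: norm_mult norm_divide)
    finally show "1 \<le> R d * norm (s d) * norm (zeta (s d) / of_real d)" .
  qed simp
  ultimately show ?thesis by (intro tendsto_lowerbound[of _ _ "at_right (0::real)"]) auto
qed

text \<open>The derivative bound shows that the zero is simple, so the residue of 1/zeta is the
  reciprocal of the derivative of zeta at s0.\<close>

lemma residue_le:
  assumes z: "zeta s0 = 0" and im: "Im s0 > 0"
  shows "norm (residue (\<lambda>s. 1 / zeta s) s0) / norm s0 \<le> C"
proof -
  have nz: "deriv zeta s0 \<noteq> 0" "s0 \<noteq> 0" using deriv_zeta_bound[OF z im] by auto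
  have "residue (\<lambda>s. 1 / zeta s) s0 = 1 / deriv zeta s0"
  proof (rule residue_simple_pole_deriv[where s = "- {1}" and f = "\<lambda>_. 1"])
    show "(zeta has_field_derivative deriv zeta s0) (at s0)"
      using im by (intro holomorphic_derivI[OF zeta_holomorphic]) (auto simp: complex_eq_iff)
    show "connected (- {1::complex})" by (rule connected_punctured_universe) simp
  qed (use im z nz zeta_holomorphic in \<open>auto simp: complex_eq_iff\<close>)
  hence "norm (residue (\<lambda>s. 1 / zeta s) s0) / norm s0 = 1 / (norm s0 * norm (deriv zeta s0))"
    by (simp add: norm_divide)
  also have "\<dots> \<le> C" using deriv_zeta_bound[OF z im] nz by (simp add: divide_le_eq mult.assoc)
  finally show ?thesis .
qed

end

section \<open>Return to Lebesgue measure in the variable x\<close>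

definition excess_set :: "real \<Rightarrow> real \<Rightarrow> real set" where
  "excess_set \<tau> C = {x. x \<ge> 1 \<and> \<tau> * Delta x > C * x powr (1 / 2)}"

lemma A1_eq_excess_set: "A1 l e = excess_set 1 (l - e)"
  by (simp add: A1_def excess_set_def)

lemma A2_eq_excess_set: "A2 l e = excess_set (- 1) (l - e)"
  by (auto simp: A2_def excess_set_def algebra_simps)

text \<open>Off the integers no term carries the weight 1/2.\<close>

lemma Delta_eq_mertens:
  assumes "x \<ge> 1" "x \<notin> \<nat>"
  shows "Delta x = mertens (ln x)"
proof -
  have "real n \<noteq> x" for n using assms by auto
  thus ?thesis using assms by (simp add: Delta_def star_sum_def summatory_def)
qed

text \<open>The two sets can differ only at natural numbers, where the half weight enters, and these
  form a null set. The interval is bounded, so nothing is lost between \<open>measure\<close> and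
  \<open>emeasure\<close>.\<close>

lemma emeasure_excess_set:
  assumes T: "T \<ge> 1"
  shows "emeasure lborel {x\<in>{T..2 * T}. \<tau> * mertens (ln x) > C * exp (1 / 2 * ln x)} =
    ennreal (measure lebesgue (excess_set \<tau> C \<inter> {T..2 * T}))"
proof -
  define S where "S = {x\<in>{T..2 * T}. \<tau> * mertens (ln x) > C * exp (1 / 2 * ln x)}"
  have [measurable]: "S \<in> sets borel" unfolding S_def by measurable
  have neg: "negligible (S - excess_set \<tau> C \<inter> {T..2 * T} \<union> (excess_set \<tau> C \<inter> {T..2 * T} - S))"
  proof (rule negligible_subset[of \<nat>])
    show "negligible (\<nat> :: real set)" 
      unfolding negligible_iff_null_sets
      by (intro null_sets_completionI countable_imp_null_set_lborel) (simp add: Nats_def)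
    show "S - excess_set \<tau> C \<inter> {T..2 * T} \<union> (excess_set \<tau> C \<inter> {T..2 * T} - S) \<subseteq> \<nat>"
    proof
      fix x assume x: "x \<in> S - excess_set \<tau> C \<inter> {T..2 * T} \<union> (excess_set \<tau> C \<inter> {T..2 * T} - S)"
      show "x \<in> \<nat>"
      proof (rule ccontr)
        assume "x \<notin> \<nat>"
        moreover have "x \<ge> 1" using x T by (auto simp: S_def)
        moreover from this have "x powr (1 / 2) = exp (1 / 2 * ln x)" by (simp add: powr_def)
        ultimately show False using x T by (auto simp: S_def excess_set_def Delta_eq_mertens)
      qed
    qed
  qed
  have fin: "emeasure lborel S < \<infinity>"
  proof -
    have "emeasure lborel S \<le> emeasure lborel {T..2 * T}" by (intro emeasure_mono) (auto simp: S_def)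
    also have "\<dots> < \<infinity>" using T by simp
    finally show ?thesis .
  qed
  have "S \<in> lmeasurable" by (rule fmeasurableI) (use fin in auto)
  hence "measure lebesgue (excess_set \<tau> C \<inter> {T..2 * T}) = measure lebesgue S"
    by (rule measure_negligible_symdiff[OF _ neg])
  also have "\<dots> = measure lborel S" by (simp add: measure_completion)
  finally have "ennreal (measure lebesgue (excess_set \<tau> C \<inter> {T..2 * T})) = emeasure lborel S"
    using fin by (simp add: emeasure_eq_ennreal_measure)
  thus ?thesis by (simp add: S_def)
qed

text \<open>If the upper limit is at most 0, the quotient is below 1 from some T on. This is the
  sparsity assumption with \<delta> = \<epsilon>, under which the residue quotient is at most C,
  against the choice of C.\<close>

lemma excess_set_is_Omega:
  assumes z: "zeta s0 = 0" "Im s0 > 0" and \<tau>: "\<bar>\<tau>\<bar> = 1"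
    and C: "C < norm (residue (\<lambda>s. 1 / zeta s) s0) / norm s0" and \<epsilon>: "\<epsilon> > 0"
  shows "is_Omega (\<lambda>T. measure lebesgue (excess_set \<tau> C \<inter> {T..2 * T})) (\<lambda>T. T powr (1 - \<epsilon>))"
proof (rule ccontr)
  define m where "m T = measure lebesgue (excess_set \<tau> C \<inter> {T..2 * T})" for T
  assume "\<not> is_Omega (\<lambda>T. measure lebesgue (excess_set \<tau> C \<inter> {T..2 * T})) (\<lambda>T. T powr (1 - \<epsilon>))"
  hence "Limsup at_top (\<lambda>T. ereal (m T / T powr (1 - \<epsilon>))) \<le> 0" by (simp add: is_Omega_def m_def not_less)
  also have "\<dots> < 1" by simp
  finally have "\<forall>\<^sub>F T in at_top. ereal (m T / T powr (1 - \<epsilon>)) < 1" by (rule Limsup_lessD)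
  then obtain T1 where T1: "\<And>T. T \<ge> T1 \<Longrightarrow> m T / T powr (1 - \<epsilon>) < 1"
    unfolding eventually_at_top_linorder by auto
  interpret sparse_excess \<tau> C \<epsilon> "max 1 T1"
  proof
    fix T assume T: "T \<ge> max 1 T1"
    have "m T \<le> T powr (1 - \<epsilon>)" using T1[of T] T by (simp add: divide_less_eq)
    thus "emeasure lborel {x\<in>{T..2 * T}. \<tau> * mertens (ln x) > C * exp (1 / 2 * ln x)} \<le> ennreal (T powr (1 - \<epsilon>))"
      using T by (subst emeasure_excess_set) (auto simp: m_def ennreal_leI)
  qed (use \<tau> \<epsilon> in auto)
  show False using residue_le[OF z] C by simp
qed

theorem mainTheorem6:
  fixes s0 :: complex and lam eps0 :: real
  assumes "is_first_zeta_zero s0"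
    and "lam = norm (residue (\<lambda>s. 1 / zeta s) s0) / norm s0"
    and "0 < eps0" and "eps0 < lam"
  shows "\<forall>\<epsilon>>0. is_Omega (\<lambda>T. measure lebesgue (A1 lam eps0 \<inter> {T..2 * T})) (\<lambda>T. T powr (1 - \<epsilon>)) \<and>
               is_Omega (\<lambda>T. measure lebesgue (A2 lam eps0 \<inter> {T..2 * T})) (\<lambda>T. T powr (1 - \<epsilon>))"
proof (intro allI impI)
  fix \<epsilon> :: real assume \<epsilon>: "\<epsilon> > 0"
  have z: "zeta s0 = 0" "Im s0 > 0"
    using assms(1) by (auto simp: is_first_zeta_zero_def is_arg_min_def nontrivial_zeta_zero_def)
  have C: "lam - eps0 < norm (residue (\<lambda>s. 1 / zeta s) s0) / norm s0" using assms(2,3) by simp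
  show "is_Omega (\<lambda>T. measure lebesgue (A1 lam eps0 \<inter> {T..2 * T})) (\<lambda>T. T powr (1 - \<epsilon>)) \<and>
        is_Omega (\<lambda>T. measure lebesgue (A2 lam eps0 \<inter> {T..2 * T})) (\<lambda>T. T powr (1 - \<epsilon>))"
    unfolding A1_eq_excess_set A2_eq_excess_set
    by (intro conjI excess_set_is_Omega[OF z _ C \<epsilon>]) auto
qed

end
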